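(* Let $\mathfrak g$ be a finite-dimensional Lie superalgebra over an algebraically closed field $k$ of characteristic zero, and let $\phi$ be an automorphism of $\mathfrak g$ fixing $\mathfrak g_{\overline 0}$ pointwise. If $\phi(x)=x$ implies $x\in\mathfrak g_{\overline 0}$, then, under the $\phi$-twisted adjoint action, there is an isomorphism of $\mathfrak g$-modules $\mathcal U\mathfrak g\cong\operatorname{Ind}_{\mathfrak g_{\overline 0}}^{\mathfrak g}\mathcal U\mathfrak g_{\overline 0}$.
   Context: The $\phi$-twisted adjoint action of $\mathfrak g$ on its enveloping algebra $\mathcal U\mathfrak g$ is $\operatorname{ad}_\phi(u)(v)=uv-(-1)^{\overline u\,\overline v}v\phi(u)$ for homogeneous $u\in\mathfrak g$, $v\in\mathcal U\mathfrak g$. $\mathcal U\mathfrak g_{\overline 0}$ carries the adjoint action of $\mathfrak g_{\overline 0}$, and $\operatorname{Ind}_{\mathfrak g_{\overline 0}}^{\mathfrak g}V_0=\mathcal U\mathfrak g\otimes_{\mathcal U\mathfrak g_{\overline 0}}V_0$ with $\mathfrak g$ acting by left multiplication. *)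

theory Defs
  imports
    "HOL-Algebra.Algebraic_Closure_Type"
    "HOL-Algebra.QuotRing"
    "HOL-Algebra.Module"
    "HOL-Library.Poly_Mapping"
    "HOL-Library.Z2"
begin

section \<open>Lie superalgebras\<close>

text \<open>Parities are elements of the two-element field \<^typ>\<open>bit\<close>. The sign below is
  $(-1)^{pq}$.\<close>

definition parity_sign :: "bit \<Rightarrow> bit \<Rightarrow> 'k::field" where
  "parity_sign p q = (if p = 1 \<and> q = 1 then - 1 else 1)"

text \<open>A Lie superalgebra lives on a subspace of an ambient vector space (the type \<open>'g\<close>), so that
  the even part of a Lie superalgebra is again a Lie superalgebra over the same type.\<close>

record ('k, 'g) lie_super =
  lscale :: "'k \<Rightarrow> 'g \<Rightarrow> 'g"
  lpart :: "bit \<Rightarrow> 'g set"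
  lbracket :: "'g \<Rightarrow> 'g \<Rightarrow> 'g"

definition lcarrier :: "('k, 'g::ab_group_add) lie_super \<Rightarrow> 'g set" where
  "lcarrier L = {x + y |x y. x \<in> lpart L 0 \<and> y \<in> lpart L 1}"

text \<open>These are the axioms in characteristic zero; in characteristic 2 or 3 further axioms
  would be needed.\<close>

locale lie_superalgebra =
  fixes L :: "('k::field_char_0, 'g::ab_group_add) lie_super"
  assumes scale: "vector_space (lscale L)"
    and part_subspace: "\<And>p. module.subspace (lscale L) (lpart L p)"
    and part_direct: "lpart L 0 \<inter> lpart L 1 = {0}"
    and bracket_add_left: "\<And>x y z. \<lbrakk>x \<in> lcarrier L; y \<in> lcarrier L; z \<in> lcarrier L\<rbrakk> \<Longrightarrow>
          lbracket L (x + y) z = lbracket L x z + lbracket L y z"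
    and bracket_add_right: "\<And>x y z. \<lbrakk>x \<in> lcarrier L; y \<in> lcarrier L; z \<in> lcarrier L\<rbrakk> \<Longrightarrow>
          lbracket L x (y + z) = lbracket L x y + lbracket L x z"
    and bracket_scale_left: "\<And>c x y. \<lbrakk>x \<in> lcarrier L; y \<in> lcarrier L\<rbrakk> \<Longrightarrow>
          lbracket L (lscale L c x) y = lscale L c (lbracket L x y)"
    and bracket_scale_right: "\<And>c x y. \<lbrakk>x \<in> lcarrier L; y \<in> lcarrier L\<rbrakk> \<Longrightarrow>
          lbracket L x (lscale L c y) = lscale L c (lbracket L x y)"
    and bracket_parity: "\<And>p q x y. \<lbrakk>x \<in> lpart L p; y \<in> lpart L q\<rbrakk> \<Longrightarrow>
          lbracket L x y \<in> lpart L (p + q)"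
    and bracket_skew: "\<And>p q x y. \<lbrakk>x \<in> lpart L p; y \<in> lpart L q\<rbrakk> \<Longrightarrow>
          lbracket L x y = - lscale L (parity_sign p q) (lbracket L y x)"
    and bracket_jacobi: "\<And>p q r x y z. \<lbrakk>x \<in> lpart L p; y \<in> lpart L q; z \<in> lpart L r\<rbrakk> \<Longrightarrow>
          lbracket L x (lbracket L y z) =
            lbracket L (lbracket L x y) z +
            lscale L (parity_sign p q) (lbracket L y (lbracket L x z))"

definition finite_dimensional :: "('k::field, 'g::ab_group_add) lie_super \<Rightarrow> bool" where
  "finite_dimensional L \<longleftrightarrow> (\<exists>B. finite B \<and> module.span (lscale L) B = lcarrier L)"

definition even_part :: "('k, 'g::ab_group_add) lie_super \<Rightarrow> ('k, 'g) lie_super" where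
  "even_part L = L\<lparr>lpart := (\<lambda>p. if p = 0 then lpart L 0 else {0})\<rparr>"

definition lie_automorphism :: "('k, 'g::ab_group_add) lie_super \<Rightarrow> ('g \<Rightarrow> 'g) \<Rightarrow> bool" where
  "lie_automorphism L \<phi> \<longleftrightarrow>
     bij_betw \<phi> (lcarrier L) (lcarrier L) \<and>
     (\<forall>x\<in>lcarrier L. \<forall>y\<in>lcarrier L. \<phi> (x + y) = \<phi> x + \<phi> y) \<and>
     (\<forall>c. \<forall>x\<in>lcarrier L. \<phi> (lscale L c x) = lscale L c (\<phi> x)) \<and>
     (\<forall>p. \<phi> ` lpart L p \<subseteq> lpart L p) \<and>
     (\<forall>x\<in>lcarrier L. \<forall>y\<in>lcarrier L. \<phi> (lbracket L x y) = lbracket L (\<phi> x) (\<phi> y))"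


section \<open>Super vector spaces and modules over a Lie superalgebra\<close>

text \<open>Vector spaces with an explicit carrier are modules over
  \<^const>\<open>ring_of_type_algebra\<close>, the base field as a ring record. The record type also has
  fields \<open>mult\<close> and \<open>one\<close>: these are the product and unit when the space is an algebra, and
  carry no information otherwise.\<close>

record ('k, 'v) superspace = "('k, 'v) module" +
  gpart :: "bit \<Rightarrow> 'v set"

record ('k, 'v, 'g) lie_rep = "('k, 'v) superspace" +
  act :: "'g \<Rightarrow> 'v \<Rightarrow> 'v"

locale lie_module =
  fixes L :: "('k::field_char_0, 'g::ab_group_add) lie_super"
    and M :: "('k, 'v, 'g) lie_rep" (structure)
  assumes vspace: "Module.module (ring_of_type_algebra :: 'k ring) M"
    and part_submodule: "\<And>p. submodule (gpart M p) (ring_of_type_algebra :: 'k ring) M"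
    and part_sum: "carrier M = gpart M 0 <+> gpart M 1"
    and part_direct: "gpart M 0 \<inter> gpart M 1 = {\<zero>}"
    and act_add_left: "\<And>x y v. \<lbrakk>x \<in> lcarrier L; y \<in> lcarrier L; v \<in> carrier M\<rbrakk> \<Longrightarrow>
          act M (x + y) v = act M x v \<oplus> act M y v"
    and act_scale_left: "\<And>c x v. \<lbrakk>x \<in> lcarrier L; v \<in> carrier M\<rbrakk> \<Longrightarrow>
          act M (lscale L c x) v = c \<odot> act M x v"
    and act_add_right: "\<And>x v w. \<lbrakk>x \<in> lcarrier L; v \<in> carrier M; w \<in> carrier M\<rbrakk> \<Longrightarrow>
          act M x (v \<oplus> w) = act M x v \<oplus> act M x w"
    and act_scale_right: "\<And>c x v. \<lbrakk>x \<in> lcarrier L; v \<in> carrier M\<rbrakk> \<Longrightarrow>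
          act M x (c \<odot> v) = c \<odot> act M x v"
    and act_parity: "\<And>p q x v. \<lbrakk>x \<in> lpart L p; v \<in> gpart M q\<rbrakk> \<Longrightarrow>
          act M x v \<in> gpart M (p + q)"
    and act_bracket: "\<And>p q x y v. \<lbrakk>x \<in> lpart L p; y \<in> lpart L q; v \<in> carrier M\<rbrakk> \<Longrightarrow>
          act M (lbracket L x y) v =
            act M x (act M y v) \<ominus> parity_sign p q \<odot> act M y (act M x v)"

definition lie_module_iso ::
  "('k::field_char_0, 'g::ab_group_add) lie_super \<Rightarrow> ('k, 'v, 'g) lie_rep \<Rightarrow>
     ('k, 'w, 'g) lie_rep \<Rightarrow> ('v \<Rightarrow> 'w) set" where
  "lie_module_iso L M N =
     {f. bij_betw f (carrier M) (carrier N) \<and>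
         (\<forall>v\<in>carrier M. \<forall>w\<in>carrier M. f (v \<oplus>\<^bsub>M\<^esub> w) = f v \<oplus>\<^bsub>N\<^esub> f w) \<and>
         (\<forall>c. \<forall>v\<in>carrier M. f (c \<odot>\<^bsub>M\<^esub> v) = c \<odot>\<^bsub>N\<^esub> f v) \<and>
         (\<forall>p. f ` gpart M p \<subseteq> gpart N p) \<and>
         (\<forall>x\<in>lcarrier L. \<forall>v\<in>carrier M. f (act M x v) = act N x (f v))}"

definition lie_module_isomorphic ::
  "('k::field_char_0, 'g::ab_group_add) lie_super \<Rightarrow> ('k, 'v, 'g) lie_rep \<Rightarrow>
     ('k, 'w, 'g) lie_rep \<Rightarrow> bool" where
  "lie_module_isomorphic L M N \<longleftrightarrow>
     lie_module L M \<and> lie_module L N \<and> lie_module_iso L M N \<noteq> {}"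


section \<open>Free and quotient vector spaces\<close>

definition pm_scale :: "'k::field \<Rightarrow> ('b \<Rightarrow>\<^sub>0 'k) \<Rightarrow> ('b \<Rightarrow>\<^sub>0 'k)" where
  "pm_scale c f = Poly_Mapping.map ((*) c) f"

definition free_space :: "'b set \<Rightarrow> ('k::field, 'b \<Rightarrow>\<^sub>0 'k) module" where
  "free_space B = \<lparr>carrier = {f. Poly_Mapping.keys f \<subseteq> B}, monoid.mult = undefined, one = undefined,
     ring.zero = 0, add = (+), module.smult = pm_scale\<rparr>"

text \<open>The quotient by \<open>W\<close> has the cosets of \<open>W\<close> as elements. Its part of parity \<open>p\<close> is the image
  of the span of a prescribed set \<open>H p\<close> of basis vectors.\<close>

definition super_quotient ::
  "('k::field, 'b \<Rightarrow>\<^sub>0 'k) module \<Rightarrow> ('b \<Rightarrow>\<^sub>0 'k) set \<Rightarrow> (bit \<Rightarrow> 'b set) \<Rightarrow>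
     ('k, ('b \<Rightarrow>\<^sub>0 'k) set) superspace" where
  "super_quotient F W H = ring.extend (F Quot W)
     \<lparr>module.smult = (\<lambda>c A. \<Union>a\<in>A. W +>\<^bsub>F\<^esub> (c \<odot>\<^bsub>F\<^esub> a)),
      gpart = (\<lambda>p. (\<lambda>f. W +>\<^bsub>F\<^esub> f) ` {f. Poly_Mapping.keys f \<subseteq> H p})\<rparr>"


section \<open>The enveloping algebra\<close>

text \<open>Words form the free monoid; written additively, because finitely supported functions on an
  additively written monoid carry the convolution product.\<close>

datatype 'a tword = TWord (letters: "'a list")

instantiation tword :: (type) monoid_add
begin

definition zero_tword :: "'a tword" where
  "zero_tword = TWord []"

definition plus_tword :: "'a tword \<Rightarrow> 'a tword \<Rightarrow> 'a tword" where
  "plus_tword v w = TWord (letters v @ letters w)"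

instance
  by standard (simp_all add: zero_tword_def plus_tword_def)

end

type_synonym ('k, 'g) env_elem = "('g tword \<Rightarrow>\<^sub>0 'k) set"

definition free_algebra :: "'g set \<Rightarrow> ('k::field, 'g tword \<Rightarrow>\<^sub>0 'k) module" where
  "free_algebra A = (free_space {w. set (letters w) \<subseteq> A})\<lparr>monoid.mult := (*), one := 1\<rparr>"

definition letter :: "'g \<Rightarrow> ('g tword \<Rightarrow>\<^sub>0 'k::field)" where
  "letter x = Poly_Mapping.single (TWord [x]) 1"

text \<open>The first two families of relations cut the free algebra on the set \<open>lcarrier L\<close> down to
  the tensor algebra of the vector space \<open>lcarrier L\<close>; the last one is
  $xy - (-1)^{pq} yx = [x,y]$.\<close>

definition env_relations ::
  "('k::field, 'g::ab_group_add) lie_super \<Rightarrow> ('g tword \<Rightarrow>\<^sub>0 'k) set" where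
  "env_relations L =
     {letter (x + y) - letter x - letter y |x y. x \<in> lcarrier L \<and> y \<in> lcarrier L} \<union>
     {letter (lscale L c x) - pm_scale c (letter x) |c x. x \<in> lcarrier L} \<union>
     {letter x * letter y - pm_scale (parity_sign p q) (letter y * letter x)
        - letter (lbracket L x y) |p q x y. x \<in> lpart L p \<and> y \<in> lpart L q}"

definition env_ideal ::
  "('k::field, 'g::ab_group_add) lie_super \<Rightarrow> ('g tword \<Rightarrow>\<^sub>0 'k) set" where
  "env_ideal L = Idl\<^bsub>free_algebra (lcarrier L)\<^esub> (env_relations L)"

definition word_part :: "('k, 'g) lie_super \<Rightarrow> bit \<Rightarrow> 'g tword set" where
  "word_part L p =
     {TWord xs |xs. \<exists>ps. list_all2 (\<lambda>x q. x \<in> lpart L q) xs ps \<and> sum_list ps = p}"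

definition enveloping_algebra ::
  "('k::field, 'g::ab_group_add) lie_super \<Rightarrow> ('k, ('k, 'g) env_elem) superspace" where
  "enveloping_algebra L =
     super_quotient (free_algebra (lcarrier L)) (env_ideal L) (word_part L)"

definition env_class ::
  "('k::field, 'g::ab_group_add) lie_super \<Rightarrow> ('g tword \<Rightarrow>\<^sub>0 'k) \<Rightarrow> ('k, 'g) env_elem" where
  "env_class L f = env_ideal L +>\<^bsub>free_algebra (lcarrier L)\<^esub> f"

definition env_embed ::
  "('k::field, 'g::ab_group_add) lie_super \<Rightarrow> 'g \<Rightarrow> ('k, 'g) env_elem" where
  "env_embed L x = env_class L (letter x)"

text \<open>The map from the enveloping algebra of the even part induced by the inclusion of Lie
  superalgebras.\<close>

definition env_incl ::
  "('k::field, 'g::ab_group_add) lie_super \<Rightarrow> ('k, 'g) env_elem \<Rightarrow> ('k, 'g) env_elem" where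
  "env_incl L A = (\<Union>a\<in>A. env_class L a)"

text \<open>The action of the enveloping algebra on a module over the Lie superalgebra. On an actual
  module all representatives of an element of the enveloping algebra act in the same way.\<close>

definition free_act ::
  "('k::field, 'v, 'g) lie_rep \<Rightarrow> ('g tword \<Rightarrow>\<^sub>0 'k) \<Rightarrow> 'v \<Rightarrow> 'v" where
  "free_act M f v = (\<Oplus>\<^bsub>M\<^esub>w\<in>Poly_Mapping.keys f.
     Poly_Mapping.lookup f w \<odot>\<^bsub>M\<^esub> foldr (act M) (letters w) v)"

definition env_act :: "('k::field, 'v, 'g) lie_rep \<Rightarrow> ('k, 'g) env_elem \<Rightarrow> 'v \<Rightarrow> 'v" where
  "env_act M A v = the_elem ((\<lambda>f. free_act M f v) ` A)"


section \<open>The twisted adjoint action\<close>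

definition hom_component ::
  "('v \<Rightarrow> 'v \<Rightarrow> 'v) \<Rightarrow> (bit \<Rightarrow> 'v set) \<Rightarrow> bit \<Rightarrow> 'v \<Rightarrow> 'v" where
  "hom_component pls part p v = (THE a. a \<in> part p \<and> (\<exists>b\<in>part (p + 1). v = pls a b))"

text \<open>The formula for homogeneous elements, extended bilinearly.\<close>

definition twisted_adjoint ::
  "('k::field, 'g::ab_group_add) lie_super \<Rightarrow> ('g \<Rightarrow> 'g) \<Rightarrow>
     ('k, ('k, 'g) env_elem, 'g) lie_rep" where
  "twisted_adjoint L \<phi> = (let U = enveloping_algebra L in
     superspace.extend U
       \<lparr>act = (\<lambda>u v. \<Oplus>\<^bsub>U\<^esub>p\<in>UNIV. \<Oplus>\<^bsub>U\<^esub>q\<in>UNIV.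
          (let up = hom_component (+) (lpart L) p u; vq = hom_component (add U) (gpart U) q v
           in env_embed L up \<otimes>\<^bsub>U\<^esub> vq
              \<ominus>\<^bsub>U\<^esub> parity_sign p q \<odot>\<^bsub>U\<^esub> (vq \<otimes>\<^bsub>U\<^esub> env_embed L (\<phi> up))))\<rparr>)"

definition adjoint ::
  "('k::field, 'g::ab_group_add) lie_super \<Rightarrow> ('k, ('k, 'g) env_elem, 'g) lie_rep" where
  "adjoint L = twisted_adjoint L id"


section \<open>Tensor products and induced modules\<close>

text \<open>The tensor product of a right module \<open>M\<close>, with action \<open>ra\<close>, and a left module \<open>N\<close>, with action
  \<open>la\<close>, over the (noncommutative) algebra \<open>A\<close>: the free vector space on pairs modulo the usual
  relations.\<close>

definition tensor_relations ::
  "('k::field, 'a, 'x) module_scheme \<Rightarrow> ('k, 'u, 'y) module_scheme \<Rightarrow> ('u \<Rightarrow> 'a \<Rightarrow> 'u) \<Rightarrow>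
     ('k, 'v, 'z) module_scheme \<Rightarrow> ('a \<Rightarrow> 'v \<Rightarrow> 'v) \<Rightarrow> ('u \<times> 'v \<Rightarrow>\<^sub>0 'k) set" where
  "tensor_relations A M ra N la = (let pair = (\<lambda>u v. Poly_Mapping.single (u, v) 1) in
     {pair (u \<oplus>\<^bsub>M\<^esub> u') v - pair u v - pair u' v |u u' v.
        u \<in> carrier M \<and> u' \<in> carrier M \<and> v \<in> carrier N} \<union>
     {pair u (v \<oplus>\<^bsub>N\<^esub> v') - pair u v - pair u v' |u v v'.
        u \<in> carrier M \<and> v \<in> carrier N \<and> v' \<in> carrier N} \<union>
     {pair (c \<odot>\<^bsub>M\<^esub> u) v - pm_scale c (pair u v) |c u v. u \<in> carrier M \<and> v \<in> carrier N} \<union>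
     {pair u (c \<odot>\<^bsub>N\<^esub> v) - pm_scale c (pair u v) |c u v. u \<in> carrier M \<and> v \<in> carrier N} \<union>
     {pair (ra u a) v - pair u (la a v) |u a v.
        u \<in> carrier M \<and> a \<in> carrier A \<and> v \<in> carrier N})"

definition tensor_subspace ::
  "('k::field, 'a, 'x) module_scheme \<Rightarrow> ('k, 'u, 'y) module_scheme \<Rightarrow> ('u \<Rightarrow> 'a \<Rightarrow> 'u) \<Rightarrow>
     ('k, 'v, 'z) module_scheme \<Rightarrow> ('a \<Rightarrow> 'v \<Rightarrow> 'v) \<Rightarrow> ('u \<times> 'v \<Rightarrow>\<^sub>0 'k) set" where
  "tensor_subspace A M ra N la = module.span pm_scale (tensor_relations A M ra N la)"

definition tensor_product ::
  "('k::field, 'a, 'x) module_scheme \<Rightarrow> ('k, 'u, 'y) superspace_scheme \<Rightarrow> ('u \<Rightarrow> 'a \<Rightarrow> 'u) \<Rightarrow>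
     ('k, 'v, 'z) superspace_scheme \<Rightarrow> ('a \<Rightarrow> 'v \<Rightarrow> 'v) \<Rightarrow>
     ('k, ('u \<times> 'v \<Rightarrow>\<^sub>0 'k) set) superspace" where
  "tensor_product A M ra N la =
     super_quotient (free_space (carrier M \<times> carrier N)) (tensor_subspace A M ra N la)
       (\<lambda>p. \<Union>q. gpart M q \<times> gpart N (p + q))"

text \<open>\<open>V\<close> is a module over the even part of \<open>L\<close>. In the action, the inner sum is the linear
  extension of $u \otimes v \mapsto xu \otimes v$ to the free vector space on pairs.\<close>

definition induced_module ::
  "('k::field, 'g::ab_group_add) lie_super \<Rightarrow> ('k, 'v, 'g) lie_rep \<Rightarrow>
     ('k, (('k, 'g) env_elem \<times> 'v \<Rightarrow>\<^sub>0 'k) set, 'g) lie_rep" where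
  "induced_module L V = (let
       U = enveloping_algebra L;
       U0 = enveloping_algebra (even_part L);
       ra = (\<lambda>u a. u \<otimes>\<^bsub>U\<^esub> env_incl L a);
       la = env_act V;
       F = free_space (carrier U \<times> carrier V);
       W = tensor_subspace U0 U ra V la
     in superspace.extend (tensor_product U0 U ra V la)
       \<lparr>act = (\<lambda>x T. \<Union>t\<in>T. W +>\<^bsub>F\<^esub>
          (\<Sum>(u, v)\<in>Poly_Mapping.keys t.
             Poly_Mapping.single (env_embed L x \<otimes>\<^bsub>U\<^esub> u, v) (Poly_Mapping.lookup t (u, v))))\<rparr>)"

end

theory Submission
  imports Defs "HOL-Library.Function_Algebras"
begin

text \<open>Write \<open>U\<close> and \<open>V\<close> for the enveloping algebras of \<open>\<gg>\<close> and of its even part, \<open>ad\<close> for the twisted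
  adjoint action on \<open>U\<close>, and \<open>a\<^sub>x\<close> for the action of \<open>x\<close> on \<open>Ind = U \<otimes>\<^sub>V V\<close>. Since \<open>\<phi>\<close> is the identity
  on the even part, \<open>V \<rightarrow> U\<close> intertwines the adjoint actions of the even part, so Frobenius
  reciprocity extends it to a \<open>\<gg>\<close>-linear map \<open>Ind \<rightarrow> U\<close>, \<open>u \<otimes> v \<mapsto> ad(u)(v)\<close> (\<open>from_ind\<close>). The inverse is
  obtained from the universal property of \<open>U\<close>: it is enough to find operators \<open>\<lambda>\<^sub>x\<close> on \<open>Ind\<close> that play
  the role of left multiplication by \<open>x\<close> and satisfy the relations of \<open>\<gg>\<close>; then \<open>U \<rightarrow> Ind\<close> sends a
  product \<open>x\<^sub>1\<dots>x\<^sub>n\<close> to \<open>\<lambda>\<^sub>x\<^sub>1\<dots>\<lambda>\<^sub>x\<^sub>n(1 \<otimes> 1)\<close> (\<open>to_ind\<close>).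

  In \<open>U\<close> the operator \<open>ad(y)\<close> is left multiplication by \<open>y\<close> minus, up to sign, right multiplication
  by \<open>\<phi> y\<close>, so left multiplication by \<open>x\<close> commutes with \<open>ad(y)\<close> up to sign and up to left multiplication
  by \<open>[x, y]\<close>. As \<open>Ind\<close> is generated by the elements \<open>1 \<otimes> v\<close> under the \<open>a\<^sub>y\<close>, the operator \<open>\<lambda>\<^sub>x\<close> is
  determined by its values there. For even \<open>x\<close> the value is \<open>1 \<otimes> xv\<close>. For odd \<open>y\<close> it is an unknown
  \<open>L(v, y)\<close>, bilinear in \<open>v\<close> and \<open>y\<close>. A product \<open>v y\<close> with \<open>v\<close> in \<open>V\<close> can be rewritten, by moving \<open>y\<close> to
  the left, as a sum of products \<open>y' v'\<close>; let \<open>(\<tau> L)(v, y)\<close> be the corresponding sum of the \<open>L(v', y')\<close>.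
  Then \<open>ad(y)(v) = y v - v \<phi>(y)\<close> translates into \<open>L(v, y) = a\<^sub>y(1 \<otimes> v) + (\<tau> L)(v, \<phi> y)\<close>. Moving \<open>y\<close> across \<open>v\<close>
  changes the product only by terms with shorter \<open>v'\<close>, so to leading order the equation reads
  \<open>L(v, y - \<phi> y) = a\<^sub>y(1 \<otimes> v)\<close>. Here the hypotheses enter: \<open>1 - \<phi>\<close> is injective on the odd part, which has
  finite dimension, hence invertible there, and the equation has exactly one solution
  (\<open>sol_eq\<close>, \<open>tau_unique\<close>).

  Uniqueness gives the compatibility of \<open>L\<close> with the even part (\<open>lodd_ad0\<close>, \<open>lmul_lodd\<close>). Frobenius
  reciprocity with values in the module \<open>Hom(\<gg>, Ind)\<close> then extends the prescription on \<open>1 \<otimes> v\<close> to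
  operators \<open>\<lambda>\<^sub>x\<close> on \<open>Ind\<close> (\<open>lmul\<close>). In the relations of \<open>\<gg>\<close> for these operators the case of two odd
  elements is the essential one; by induction on the length of \<open>v\<close> it comes down to \<open>1 \<otimes> 1\<close>, where it says
  \<open>[x, y] = [\<phi> x, \<phi> y]\<close>, which holds because \<open>\<phi>\<close> fixes the even element \<open>[x, y]\<close> (\<open>super_rep_lmul\<close>). Finally
  \<open>from_ind\<close> turns \<open>\<lambda>\<^sub>x\<close> into left multiplication (\<open>from_ind_lmul\<close>), \<open>to_ind\<close> turns \<open>ad(x)\<close> into \<open>a\<^sub>x\<close>
  (\<open>to_ind_twad\<close>), and both composites are the identity because they are so on generators.

  This argument is carried out with operations that are defined everywhere. The bracket is extended
  to the ambient vector space through projections to the even and odd parts, and a quotient of a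
  vector space by \<open>W\<close> is replaced by an idempotent linear map with kernel \<open>W\<close>: elements of the quotient
  are equal iff their representatives have the same image. The later sections identify
  the cosets in the definitions of the enveloping algebra and of the induced module with these
  images, and the homogeneous parts with the eigenspaces of the parity automorphism.\<close>

section \<open>Linear maps out of free vector spaces\<close>

abbreviation "lin \<equiv> Modules.module_hom"

lemma linI:
  assumes "Modules.module s1" "Modules.module s2"
    "\<And>x y. f (x + y) = f x + f y" "\<And>c x. f (s1 c x) = s2 c (f x)"
  shows "lin s1 s2 f"
  using assms by (simp add: module_hom_iff)

lemmas lin_add = module_hom.add and lin_scale = module_hom.scale and lin_zero = module_hom.zero
  and lin_neg = module_hom.neg and lin_diff = module_hom.diff and lin_sum = module_hom.sum

lemmas lin_simps = lin_add lin_scale lin_zero lin_neg lin_diff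

lemma lin_comp: "lin s1 s2 f \<Longrightarrow> lin s2 s3 g \<Longrightarrow> lin s1 s3 (\<lambda>x. g (f x))"
  using module_hom_compose[of s1 s2 f s3 g] by (simp add: o_def)

lemma lin_add_fun: "lin s1 s2 f \<Longrightarrow> lin s1 s2 g \<Longrightarrow> lin s1 s2 (\<lambda>x. f x + g x)"
  and lin_diff_fun: "lin s1 s2 f \<Longrightarrow> lin s1 s2 g \<Longrightarrow> lin s1 s2 (\<lambda>x. f x - g x)"
  and lin_scale_fun: "lin s1 s2 f \<Longrightarrow> lin s1 s2 (\<lambda>x. s2 c (f x))"
  by (auto simp: module_hom_iff module.scale_right_distrib module.scale_right_diff_distrib
      module.scale_minus_right module.scale_left_commute)

lemma lookup_pm_scale [simp]: "Poly_Mapping.lookup (pm_scale c f) k = c * Poly_Mapping.lookup f k"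
  by (simp add: pm_scale_def Poly_Mapping.map.rep_eq when_def)

lemma module_pm: "Modules.module pm_scale"
  by standard (auto intro!: poly_mapping_eqI simp: lookup_add algebra_simps)

lemma vector_space_pm: "vector_space pm_scale"
  by (rule module_pm[unfolded module_iff_vector_space])

lemmas pm_scale_simps [simp] = module.scale_scale[OF module_pm] module.scale_one[OF module_pm]
  module.scale_zero_left[OF module_pm] module.scale_zero_right[OF module_pm]
  module.scale_minus_left[OF module_pm] module.scale_minus_right[OF module_pm]
lemmas pm_scale_distribs = module.scale_right_distrib[OF module_pm]
  module.scale_left_distrib[OF module_pm] module.scale_right_diff_distrib[OF module_pm]

lemma pm_scale_single [simp]:
  "pm_scale c (Poly_Mapping.single b d) = Poly_Mapping.single b (c * d)"
  by (rule poly_mapping_eqI) (simp add: lookup_single when_def)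

definition fscale :: "('k \<Rightarrow> 'v \<Rightarrow> 'v) \<Rightarrow> 'k \<Rightarrow> ('a \<Rightarrow> 'v) \<Rightarrow> 'a \<Rightarrow> 'v" where
  "fscale s c f = (\<lambda>x. s c (f x))"

lemma fscale_apply [simp]: "fscale s c f x = s c (f x)"
  by (simp add: fscale_def)

lemma module_fscale: "Modules.module s \<Longrightarrow> Modules.module (fscale s)"
  by (auto simp: Modules.module_def fun_eq_iff)

lemma lin_eval: "Modules.module s \<Longrightarrow> lin (fscale s) s (\<lambda>f. f x)"
  by (intro linI module_fscale) auto

definition lin_ext :: "('k::field \<Rightarrow> 'v \<Rightarrow> 'v::ab_group_add) \<Rightarrow> ('b \<Rightarrow> 'v) \<Rightarrow> ('b \<Rightarrow>\<^sub>0 'k) \<Rightarrow> 'v"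
  where "lin_ext s f t = (\<Sum>b\<in>Poly_Mapping.keys t. s (Poly_Mapping.lookup t b) (f b))"

lemma pm_induct [case_names zero add scale single]:
  assumes "Q 0" and "\<And>t u. Q t \<Longrightarrow> Q u \<Longrightarrow> Q (t + u)" and "\<And>c t. Q t \<Longrightarrow> Q (pm_scale c t)"
    and "\<And>b. b \<in> Poly_Mapping.keys t \<Longrightarrow> Q (Poly_Mapping.single b 1)"
  shows "Q t"
proof -
  have *: "Q (\<Sum>b\<in>B. pm_scale (Poly_Mapping.lookup t b) (Poly_Mapping.single b 1))"
    if "finite B" "B \<subseteq> Poly_Mapping.keys t" for B
    using that by (induction B rule: finite_induct) (auto intro: assms simp del: pm_scale_single)
  have "t = (\<Sum>b\<in>Poly_Mapping.keys t. pm_scale (Poly_Mapping.lookup t b) (Poly_Mapping.single b 1))"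
    by (rule poly_mapping_eqI)
      (simp add: lookup_sum lookup_single when_def in_keys_iff if_distrib cong: if_cong)
  then show ?thesis using *[of "Poly_Mapping.keys t"] by simp
qed

lemma lin_ext_lin:
  assumes "Modules.module s"
  shows "lin pm_scale s (lin_ext s f)"
proof (rule linI[OF module_pm assms])
  interpret Modules.module s by fact
  have sup: "lin_ext s f t = (\<Sum>b\<in>B. s (Poly_Mapping.lookup t b) (f b))"
    if "finite B" "Poly_Mapping.keys t \<subseteq> B" for t B
    unfolding lin_ext_def
    by (rule sum.mono_neutral_left[OF that]) (simp add: in_keys_iff)
  show "lin_ext s f (t + u) = lin_ext s f t + lin_ext s f u" for t u
  proof -
    let ?B = "Poly_Mapping.keys t \<union> Poly_Mapping.keys u"
    have "lin_ext s f (t + u) = (\<Sum>b\<in>?B. s (Poly_Mapping.lookup (t + u) b) (f b))"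
      using keys_add[of t u] by (intro sup) auto
    also have "\<dots> = lin_ext s f t + lin_ext s f u"
      by (simp add: sup[of ?B t] sup[of ?B u] lookup_add scale_left_distrib sum.distrib)
    finally show ?thesis .
  qed
  show "lin_ext s f (pm_scale c t) = s c (lin_ext s f t)" for c t
  proof -
    have "lin_ext s f (pm_scale c t) = (\<Sum>b\<in>Poly_Mapping.keys t. s (c * Poly_Mapping.lookup t b) (f b))"
      by (subst sup[of "Poly_Mapping.keys t"]) (auto simp: in_keys_iff)
    then show ?thesis by (simp add: lin_ext_def scale_sum_right)
  qed
qed

lemma lin_ext_single [simp]:
  assumes "Modules.module s"
  shows "lin_ext s f (Poly_Mapping.single b c) = s c (f b)"
  by (simp add: lin_ext_def module.scale_zero_left[OF assms])

lemma lin_ext_single_1: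
  assumes "Modules.module s"
  shows "lin_ext s f (Poly_Mapping.single b 1) = f b"
  by (simp add: assms module.scale_one)

lemma pm_lin_eqI:
  assumes "lin pm_scale s f" "lin pm_scale s g"
    and "\<And>b. b \<in> Poly_Mapping.keys t \<Longrightarrow> f (Poly_Mapping.single b 1) = g (Poly_Mapping.single b 1)"
  shows "f t = g t"
  by (rule pm_induct[of "\<lambda>t. f t = g t"])
    (auto simp: assms(3) lin_simps[OF assms(1)] lin_simps[OF assms(2)] simp del: pm_scale_single)

text \<open>The quotient map onto a complement of \<open>W\<close>: the identity minus a projection onto \<open>W\<close>.\<close>

lemma exists_linear_quotient:
  fixes s :: "'k::field \<Rightarrow> 'v::ab_group_add \<Rightarrow> 'v"
  assumes "vector_space s" and W: "module.subspace s W"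
  shows "\<exists>f. lin s s f \<and> (\<forall>x. f x = 0 \<longleftrightarrow> x \<in> W) \<and> (\<forall>x. f (f x) = f x)"
proof -
  interpret vector_space s by fact
  interpret p: vector_space_pair s s ..
  obtain g where g: "range g \<subseteq> W" "Vector_Spaces.linear s s g" "\<forall>v\<in>W. g v = v"
    using p.linear_exists_left_inverse_on[of "\<lambda>x. x" W] W linear_ident by auto
  define f where "f x = x - g x" for x
  have "lin s s g"
    using g(2) by (simp add: Vector_Spaces.linear_def)
  then have f: "lin s s f"
    unfolding f_def by (intro linI) (simp_all add: lin_simps module_axioms scale_right_diff_distrib)
  have ker: "f x = 0 \<longleftrightarrow> x \<in> W" for x
    using g unfolding f_def by (metis diff_self eq_iff_diff_eq_0 rangeI subsetD)
  have "f (f x) = f x" for x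
  proof -
    have "f (x - f x) = 0"
      using g(1) by (subst ker) (auto simp: f_def)
    then show ?thesis by (simp add: lin_diff[OF f])
  qed
  with f ker show ?thesis by blast
qed

text \<open>A quotient by \<open>W\<close> is modelled inside the space itself: equality in the quotient becomes equality of
  the values of this map, and a linear map on the space that vanishes on \<open>W\<close> cannot distinguish
  \<open>x\<close> from its image. An operator \<open>x \<mapsto> f x\<close> of the quotient becomes \<open>x \<mapsto> quot_map s W (f x)\<close>, which
  satisfies the same relations as an honest operator on the whole space.\<close>

definition quot_map :: "('k::field \<Rightarrow> 'v \<Rightarrow> 'v::ab_group_add) \<Rightarrow> 'v set \<Rightarrow> 'v \<Rightarrow> 'v" where
  "quot_map s W = (SOME f. lin s s f \<and> (\<forall>x. f x = 0 \<longleftrightarrow> x \<in> W) \<and> (\<forall>x. f (f x) = f x))"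

lemma quot_map:
  assumes "vector_space s" "module.subspace s W"
  shows quot_map_lin: "lin s s (quot_map s W)"
    and quot_map_eq_0_iff: "quot_map s W x = 0 \<longleftrightarrow> x \<in> W"
    and quot_map_idem: "quot_map s W (quot_map s W x) = quot_map s W x"
  using someI_ex[OF exists_linear_quotient[OF assms], folded quot_map_def] by blast+

lemma quot_map_eq_iff:
  assumes "vector_space s" "module.subspace s W"
  shows "quot_map s W x = quot_map s W y \<longleftrightarrow> x - y \<in> W"
  using quot_map_eq_0_iff[OF assms, of "x - y"] by (simp add: lin_diff[OF quot_map_lin[OF assms]])

lemma lin_quot_map:
  assumes "vector_space s" "module.subspace s W" "lin s s2 f" "\<And>x. x \<in> W \<Longrightarrow> f x = 0"
  shows "f (quot_map s W x) = f x"
proof -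
  have "quot_map s W x - x \<in> W"
    using quot_map_idem[OF assms(1,2)] by (simp add: quot_map_eq_iff[OF assms(1,2), symmetric])
  then have "f (quot_map s W x - x) = 0" by (rule assms(4))
  then show ?thesis by (simp add: lin_diff[OF assms(3)])
qed

section \<open>The free algebra\<close>

type_synonym ('k, 'g) fa = "'g tword \<Rightarrow>\<^sub>0 'k"
type_synonym ('k, 'g) fa2 = "'g tword \<times> 'g tword \<Rightarrow>\<^sub>0 'k"
type_synonym ('k, 'g) env_pairs = "('k, 'g) env_elem \<times> ('k, 'g) env_elem \<Rightarrow>\<^sub>0 'k"

definition word :: "'g list \<Rightarrow> ('k::field, 'g) fa" where
  "word xs = Poly_Mapping.single (TWord xs) 1"

lemma word_Nil [simp]: "word [] = 1"
  by (simp add: word_def zero_tword_def[symmetric])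

lemma word_Cons: "word (x # xs) = letter x * word xs"
  by (simp add: word_def letter_def mult_single plus_tword_def)

lemma single_word: "Poly_Mapping.single w 1 = word (letters w)"
  by (simp add: word_def)

lemma pm_scale_conv_mult: "pm_scale c f = Poly_Mapping.single 0 c * (f :: ('k::field, 'g) fa)"
  by (simp add: pm_scale_def mult_map_scale_conv_mult)

lemma pm_scale_mult_left: "pm_scale c f * g = pm_scale c (f * (g :: ('k::field, 'g) fa))"
  by (simp add: pm_scale_conv_mult mult.assoc)

text \<open>Scalars are central: they are the multiples of the empty word.\<close>

lemma pm_scale_mult_right: "f * pm_scale c g = pm_scale c (f * (g :: ('k::field, 'g) fa))"
proof -
  have "f * Poly_Mapping.single 0 c = Poly_Mapping.single 0 c * f"
  proof (induction f rule: pm_induct)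
    case (scale d t)
    have "pm_scale d t * Poly_Mapping.single 0 c = pm_scale d (Poly_Mapping.single 0 c * t)"
      by (simp add: pm_scale_mult_left scale)
    also have "\<dots> = Poly_Mapping.single 0 c * pm_scale d t"
      by (simp add: pm_scale_conv_mult mult.assoc[symmetric] mult_single mult.commute)
    finally show ?case .
  qed (simp_all add: algebra_simps mult_single)
  then show ?thesis
    by (metis pm_scale_conv_mult mult.assoc)
qed

lemmas pm_scale_mult = pm_scale_mult_left pm_scale_mult_right

lemma lin_mult_left: "lin pm_scale pm_scale (\<lambda>g. (f :: ('k::field, 'g) fa) * g)"
  by (intro linI module_pm) (simp_all add: algebra_simps pm_scale_mult)

lemma lin_mult_right: "lin pm_scale pm_scale (\<lambda>g. g * (f :: ('k::field, 'g) fa))"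
  by (intro linI module_pm) (simp_all add: algebra_simps pm_scale_mult)

lemma fa_induct [case_names zero add scale one letter]:
  fixes f :: "('k::field, 'g) fa"
  assumes "Q 0" and "\<And>t u. Q t \<Longrightarrow> Q u \<Longrightarrow> Q (t + u)" and "\<And>c t. Q t \<Longrightarrow> Q (pm_scale c t)"
    and "Q 1" and "\<And>x f. Q f \<Longrightarrow> Q (letter x * f)"
  shows "Q f"
proof (rule pm_induct[of Q])
  show "Q (Poly_Mapping.single w 1)" for w
    unfolding single_word by (induction "letters w" arbitrary: w) (auto simp: word_Cons intro: assms, metis assms(4,5) tword.sel word_Cons)
qed (use assms in auto)

text \<open>The action of the free algebra on a vector space on which the letters act by \<open>a\<close>.\<close>

definition ev :: "('k::field \<Rightarrow> 'v \<Rightarrow> 'v::ab_group_add) \<Rightarrow> ('g \<Rightarrow> 'v \<Rightarrow> 'v) \<Rightarrow> ('k, 'g) fa \<Rightarrow> 'v \<Rightarrow> 'v" where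
  "ev s a f n = lin_ext s (\<lambda>w. foldr a (letters w) n) f"

lemma ev_lin: "Modules.module s \<Longrightarrow> lin pm_scale s (\<lambda>f. ev s a f n)"
  unfolding ev_def by (rule lin_ext_lin)

lemma ev_word: "Modules.module s \<Longrightarrow> ev s a (word xs) n = foldr a xs n"
  by (simp add: ev_def word_def lin_ext_single_1 del: lin_ext_single)

definition map_fa :: "('g \<Rightarrow> 'h) \<Rightarrow> ('k::field, 'g) fa \<Rightarrow> ('k, 'h) fa" where
  "map_fa g f = lin_ext pm_scale (\<lambda>w. word (map g (letters w))) f"

lemma map_fa_lin: "lin pm_scale pm_scale (map_fa g)"
  unfolding map_fa_def by (rule lin_ext_lin[OF module_pm])

lemmas map_fa_simps = lin_simps[OF map_fa_lin]

lemma map_fa_word: "map_fa g (word xs) = word (map g xs)"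
  by (simp add: map_fa_def word_def module_pm)

lemma map_fa_1 [simp]: "map_fa g 1 = 1"
  using map_fa_word[of g "[]"] by simp

lemma map_fa_letter_mult: "map_fa g (letter x * f) = letter (g x) * map_fa g f"
proof (rule pm_lin_eqI[of pm_scale "\<lambda>f. map_fa g (letter x * f)"])
  show "lin pm_scale pm_scale (\<lambda>f. map_fa g (letter x * f))"
    by (rule lin_comp[OF lin_mult_left map_fa_lin])
  show "lin pm_scale pm_scale (\<lambda>f. letter (g x) * map_fa g f)"
    by (rule lin_comp[OF map_fa_lin lin_mult_left])
qed (simp add: single_word word_Cons[symmetric] map_fa_word)

lemma map_fa_letter [simp]: "map_fa g (letter x) = letter (g x)"
  using map_fa_letter_mult[of g x 1] by simp

lemma map_fa_mult: "map_fa g (f * h) = map_fa g f * map_fa g h"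
  by (induction f rule: fa_induct)
    (simp_all add: map_fa_simps map_fa_letter_mult algebra_simps pm_scale_mult mult.assoc)

section \<open>Tensor products of free vector spaces\<close>

definition ten :: "('a \<Rightarrow>\<^sub>0 'k::field) \<Rightarrow> ('b \<Rightarrow>\<^sub>0 'k) \<Rightarrow> ('a \<times> 'b \<Rightarrow>\<^sub>0 'k)" where
  "ten f g = lin_ext pm_scale (\<lambda>a. lin_ext pm_scale (\<lambda>b. Poly_Mapping.single (a, b) 1) g) f"

lemma ten_single [simp]:
  "ten (Poly_Mapping.single a c) (Poly_Mapping.single b d) = Poly_Mapping.single (a, b) (c * d)"
  by (simp add: ten_def module_pm)

lemma ten_lin_left: "lin pm_scale pm_scale (\<lambda>f. ten f g)"
  unfolding ten_def by (rule lin_ext_lin[OF module_pm])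

lemma lin_ext_lin_fun:
  assumes "Modules.module s2" "\<And>b. lin s1 s2 (\<lambda>x. f x b)" "Modules.module s1"
  shows "lin s1 s2 (\<lambda>x. lin_ext s2 (f x) t)"
proof (rule linI[OF assms(3,1)])
  interpret Modules.module s2 by fact
  show "lin_ext s2 (f (x + y)) t = lin_ext s2 (f x) t + lin_ext s2 (f y) t" for x y
    by (simp add: lin_ext_def lin_add[OF assms(2)] scale_right_distrib sum.distrib)
  show "lin_ext s2 (f (s1 c x)) t = s2 c (lin_ext s2 (f x) t)" for c x
    by (simp add: lin_ext_def lin_scale[OF assms(2)] scale_sum_right mult.commute)
qed

lemma ten_lin_right: "lin pm_scale pm_scale (\<lambda>g. ten f g)"
  unfolding ten_def by (intro lin_ext_lin_fun module_pm lin_ext_lin)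

lemmas ten_simps = lin_simps[OF ten_lin_left] lin_simps[OF ten_lin_right]

lemma ten_induct [case_names zero add scale ten]:
  assumes "Q 0" and "\<And>t u. Q t \<Longrightarrow> Q u \<Longrightarrow> Q (t + u)" and "\<And>c t. Q t \<Longrightarrow> Q (pm_scale c t)"
    and "\<And>f g. Q (ten f g)"
  shows "Q t"
  by (rule pm_induct[of Q])
    (use assms assms(4)[of "Poly_Mapping.single _ 1" "Poly_Mapping.single _ 1"] in auto)

definition lift :: "('k::field \<Rightarrow> 'v \<Rightarrow> 'v::ab_group_add) \<Rightarrow> (('a \<Rightarrow>\<^sub>0 'k) \<Rightarrow> ('b \<Rightarrow>\<^sub>0 'k) \<Rightarrow> 'v) \<Rightarrow>
    ('a \<times> 'b \<Rightarrow>\<^sub>0 'k) \<Rightarrow> 'v" where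
  "lift s \<beta> = lin_ext s (\<lambda>(a, b). \<beta> (Poly_Mapping.single a 1) (Poly_Mapping.single b 1))"

lemma lift_lin: "Modules.module s \<Longrightarrow> lin pm_scale s (lift s \<beta>)"
  unfolding lift_def by (rule lin_ext_lin)

lemma lift_ten:
  assumes "Modules.module s" "\<And>g. lin pm_scale s (\<lambda>f. \<beta> f g)" "\<And>f. lin pm_scale s (\<beta> f)"
  shows "lift s \<beta> (ten f g) = \<beta> f g"
proof (rule pm_lin_eqI[where f = "\<lambda>f. lift s \<beta> (ten f g)"])
  show "lin pm_scale s (\<lambda>f. lift s \<beta> (ten f g))"
    by (rule lin_comp[OF ten_lin_left lift_lin[OF assms(1)]])
  show "lift s \<beta> (ten (Poly_Mapping.single a 1) g) = \<beta> (Poly_Mapping.single a 1) g" for a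
  proof (rule pm_lin_eqI)
    show "lin pm_scale s (\<lambda>g. lift s \<beta> (ten (Poly_Mapping.single a 1) g))"
      by (rule lin_comp[OF ten_lin_right lift_lin[OF assms(1)]])
  qed (simp_all add: assms lift_def module.scale_one[OF assms(1)])
qed (rule assms(2))

lemma ten_lin_eqI:
  assumes "lin pm_scale s f" "lin pm_scale s g" "\<And>u v. f (ten u v) = g (ten u v)"
  shows "f t = g t"
  by (rule ten_induct[of "\<lambda>t. f t = g t"])
    (simp_all add: assms(3) lin_simps[OF assms(1)] lin_simps[OF assms(2)])

section \<open>Lie superalgebras with operations defined everywhere\<close>

text \<open>The Koszul sign $(-1)^{pq}$, applied to a vector. With a case distinction in place of a scalar the
  sign rules are proved by evaluating them at the parities.\<close>

definition sg :: "bit \<Rightarrow> bit \<Rightarrow> 'v \<Rightarrow> 'v::ab_group_add" where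
  "sg p q v = (if p = 1 \<and> q = 1 then - v else v)"

lemma sg_simps [simp]: "sg 0 q v = v" "sg p 0 v = v" "sg 1 1 v = - v"
  by (simp_all add: sg_def)

lemma sg_parity_sign: "Modules.module s \<Longrightarrow> s (parity_sign p q) v = sg p q v"
  by (simp add: sg_def parity_sign_def module.scale_one module.scale_minus_left)

text \<open>A Lie superalgebra inside an ambient vector space. The maps \<open>pr 0\<close> and \<open>pr 1\<close> project the whole space
  to the even and the odd part, so that \<open>x\<close> is homogeneous of parity \<open>p\<close> iff \<open>pr p x = x\<close>, and the
  bracket of arbitrary vectors is that of their projections. A vector killed by both projections is
  thereby central, and it is set equal to \<open>0\<close> in the enveloping algebra below.\<close>

locale super_lie =
  fixes scg :: "'k::field_char_0 \<Rightarrow> 'g::ab_group_add \<Rightarrow> 'g"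
    and pr :: "bit \<Rightarrow> 'g \<Rightarrow> 'g"
    and br :: "'g \<Rightarrow> 'g \<Rightarrow> 'g"
  assumes vsg: "vector_space scg"
    and pr_lin: "lin scg scg (pr p)"
    and pr_pr: "pr p (pr q x) = (if p = q then pr p x else 0)"
    and br_lin_left: "lin scg scg (\<lambda>x. br x y)"
    and br_lin_right: "lin scg scg (br x)"
    and br_pr_left: "br (pr 0 x + pr 1 x) y = br x y"
    and br_pr_right: "br x (pr 0 y + pr 1 y) = br x y"
    and br_parity: "pr p x = x \<Longrightarrow> pr q y = y \<Longrightarrow> pr (p + q) (br x y) = br x y"
    and br_skew: "pr p x = x \<Longrightarrow> pr q y = y \<Longrightarrow> br x y = - sg p q (br y x)"
    and br_jacobi: "pr p x = x \<Longrightarrow> pr q y = y \<Longrightarrow> pr r z = z \<Longrightarrow>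
          br x (br y z) = br (br x y) z + sg p q (br y (br x z))"
begin

lemmas pr_simps = lin_simps[OF pr_lin]
lemmas br_simps = lin_simps[OF br_lin_left] lin_simps[OF br_lin_right]

lemma module_scg: "Modules.module scg"
  using vsg by (simp add: module_iff_vector_space)

lemma pr_pr_same [simp]: "pr p (pr p x) = pr p x"
  by (simp add: pr_pr)

lemma pr_other: "pr p x = x \<Longrightarrow> q \<noteq> p \<Longrightarrow> pr q x = 0"
  by (metis pr_pr)

text \<open>The third family makes every letter the sum of its homogeneous parts; in particular a letter with both
  projections \<open>0\<close> vanishes.\<close>

definition rels :: "('k, 'g) fa set" where
  "rels = {letter (x + y) - letter x - letter y |x y. True} \<union>
     {letter (scg c x) - pm_scale c (letter x) |c x. True} \<union>
     {letter x - letter (pr 0 x) - letter (pr 1 x) |x. True} \<union>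
     {letter x * letter y - sg p q (letter y * letter x) - letter (br x y) |p q x y.
        pr p x = x \<and> pr q y = y}"

lemma rels_cases [consumes 1, case_names add scale parts bracket]:
  assumes "r \<in> rels"
  obtains x y where "r = letter (x + y) - letter x - letter y"
  | c x where "r = letter (scg c x) - pm_scale c (letter x)"
  | x where "r = letter x - letter (pr 0 x) - letter (pr 1 x)"
  | p q x y where "r = letter x * letter y - sg p q (letter y * letter x) - letter (br x y)"
    "pr p x = x" "pr q y = y"
  using assms unfolding rels_def by blast

definition J :: "('k, 'g) fa set" where
  "J = module.span pm_scale {u * r * v |u r v. r \<in> rels}"

lemma subspace_J: "module.subspace pm_scale J"
  unfolding J_def by (rule module.subspace_span[OF module_pm])

lemmas J_0 = module.subspace_0[OF module_pm subspace_J]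
  and J_add = module.subspace_add[OF module_pm subspace_J]
  and J_scale = module.subspace_scale[OF module_pm subspace_J]
  and J_neg = module.subspace_neg[OF module_pm subspace_J]
  and J_diff = module.subspace_diff[OF module_pm subspace_J]

lemma J_induct [consumes 1, case_names zero add scale rel]:
  assumes "f \<in> J" "Q 0" "\<And>t u. Q t \<Longrightarrow> Q u \<Longrightarrow> Q (t + u)" "\<And>c t. Q t \<Longrightarrow> Q (pm_scale c t)"
    "\<And>u r v. r \<in> rels \<Longrightarrow> Q (u * r * v)"
  shows "Q f"
  using assms(1) unfolding J_def
proof (rule module.span_induct[OF module_pm])
  show "module.subspace pm_scale {f. Q f}"
    using assms by (auto simp: module.subspace_def[OF module_pm])
qed (use assms(5) in auto)

lemma J_rel: "r \<in> rels \<Longrightarrow> u * r * v \<in> J"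
  unfolding J_def by (rule module.span_base[OF module_pm]) auto

lemma J_mult_left: "f \<in> J \<Longrightarrow> g * f \<in> J"
proof (induction f rule: J_induct)
  case (rel u r v)
  then show ?case using J_rel[of r "g * u" v] by (simp add: mult.assoc)
qed (auto simp: J_0 algebra_simps pm_scale_mult intro: J_add J_scale)

lemma J_mult_right: "f \<in> J \<Longrightarrow> f * g \<in> J"
proof (induction f rule: J_induct)
  case (rel u r v)
  then show ?case using J_rel[of r u "v * g"] by (simp add: mult.assoc)
qed (auto simp: J_0 algebra_simps pm_scale_mult intro: J_add J_scale)

lemma rels_J: "r \<in> rels \<Longrightarrow> r \<in> J"
  using J_rel[of r 1 1] by simp

lemma J_letter_add: "letter (x + y) - letter x - letter y \<in> J"
  and J_letter_scale: "letter (scg c x) - pm_scale c (letter x) \<in> J"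
  and J_letter_pr: "letter x - letter (pr 0 x) - letter (pr 1 x) \<in> J"
  and J_bracket: "pr p x = x \<Longrightarrow> pr q y = y \<Longrightarrow>
     letter x * letter y - sg p q (letter y * letter x) - letter (br x y) \<in> J"
  by (rule rels_J; auto simp: rels_def)+

text \<open>The enveloping algebra is the quotient by \<open>J\<close>; its elements are represented by the values of \<open>env\<close>.\<close>

definition env :: "('k, 'g) fa \<Rightarrow> ('k, 'g) fa" where
  "env = quot_map pm_scale J"

lemmas env_lin = quot_map_lin[OF vector_space_pm subspace_J, folded env_def]
  and env_eq_0_iff = quot_map_eq_0_iff[OF vector_space_pm subspace_J, folded env_def]
  and env_idem [simp] = quot_map_idem[OF vector_space_pm subspace_J, folded env_def]
  and env_eq_iff = quot_map_eq_iff[OF vector_space_pm subspace_J, folded env_def]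
  and lin_env = lin_quot_map[OF vector_space_pm subspace_J, folded env_def]

lemmas env_simps = lin_simps[OF env_lin]

lemma env_minus_J: "env f - f \<in> J"
  by (simp add: env_eq_iff[symmetric])

lemma env_mult_left [simp]: "env (g * env f) = env (g * f)"
  using J_mult_left[OF env_minus_J, of g f] by (simp add: env_eq_iff algebra_simps)

lemma env_mult_right [simp]: "env (env f * g) = env (f * g)"
  using J_mult_right[OF env_minus_J, of f g] by (simp add: env_eq_iff algebra_simps)

lemma letter_lin_env: "lin scg pm_scale (\<lambda>x. env (letter x))"
proof (intro linI module_scg module_pm)
  show "env (letter (x + y)) = env (letter x) + env (letter y)" for x y
    using J_letter_add[of x y] by (simp add: env_eq_iff env_simps(1)[symmetric] diff_diff_eq)
  show "env (letter (scg c x)) = pm_scale c (env (letter x))" for c x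
    using J_letter_scale[of c x] by (simp add: env_eq_iff env_simps(2)[symmetric])
qed

lemma env_letter_pr: "env (letter x) = env (letter (pr 0 x)) + env (letter (pr 1 x))"
    using J_letter_pr[of x] by (simp add: env_eq_iff env_simps(1)[symmetric] diff_diff_eq)

lemma env_bracket: "pr p x = x \<Longrightarrow> pr q y = y \<Longrightarrow>
    env (letter (br x y)) = env (letter x * letter y) - sg p q (env (letter y * letter x))"
  using J_bracket[of p x q y] unfolding env_eq_0_iff[symmetric]
  by (cases p; cases q) (auto simp: env_simps)

text \<open>The parity automorphism. The homogeneous parts of the enveloping algebra are the eigenspaces of its
  extension \<open>par\<close> to products.\<close>

definition sigma :: "'g \<Rightarrow> 'g" where "sigma x = pr 0 x - pr 1 x"

abbreviation "par \<equiv> map_fa sigma"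

lemma sigma_lin: "lin scg scg sigma"
  unfolding sigma_def by (intro lin_diff_fun pr_lin)

lemmas sigma_simps = lin_simps[OF sigma_lin]
lemmas env_letter_simps = lin_simps[OF letter_lin_env]

lemma sigma_hom: "pr p x = x \<Longrightarrow> sigma x = sg p 1 x"
  by (cases p) (auto simp: sigma_def pr_other)

lemma env_mult_cong: "env f = env f' \<Longrightarrow> env g = env g' \<Longrightarrow> env (f * g) = env (f' * g')"
  by (metis env_mult_left env_mult_right)

lemma env_mult_env: "env (f * g) = env (env f * env g)"
  by simp

lemma par_J: "j \<in> J \<Longrightarrow> par j \<in> J"
proof (induction j rule: J_induct)
  case (rel u r v)
  have "par r \<in> J"
    using rel unfolding rels_def
  proof (elim UnE; clarify?)
    fix x y
    show "par (letter (x + y) - letter x - letter y) \<in> J"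
      by (simp add: env_eq_0_iff[symmetric] map_fa_simps env_simps env_letter_simps sigma_simps)
  next
    fix c x
    show "par (letter (scg c x) - pm_scale c (letter x)) \<in> J"
      by (simp add: env_eq_0_iff[symmetric] map_fa_simps env_simps env_letter_simps sigma_simps)
  next
    fix x
    show "par (letter x - letter (pr 0 x) - letter (pr 1 x)) \<in> J"
      by (simp add: env_eq_0_iff[symmetric] map_fa_simps env_simps env_letter_simps sigma_def pr_pr)
  next
    fix p q x y assume x: "pr p x = x" and y: "pr q y = y"
    have sg_env: "env (letter (sg p q z)) = sg p q (env (letter z))" for p q z
      by (simp add: sg_def env_letter_simps)
    have "env (letter (sigma x) * letter (sigma y)) = sg (p + q) 1 (env (letter x * letter y))"
      "env (letter (sigma y) * letter (sigma x)) = sg (p + q) 1 (env (letter y * letter x))"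
      unfolding sigma_hom[OF x] sigma_hom[OF y]
      by (subst env_mult_env, simp only: sg_env, cases p; cases q; simp add: env_simps)+
    then show "par (letter x * letter y - sg p q (letter y * letter x) - letter (br x y)) \<in> J"
      using env_bracket[OF x y] sigma_hom[OF br_parity[OF x y]]
      by (simp add: env_eq_0_iff[symmetric])
        (cases p; cases q; simp add: map_fa_simps map_fa_mult env_simps env_letter_simps)
  qed
  then show ?case by (simp add: map_fa_mult J_mult_left J_mult_right)
qed (auto simp: map_fa_simps J_0 intro: J_add J_scale)

lemma par_env: "env (par (env f)) = env (par f)"
  using par_J[OF env_minus_J, of f] by (simp add: env_eq_iff map_fa_simps)

lemma par_par: "env (par (par f)) = env f"
proof (induction f rule: fa_induct)
  case (letter x f)
  have "env (letter (sigma (sigma x))) = env (letter x)"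
    using env_letter_pr[of x] by (simp add: sigma_def pr_simps pr_pr env_letter_simps)
  then show ?case unfolding map_fa_letter_mult using letter by (rule env_mult_cong)
qed (simp_all add: map_fa_simps env_simps)

lemma env_letter_0: "env (letter 0 * f) = 0" "env (f * letter 0) = 0"
  by (subst env_mult_env, simp add: env_letter_simps env_simps)+

lemma env_letter_sigma: "pr p x = x \<Longrightarrow> env (letter (sigma x) * f) = sg p 1 (env (letter x * f))"
  by (subst env_mult_env, cases p) (simp_all add: sigma_hom env_letter_simps env_simps)

lemma pr_01 [simp]: "pr 0 (pr 1 x) = 0" "pr 1 (pr 0 x) = 0"
  by (simp_all add: pr_pr)

lemma br_decomp: "br x y = br (pr 0 x) y + br (pr 1 x) y" "br x y = br x (pr 0 y) + br x (pr 1 y)"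
  using br_pr_left[of x y] br_pr_right[of x y] by (simp_all add: br_simps)

end

section \<open>Representations\<close>

text \<open>The relations are only required on a subspace \<open>C\<close>, because for the spaces of functions below they
  hold on the linear functions only.\<close>

locale super_rep = super_lie scg pr br
  for scg :: "'k::field_char_0 \<Rightarrow> 'g::ab_group_add \<Rightarrow> 'g" and pr br +
  fixes s :: "'k \<Rightarrow> 'v::ab_group_add \<Rightarrow> 'v" and C :: "'v set" and a :: "'g \<Rightarrow> 'v \<Rightarrow> 'v"
  assumes ms: "Modules.module s"
    and sub: "module.subspace s C"
    and closed: "n \<in> C \<Longrightarrow> a x n \<in> C"
    and a_add: "m \<in> C \<Longrightarrow> n \<in> C \<Longrightarrow> a x (m + n) = a x m + a x n"
    and a_scale: "n \<in> C \<Longrightarrow> a x (s c n) = s c (a x n)"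
    and a_add_left: "n \<in> C \<Longrightarrow> a (x + y) n = a x n + a y n"
    and a_scale_left: "n \<in> C \<Longrightarrow> a (scg c x) n = s c (a x n)"
    and a_pr: "n \<in> C \<Longrightarrow> a x n = a (pr 0 x) n + a (pr 1 x) n"
    and a_bracket: "pr p x = x \<Longrightarrow> pr q y = y \<Longrightarrow> n \<in> C \<Longrightarrow>
       a (br x y) n = a x (a y n) - sg p q (a y (a x n))"
begin

lemmas C_0 = module.subspace_0[OF ms sub]
  and C_add = module.subspace_add[OF ms sub]
  and C_scale = module.subspace_scale[OF ms sub]

lemmas evl = ev_lin[OF ms] and ev_simps = lin_simps[OF ev_lin[OF ms]]

lemma ev_1 [simp]: "ev s a 1 n = n"
  using ev_word[OF ms, of a "[]" n] by simp

lemma foldr_closed: "n \<in> C \<Longrightarrow> foldr a xs n \<in> C"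
  by (induction xs) (auto intro: closed)

lemma ev_closed: "n \<in> C \<Longrightarrow> ev s a f n \<in> C"
  by (rule pm_induct[of "\<lambda>f. ev s a f n \<in> C"])
    (auto simp: ev_simps C_0 single_word ev_word[OF ms] intro: C_add C_scale foldr_closed
      simp del: pm_scale_single)

lemma a_0: "a x 0 = 0"
  using a_scale[OF C_0, of x 0] by (simp add: module.scale_zero_left[OF ms])

lemma a_sum: "n \<in> C \<Longrightarrow> a x (ev s a f n) = ev s a (letter x * f) n"
proof (induction f rule: pm_induct)
  case (single b)
  then show ?case by (simp add: single_word word_Cons[symmetric] ev_word[OF ms])
qed (simp_all add: ev_simps a_0 a_add a_scale ev_closed algebra_simps pm_scale_mult)

lemma ev_letter_mult: "n \<in> C \<Longrightarrow> ev s a (letter x * f) n = a x (ev s a f n)"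
  by (simp add: a_sum)

lemma ev_letter [simp]: "n \<in> C \<Longrightarrow> ev s a (letter x) n = a x n"
  using ev_letter_mult[of n x 1] by simp

lemma ev_mult: "n \<in> C \<Longrightarrow> ev s a (f * g) n = ev s a f (ev s a g n)"
proof (induction f rule: fa_induct)
qed (simp_all add: ev_simps algebra_simps pm_scale_mult ev_letter_mult ev_closed mult.assoc module.scale_zero_right[OF ms])

lemma ev_0_right [simp]: "ev s a f 0 = 0"
  by (induction f rule: fa_induct) (simp_all add: ev_simps ev_letter_mult C_0 a_0 module.scale_zero_right[OF ms])

lemma ev_add_right: "m \<in> C \<Longrightarrow> n \<in> C \<Longrightarrow> ev s a f (m + n) = ev s a f m + ev s a f n"
  by (induction f rule: fa_induct)
    (simp_all add: ev_simps ev_letter_mult C_add a_add ev_closed algebra_simps module.scale_right_distrib[OF ms])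

lemma ev_scale_right: "n \<in> C \<Longrightarrow> ev s a f (s c n) = s c (ev s a f n)"
  by (induction f rule: fa_induct)
    (simp_all add: ev_simps ev_letter_mult C_scale a_scale ev_closed module.scale_right_distrib[OF ms]
      module.scale_zero_right[OF ms]
      module.scale_left_commute[OF ms])

lemma ev_rel: "n \<in> C \<Longrightarrow> r \<in> rels \<Longrightarrow> ev s a r n = 0"
  unfolding rels_def
  by (auto simp: ev_simps ev_mult a_add_left a_scale_left closed a_bracket sg_def)
    (metis a_pr add_diff_cancel_left' diff_self)

text \<open>The universal property of the enveloping algebra: \<open>f \<mapsto> ev s a f n\<close> is well defined on it because
  the relations act by \<open>0\<close> on \<open>C\<close>, and \<open>C\<close> is stable under the words on either side of a relation.\<close>

lemma ev_J: "n \<in> C \<Longrightarrow> f \<in> J \<Longrightarrow> ev s a f n = 0"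
  by (rotate_tac, induction f rule: J_induct) (simp_all add: ev_simps ev_mult ev_rel ev_closed module.scale_zero_right[OF ms])

lemma ev_env [simp]: "n \<in> C \<Longrightarrow> ev s a (env f) n = ev s a f n"
  by (rule lin_env[OF ev_lin[OF ms]]) (rule ev_J)

end

section \<open>The even part\<close>

definition even_pr :: "(bit \<Rightarrow> 'g \<Rightarrow> 'g::ab_group_add) \<Rightarrow> bit \<Rightarrow> 'g \<Rightarrow> 'g" where
  "even_pr pr p x = (if p = 0 then pr 0 x else 0)"

definition even_br :: "(bit \<Rightarrow> 'g \<Rightarrow> 'g::ab_group_add) \<Rightarrow> ('g \<Rightarrow> 'g \<Rightarrow> 'g) \<Rightarrow> 'g \<Rightarrow> 'g \<Rightarrow> 'g" where
  "even_br pr br x y = br (pr 0 x) (pr 0 y)"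

lemma (in super_lie) even_super_lie: "super_lie scg (even_pr pr) (even_br pr br)"
proof (rule super_lie.intro)
  show "vector_space scg" by (rule vsg)
  show "lin scg scg (even_pr pr p)" for p
    by (intro linI module_scg) (auto simp: even_pr_def pr_simps module.scale_zero_right[OF module_scg])
  show "lin scg scg (\<lambda>x. even_br pr br x y)" for y
    by (intro linI module_scg) (auto simp: even_br_def pr_simps br_simps)
  show "lin scg scg (even_br pr br x)" for x
    by (intro linI module_scg) (auto simp: even_br_def pr_simps br_simps)
next
  fix p q r x y z
  show "even_pr pr p (even_pr pr q x) = (if p = q then even_pr pr p x else 0)"
    by (auto simp: even_pr_def pr_simps)
  show "even_br pr br (even_pr pr 0 x + even_pr pr 1 x) y = even_br pr br x y"
    "even_br pr br x (even_pr pr 0 y + even_pr pr 1 y) = even_br pr br x y"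
    by (auto simp: even_pr_def even_br_def)
  assume x: "even_pr pr p x = x" and y: "even_pr pr q y = y"
  then have [simp]: "pr 0 x = x" "pr 0 y = y"
    by (auto simp: even_pr_def pr_simps split: if_splits)
  have [simp]: "pr 0 (br x y) = br x y"
    using br_parity[of 0 x 0 y] by simp
  show "even_pr pr (p + q) (even_br pr br x y) = even_br pr br x y"
    using x y by (cases p; cases q) (auto simp: even_pr_def even_br_def br_simps pr_simps)
  have "x = 0" if "p = 1" using x that by (simp add: even_pr_def)
  then show "even_br pr br x y = - sg p q (even_br pr br y x)"
    using br_skew[of 0 x 0 y] by (cases p) (auto simp: even_br_def br_simps pr_simps sg_def)
  assume z: "even_pr pr r z = z"
  then have [simp]: "pr 0 z = z"
    by (auto simp: even_pr_def pr_simps split: if_splits)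
  have [simp]: "pr 0 (br x z) = br x z" "pr 0 (br y z) = br y z"
    using br_parity[of 0 x 0 z] br_parity[of 0 y 0 z] by simp_all
  show "even_br pr br x (even_br pr br y z) =
    even_br pr br (even_br pr br x y) z + sg p q (even_br pr br y (even_br pr br x z))"
    using br_jacobi[of 0 x 0 y 0 z] \<open>p = 1 \<Longrightarrow> x = 0\<close> by (cases p) (auto simp: even_br_def br_simps pr_simps sg_def)
qed

text \<open>The map \<open>\<psi>\<close> is the inverse of \<open>1 - \<phi>\<close> on the odd part.\<close>

locale twisted_lie = super_lie scg pr br
  for scg :: "'k::field_char_0 \<Rightarrow> 'g::ab_group_add \<Rightarrow> 'g" and pr br +
  fixes \<phi> \<psi> :: "'g \<Rightarrow> 'g"
  assumes \<phi>_lin: "lin scg scg \<phi>"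
    and \<phi>_even: "pr 0 x = x \<Longrightarrow> \<phi> x = x"
    and \<phi>_odd: "pr 1 x = x \<Longrightarrow> pr 1 (\<phi> x) = \<phi> x"
    and \<phi>_br: "\<phi> (br x y) = br (\<phi> x) (\<phi> y)"
    and \<psi>_lin: "lin scg scg \<psi>"
    and \<psi>_odd: "pr 1 x = x \<Longrightarrow> pr 1 (\<psi> x) = \<psi> x"
    and \<psi>_right: "pr 1 x = x \<Longrightarrow> \<psi> x - \<phi> (\<psi> x) = x"
    and \<psi>_left: "pr 1 x = x \<Longrightarrow> \<psi> (x - \<phi> x) = x"
begin

sublocale even: super_lie scg "even_pr pr" "even_br pr br"
  by (rule even_super_lie)

text \<open>A representation of the even part is given by the action of the even elements; an arbitrary vector acts
  through its even projection.\<close>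

lemma even_repI:
  assumes "Modules.module s" and "module.subspace s C"
    and "\<And>z n. pr 0 z = z \<Longrightarrow> n \<in> C \<Longrightarrow> a z n \<in> C"
    and "\<And>z m n. pr 0 z = z \<Longrightarrow> m \<in> C \<Longrightarrow> n \<in> C \<Longrightarrow> a z (m + n) = a z m + a z n"
    and "\<And>z c n. pr 0 z = z \<Longrightarrow> n \<in> C \<Longrightarrow> a z (s c n) = s c (a z n)"
    and "\<And>y z n. pr 0 y = y \<Longrightarrow> pr 0 z = z \<Longrightarrow> n \<in> C \<Longrightarrow> a (y + z) n = a y n + a z n"
    and "\<And>c z n. pr 0 z = z \<Longrightarrow> n \<in> C \<Longrightarrow> a (scg c z) n = s c (a z n)"
    and "\<And>y z n. pr 0 y = y \<Longrightarrow> pr 0 z = z \<Longrightarrow> n \<in> C \<Longrightarrow> a (br y z) n = a y (a z n) - a z (a y n)"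
  shows "super_rep scg (even_pr pr) (even_br pr br) s C (\<lambda>z. a (pr 0 z))"
proof (intro super_rep.intro even.super_lie_axioms super_rep_axioms.intro)
  fix n assume n: "n \<in> C"
  have 0: "a 0 n = 0"
    using assms(7)[of 0 n 0] n
    by (simp add: pr_simps module.scale_zero_left[OF module_scg] module.scale_zero_left[OF assms(1)])
  show "a (pr 0 x) n = a (pr 0 (even_pr pr 0 x)) n + a (pr 0 (even_pr pr 1 x)) n" for x
    by (simp add: even_pr_def pr_simps 0)
  show "a (pr 0 (even_br pr br x y)) n = a (pr 0 x) (a (pr 0 y) n) - sg p q (a (pr 0 y) (a (pr 0 x) n))"
    if "even_pr pr p x = x" "even_pr pr q y = y" for p q x y
  proof -
    have xy: "pr 0 x = x" "pr 0 y = y"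
      using that by (auto simp: even_pr_def pr_simps split: if_splits)
    have z: "a 0 0 = 0"
      using assms(5)[of 0 n 0] n 0
      by (simp add: pr_simps module.scale_zero_left[OF module_scg] module.scale_zero_left[OF assms(1)])
    have x0: "x = 0" if "p = 1" using that \<open>even_pr pr p x = x\<close> by (simp add: even_pr_def)
    have "a z 0 = 0" if "pr 0 z = z" for z
      using assms(5)[of z n 0] n that 0
      by (simp add: pr_simps module.scale_zero_left[OF module_scg] module.scale_zero_left[OF assms(1)])
    then show ?thesis
      using assms(8)[of x y n] n xy br_parity[of 0 x 0 y] x0 assms(3)[of y n]
      by (cases p) (auto simp: even_br_def br_simps pr_simps 0 sg_def)
  qed
qed (use assms in \<open>auto simp: pr_simps\<close>)

section \<open>The induced module\<close>

definition ad0 :: "'g \<Rightarrow> ('k, 'g) fa \<Rightarrow> ('k, 'g) fa" where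
  "ad0 z v = letter z * v - v * letter z"

lemma ad0_lin: "lin pm_scale pm_scale (ad0 z)"
  by (intro linI module_pm) (auto simp: ad0_def algebra_simps pm_scale_mult pm_scale_distribs)

text \<open>The relations of \<open>U \<otimes>\<^sub>V V\<close> on the tensor square of the free algebra. Balancing is imposed for single
  letters; the even part acts on \<open>V\<close> by commutators.\<close>

definition ind_rels :: "('k, 'g) fa2 set" where
  "ind_rels = {ten j v |j v. j \<in> J} \<union> {ten f j |f j. j \<in> even.J} \<union>
     {ten (f * letter z) v - ten f (ad0 z v) |f v z. pr 0 z = z}"

definition W :: "('k, 'g) fa2 set" where
  "W = module.span pm_scale ind_rels"

lemma subspace_W: "module.subspace pm_scale W"
  unfolding W_def by (rule module.subspace_span[OF module_pm])

lemma ind_rels_W: "r \<in> ind_rels \<Longrightarrow> r \<in> W"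
  unfolding W_def by (rule module.span_base[OF module_pm])

lemma ten_J: "j \<in> J \<Longrightarrow> ten j v \<in> W"
  and ten_even_J: "j \<in> even.J \<Longrightarrow> ten f j \<in> W"
  and ten_balanced: "pr 0 z = z \<Longrightarrow> ten (f * letter z) v - ten f (ad0 z v) \<in> W"
  by (rule ind_rels_W; auto simp: ind_rels_def)+

lemma lin_W:
  assumes "lin pm_scale s F" "\<And>j v. j \<in> J \<Longrightarrow> F (ten j v) = 0" "\<And>f j. j \<in> even.J \<Longrightarrow> F (ten f j) = 0"
    "\<And>f v z. pr 0 z = z \<Longrightarrow> F (ten (f * letter z) v) = F (ten f (ad0 z v))"
    "t \<in> W"
  shows "F t = 0"
  using assms(5) unfolding W_def
proof (rule module.span_induct[OF module_pm])
  show "module.subspace pm_scale {t. F t = 0}"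
    using assms(1) by (auto simp: module.subspace_def[OF module_pm] lin_simps
      module.scale_zero_right[OF module_hom.axioms(2)[OF assms(1)]])
qed (auto simp: ind_rels_def assms(2-4) lin_simps[OF assms(1)])

definition ind :: "('k, 'g) fa2 \<Rightarrow> ('k, 'g) fa2" where
  "ind = quot_map pm_scale W"

lemmas ind_lin = quot_map_lin[OF vector_space_pm subspace_W, folded ind_def]
  and ind_eq_0_iff = quot_map_eq_0_iff[OF vector_space_pm subspace_W, folded ind_def]
  and ind_idem [simp] = quot_map_idem[OF vector_space_pm subspace_W, folded ind_def]
  and ind_eq_iff = quot_map_eq_iff[OF vector_space_pm subspace_W, folded ind_def]
  and lin_ind = lin_quot_map[OF vector_space_pm subspace_W, folded ind_def]

lemmas ind_simps = lin_simps[OF ind_lin]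

abbreviation tens :: "('k, 'g) fa \<Rightarrow> ('k, 'g) fa \<Rightarrow> ('k, 'g) fa2" where
  "tens f v \<equiv> ind (ten f v)"

lemma tens_eq_0: "j \<in> J \<Longrightarrow> tens j v = 0" "j \<in> even.J \<Longrightarrow> tens f j = 0"
  by (simp_all add: ind_eq_0_iff ten_J ten_even_J)

lemma tens_balanced: "pr 0 z = z \<Longrightarrow> tens (f * letter z) v = tens f (ad0 z v)"
  by (simp add: ind_eq_iff ten_balanced)

definition iact :: "'g \<Rightarrow> ('k, 'g) fa2 \<Rightarrow> ('k, 'g) fa2" where
  "iact x t = ind (lift pm_scale (\<lambda>f v. ten (letter x * f) v) t)"

lemma act_lin: "lin pm_scale pm_scale (iact x)"
  unfolding iact_def by (rule lin_comp[OF lift_lin[OF module_pm] ind_lin])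

lemmas act_simps = lin_simps[OF act_lin]

lemma act_ten: "iact x (ten f v) = tens (letter x * f) v"
  unfolding iact_def
  by (subst lift_ten[OF module_pm])
    (auto intro: lin_comp[OF lin_mult_left ten_lin_left] ten_lin_right)

lemma act_ind [simp]: "iact x (ind t) = iact x t"
proof (rule lin_ind[OF act_lin], erule lin_W[OF act_lin, rotated -1])
qed (simp_all add: act_ten tens_eq_0 J_mult_left tens_balanced mult.assoc[symmetric])

lemma ind_act [simp]: "ind (iact x t) = iact x t"
  by (simp add: iact_def)

lemma ind_ten_cong: "env f = env g \<Longrightarrow> tens f v = tens g v"
  by (simp add: env_eq_iff ind_eq_iff lin_diff[OF ten_lin_left, symmetric] ten_J)

lemma super_rep_act: "super_rep scg pr br pm_scale UNIV iact"
proof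
  show "module.subspace pm_scale (UNIV :: ('k, 'g) fa2 set)"
    by (simp add: module.subspace_def[OF module_pm])
  have e: "tens (letter x * f) v = tens (env (letter x) * f) v" for x f v
    by (rule ind_ten_cong) simp
  have e2: "tens (env f * g) v = tens (f * g) v" for f g v
    by (rule ind_ten_cong) simp
  fix x y :: 'g and t and c
  show "iact (x + y) t = iact x t + iact y t"
    by (rule ten_lin_eqI[OF act_lin lin_add_fun[OF act_lin act_lin]])
      (simp add: act_ten, simp add: e lin_simps[OF letter_lin_env] algebra_simps ten_simps ind_simps)
  show "iact (scg c x) t = pm_scale c (iact x t)"
    by (rule ten_lin_eqI[OF act_lin lin_scale_fun[OF act_lin]])
      (simp add: act_ten, simp add: e lin_simps[OF letter_lin_env] pm_scale_mult ten_simps ind_simps)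
  show "iact x t = iact (pr 0 x) t + iact (pr 1 x) t"
    by (rule ten_lin_eqI[OF act_lin lin_add_fun[OF act_lin act_lin]])
      (simp add: act_ten, simp add: e env_letter_pr[of x] algebra_simps ten_simps ind_simps)
  show "iact (br x y) t = iact x (iact y t) - sg p q (iact y (iact x t))" if "pr p x = x" "pr q y = y" for p q
  proof (rule ten_lin_eqI[OF act_lin])
    show "lin pm_scale pm_scale (\<lambda>t. iact x (iact y t) - sg p q (iact y (iact x t)))"
      by (intro linI module_pm) (auto simp: act_simps sg_def pm_scale_distribs)
    show "iact (br x y) (ten f v) = iact x (iact y (ten f v)) - sg p q (iact y (iact x (ten f v)))" for f v
      by (simp add: act_ten, simp add: e[of "br x y"] env_bracket[OF that] mult.assoc[symmetric] sg_def)
        (auto simp: algebra_simps ten_simps ind_simps e2)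
  qed
qed (simp_all add: module_pm act_simps pm_scale_distribs)

sublocale ind: super_rep scg pr br pm_scale UNIV iact
  by (rule super_rep_act)

lemma act_tens: "iact x (tens f v) = tens (letter x * f) v"
  by (simp add: act_ten)

declare act_ind [simp del]

text \<open>Frobenius reciprocity: a map \<open>h\<close> from \<open>V\<close> to a module \<open>N\<close> that is linear over the even part extends to
  the induced module by \<open>f \<otimes> v \<mapsto> f \<cdot> h v\<close>. Equivariance of \<open>h\<close> is what the balancing relation needs.\<close>

definition frob :: "('k \<Rightarrow> 'v \<Rightarrow> 'v::ab_group_add) \<Rightarrow> ('g \<Rightarrow> 'v \<Rightarrow> 'v) \<Rightarrow> (('k, 'g) fa \<Rightarrow> 'v) \<Rightarrow>
    ('k, 'g) fa2 \<Rightarrow> 'v" where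
  "frob s a h = lift s (\<lambda>f v. ev s a f (h v))"

lemma frobenius:
  assumes "super_rep scg pr br s C a" and h: "lin pm_scale s h" "\<And>v. h v \<in> C"
    and hJ: "\<And>j. j \<in> even.J \<Longrightarrow> h j = 0"
    and eq: "\<And>z v. pr 0 z = z \<Longrightarrow> h (ad0 z v) = a z (h v)"
  shows frob_lin: "lin pm_scale s (frob s a h)"
    and frob_ten: "frob s a h (ten f v) = ev s a f (h v)"
    and frob_ind: "frob s a h (ind t) = frob s a h t"
    and frob_act: "frob s a h (iact x t) = a x (frob s a h t)"
    and frob_closed: "frob s a h t \<in> C"
proof -
  interpret N: super_rep scg pr br s C a by fact
  show l: "lin pm_scale s (frob s a h)"
    unfolding frob_def by (rule lift_lin[OF N.ms])
  show t: "frob s a h (ten f v) = ev s a f (h v)" for f v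
    unfolding frob_def
    by (rule lift_ten[OF N.ms N.evl], rule linI[OF module_pm N.ms])
      (simp_all add: lin_simps[OF h(1)] N.ev_add_right N.ev_scale_right h(2))
  show k: "frob s a h (ind t) = frob s a h t" for t
    by (rule lin_ind[OF l], erule lin_W[OF l, rotated -1])
      (simp_all add: t N.ev_J h hJ N.ev_mult eq)
  show c: "frob s a h t \<in> C" for t
    by (induction t rule: ten_induct)
      (auto simp: t lin_simps[OF l] N.C_0 intro: N.C_add N.C_scale N.ev_closed h)
  show "frob s a h (iact x t) = a x (frob s a h t)"
    by (induction t rule: ten_induct)
      (auto simp: act_simps lin_simps[OF l] N.a_0 N.a_add N.a_scale c act_ind act_ten k t N.ev_letter_mult h)
qed

text \<open>Induction along \<open>x f \<otimes> v = a\<^sub>x (f \<otimes> v)\<close>: the elements \<open>1 \<otimes> v\<close> generate the induced module.\<close>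

lemma ind_induct [case_names zero add scale iact gen]:
  assumes "Q 0" "\<And>t u. Q t \<Longrightarrow> Q u \<Longrightarrow> Q (t + u)" "\<And>c t. Q t \<Longrightarrow> Q (pm_scale c t)"
    "\<And>p x t. pr p x = x \<Longrightarrow> Q t \<Longrightarrow> Q (iact x t)" "\<And>v. Q (tens 1 v)"
  shows "Q (ind t)"
proof (induction t rule: ten_induct)
  case (ten f v)
  show ?case
  proof (induction f rule: fa_induct)
    case (letter x f)
    have "tens (letter x * f) v = iact (pr 0 x) (tens f v) + iact (pr 1 x) (tens f v)"
      using ind.a_pr[of "tens f v" x] by (simp add: act_tens)
    then show ?case using letter assms(2,4) by (metis pr_pr_same)
  qed (auto simp: ten_simps ind_simps assms)
qed (auto simp: ind_simps assms)

end

context twisted_lie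
begin

section \<open>Moving an odd element to the left\<close>

text \<open>For two even elements the Jacobi identity contains no signs, so it extends linearly to an arbitrary
  third element.\<close>

lemma br_jacobi_even: "pr 0 x = x \<Longrightarrow> pr 0 y = y \<Longrightarrow> br x (br y u) = br (br x y) u + br y (br x u)"
proof -
  assume xy: "pr 0 x = x" "pr 0 y = y"
  have "br x (br y (pr 0 u + pr 1 u)) = br (br x y) (pr 0 u + pr 1 u) + br y (br x (pr 0 u + pr 1 u))"
    using br_jacobi[OF xy pr_pr_same[of 0 u]] br_jacobi[OF xy pr_pr_same[of 1 u]]
    by (simp add: br_simps algebra_simps)
  then show ?thesis by (simp only: br_pr_right)
qed

lemma even_J_simps:
  shows even_J_add: "(letter (x + y) - letter x - letter y) * v \<in> even.J"
    and even_J_scale: "(letter (scg c x) - pm_scale c (letter x)) * v \<in> even.J"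
    and even_J_bracket: "pr 0 x = x \<Longrightarrow> pr 0 y = y \<Longrightarrow>
      (letter x * letter y - letter y * letter x - letter (br x y)) * v \<in> even.J"
    and even_J_pr: "(letter x - letter (pr 0 x)) * v \<in> even.J"
proof -
  show "(letter (x + y) - letter x - letter y) * v \<in> even.J"
    "(letter (scg c x) - pm_scale c (letter x)) * v \<in> even.J"
    by (intro even.J_mult_right even.J_letter_add even.J_letter_scale)+
  show "(letter x * letter y - letter y * letter x - letter (br x y)) * v \<in> even.J"
    if "pr 0 x = x" "pr 0 y = y"
    using even.J_mult_right[OF even.J_bracket[of 0 x 0 y], of v] that
    by (simp add: even_pr_def even_br_def)
  have "letter x - letter (pr 0 x) - letter 0 \<in> even.J"
    using even.J_letter_pr[of x] by (simp add: even_pr_def)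
  moreover have "letter (scg 0 x) - pm_scale 0 (letter x) \<in> even.J"
    by (rule even.J_letter_scale)
  then have "letter 0 \<in> even.J"
    by (simp add: module.scale_zero_left[OF module_scg])
  ultimately have "letter x - letter (pr 0 x) \<in> even.J"
    using even.J_add by (metis diff_add_cancel)
  then show "(letter x - letter (pr 0 x)) * v \<in> even.J"
    by (rule even.J_mult_right)
qed

text \<open>The bilinear maps on \<open>V \<times> \<gg>\<close>. A map \<open>\<beta>\<close> is to be thought of as a function of the product \<open>y v\<close>.\<close>

definition Bil :: "('k \<Rightarrow> 'v \<Rightarrow> 'v::ab_group_add) \<Rightarrow> (('k, 'g) fa \<Rightarrow> 'g \<Rightarrow> 'v) set" where
  "Bil s = {\<beta>. (\<forall>y. lin pm_scale s (\<lambda>v. \<beta> v y)) \<and> (\<forall>v. lin scg s (\<beta> v)) \<and>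
     (\<forall>j\<in>even.J. \<forall>y. \<beta> j y = 0)}"

lemma Bil_D:
  assumes "\<beta> \<in> Bil s"
  shows Bil_left: "lin pm_scale s (\<lambda>v. \<beta> v y)" and Bil_right: "lin scg s (\<beta> v)"
    and Bil_J: "j \<in> even.J \<Longrightarrow> \<beta> j y = 0"
  using assms by (auto simp: Bil_def)

lemmas Bil_simps = lin_simps[OF Bil_left] lin_simps[OF Bil_right]

lemma Bil_cong: "\<beta> \<in> Bil s \<Longrightarrow> f - g \<in> even.J \<Longrightarrow> \<beta> f y = \<beta> g y"
  using Bil_J[of \<beta> s "f - g" y] by (simp add: Bil_simps(5))

lemma Bil_comp:
  assumes "\<beta> \<in> Bil s" "lin pm_scale pm_scale f" "lin scg scg g" "\<And>j. j \<in> even.J \<Longrightarrow> f j \<in> even.J"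
  shows "(\<lambda>v y. \<beta> (f v) (g y)) \<in> Bil s"
  using assms lin_comp[OF assms(2) Bil_left[OF assms(1)]] lin_comp[OF assms(3) Bil_right[OF assms(1)]]
  by (auto simp: Bil_def)

lemma Bil_post: "\<beta> \<in> Bil s \<Longrightarrow> lin s s2 g \<Longrightarrow> (\<lambda>v y. g (\<beta> v y)) \<in> Bil s2"
  by (auto simp: Bil_def lin_zero intro: lin_comp)

lemma Bil_add: "\<beta> \<in> Bil s \<Longrightarrow> \<gamma> \<in> Bil s \<Longrightarrow> (\<lambda>v y. \<beta> v y + \<gamma> v y) \<in> Bil s"
  and Bil_diff: "\<beta> \<in> Bil s \<Longrightarrow> \<gamma> \<in> Bil s \<Longrightarrow> (\<lambda>v y. \<beta> v y - \<gamma> v y) \<in> Bil s"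
  and Bil_scale: "\<beta> \<in> Bil s \<Longrightarrow> (\<lambda>v y. s c (\<beta> v y)) \<in> Bil s"
  by (auto simp: Bil_def intro!: lin_add_fun lin_diff_fun lin_scale_fun
      intro: module.scale_zero_right[OF module_hom.axioms(2)])

lemma Bil_mult_left: "\<beta> \<in> Bil s \<Longrightarrow> (\<lambda>v y. \<beta> (f * v) y) \<in> Bil s"
  and Bil_mult_right: "\<beta> \<in> Bil s \<Longrightarrow> (\<lambda>v y. \<beta> (v * f) y) \<in> Bil s"
  and Bil_br: "\<beta> \<in> Bil s \<Longrightarrow> (\<lambda>v y. \<beta> v (br z y)) \<in> Bil s"
  using Bil_comp[of \<beta> s "\<lambda>v. f * v" "\<lambda>y. y"] Bil_comp[of \<beta> s "\<lambda>v. v * f" "\<lambda>y. y"]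
    Bil_comp[of \<beta> s "\<lambda>v. v" "br z"]
  by (simp_all add: lin_mult_left lin_mult_right module.module_hom_ident module_scg module_pm
      even.J_mult_left even.J_mult_right br_lin_right)

text \<open>With \<open>\<beta> v y\<close> standing for the value at \<open>y v\<close>, this is the value at \<open>z y v\<close>, since \<open>z y = y z + [z, y]\<close>
  for even \<open>z\<close>. It is a right action of the even part on bilinear maps.\<close>

definition rmul :: "'g \<Rightarrow> (('k, 'g) fa \<Rightarrow> 'g \<Rightarrow> 'v) \<Rightarrow> ('k, 'g) fa \<Rightarrow> 'g \<Rightarrow> 'v::ab_group_add" where
  "rmul z \<beta> = (\<lambda>v y. \<beta> (letter z * v) y + \<beta> v (br z y))"

lemma rmul_Bil: "\<beta> \<in> Bil s \<Longrightarrow> rmul z \<beta> \<in> Bil s"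
  unfolding rmul_def by (intro Bil_add Bil_mult_left Bil_br)

lemma rmul_bracket:
  assumes \<beta>: "\<beta> \<in> Bil s" and xy: "pr 0 x = x" "pr 0 y = y"
  shows "rmul (br x y) \<beta> = (\<lambda>v u. rmul y (rmul x \<beta>) v u - rmul x (rmul y \<beta>) v u)"
proof (intro ext)
  fix v u
  have "\<beta> (letter x * letter y * v - letter y * letter x * v) u = \<beta> (letter (br x y) * v) u"
    using even_J_bracket[OF xy, of v] by (intro Bil_cong[OF \<beta>]) (simp add: algebra_simps)
  then show "rmul (br x y) \<beta> v u = rmul y (rmul x \<beta>) v u - rmul x (rmul y \<beta>) v u"
    using br_jacobi_even[OF xy, of u]
    by (simp add: rmul_def Bil_simps[OF \<beta>] mult.assoc)
qed

lemma rmul_add: "\<beta> \<in> Bil s \<Longrightarrow> rmul (x + y) \<beta> = (\<lambda>v u. rmul x \<beta> v u + rmul y \<beta> v u)"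
proof (intro ext)
  fix v u assume \<beta>: "\<beta> \<in> Bil s"
  have "\<beta> (letter (x + y) * v) u = \<beta> (letter x * v + letter y * v) u"
    using even_J_add[of x y v] by (intro Bil_cong[OF \<beta>]) (simp add: algebra_simps)
  then show "rmul (x + y) \<beta> v u = rmul x \<beta> v u + rmul y \<beta> v u"
    by (simp add: rmul_def Bil_simps[OF \<beta>] br_simps)
qed

lemma rmul_scale: "\<beta> \<in> Bil s \<Longrightarrow> rmul (scg c x) \<beta> = (\<lambda>v u. s c (rmul x \<beta> v u))"
proof (intro ext)
  fix v u assume \<beta>: "\<beta> \<in> Bil s"
  have s: "Modules.module s" using Bil_left[OF \<beta>] by (rule module_hom.axioms(2))
  have "\<beta> (letter (scg c x) * v) u = \<beta> (pm_scale c (letter x * v)) u"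
    using even_J_scale[of c x v] by (intro Bil_cong[OF \<beta>]) (simp add: algebra_simps pm_scale_mult)
  then show "rmul (scg c x) \<beta> v u = s c (rmul x \<beta> v u)"
    by (simp add: rmul_def Bil_simps[OF \<beta>] br_simps module.scale_right_distrib[OF s])
qed

text \<open>A right action on bilinear maps is a left action on the functionals of bilinear maps, to which the
  universal property of \<open>V\<close> applies. Functionals are set to \<open>0\<close> outside \<open>Bil s\<close>, so that they
  are determined by their values on bilinear maps.\<close>

definition functionals :: "('k \<Rightarrow> 'v \<Rightarrow> 'v::ab_group_add) \<Rightarrow> ((('k, 'g) fa \<Rightarrow> 'g \<Rightarrow> 'v) \<Rightarrow> 'v) set" where
  "functionals s = {e. (\<forall>\<beta>. \<beta> \<notin> Bil s \<longrightarrow> e \<beta> = 0) \<and>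
     (\<forall>\<beta>\<in>Bil s. \<forall>\<gamma>\<in>Bil s. e (\<lambda>v y. \<beta> v y + \<gamma> v y) = e \<beta> + e \<gamma>) \<and>
     (\<forall>c. \<forall>\<beta>\<in>Bil s. e (\<lambda>v y. s c (\<beta> v y)) = s c (e \<beta>))}"

definition fun_act :: "('k \<Rightarrow> 'v \<Rightarrow> 'v::ab_group_add) \<Rightarrow> 'g \<Rightarrow> ((('k, 'g) fa \<Rightarrow> 'g \<Rightarrow> 'v) \<Rightarrow> 'v) \<Rightarrow>
    (('k, 'g) fa \<Rightarrow> 'g \<Rightarrow> 'v) \<Rightarrow> 'v" where
  "fun_act s z e \<beta> = (if \<beta> \<in> Bil s then e (rmul z \<beta>) else 0)"

lemma functionals_diff:
  assumes s: "Modules.module s" and e: "e \<in> functionals s" "\<beta> \<in> Bil s" "\<gamma> \<in> Bil s"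
  shows "e (\<lambda>v y. \<beta> v y - \<gamma> v y) = e \<beta> - e \<gamma>"
proof -
  have add: "e (\<lambda>v y. \<beta> v y + \<gamma> v y) = e \<beta> + e \<gamma>" if "\<beta> \<in> Bil s" "\<gamma> \<in> Bil s" for \<beta> \<gamma>
    using e(1) that by (simp add: functionals_def)
  have "e (\<lambda>v y. (\<beta> v y - \<gamma> v y) + \<gamma> v y) = e (\<lambda>v y. \<beta> v y - \<gamma> v y) + e \<gamma>"
    by (rule add[OF Bil_diff[OF e(2,3)] e(3)])
  then show ?thesis by simp
qed

text \<open>The bracket relation is the one for \<open>rmul\<close>, with the order of the two operators reversed by
  dualisation.\<close>

lemma super_rep_functionals:
  assumes s: "Modules.module s"
  shows "super_rep scg (even_pr pr) (even_br pr br) (fscale s) (functionals s) (\<lambda>z. fun_act s (pr 0 z))"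
proof (rule even_repI)
  show "Modules.module (fscale s)" by (rule module_fscale[OF s])
  show "module.subspace (fscale s) (functionals s)"
    using s by (auto simp: module.subspace_def[OF module_fscale[OF s]] functionals_def
        module.scale_zero_right module.scale_right_distrib module.scale_left_commute algebra_simps)
  fix z n assume n: "n \<in> functionals s"
  have radd: "rmul z (\<lambda>v y. \<beta> v y + \<gamma> v y) = (\<lambda>v y. rmul z \<beta> v y + rmul z \<gamma> v y)" for \<beta> \<gamma> :: "('k, 'g) fa \<Rightarrow> 'g \<Rightarrow> 'a"
    by (simp add: rmul_def fun_eq_iff algebra_simps)
  have rsc: "rmul z (\<lambda>v y. s c (\<beta> v y)) = (\<lambda>v y. s c (rmul z \<beta> v y))" for \<beta> c
    by (simp add: rmul_def fun_eq_iff module.scale_right_distrib[OF s])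
  show "fun_act s z n \<in> functionals s"
    using n by (auto simp: functionals_def fun_act_def radd rsc rmul_Bil Bil_add Bil_scale)
  show "fun_act s z (m + n) = fun_act s z m + fun_act s z n" for m
    by (simp add: fun_act_def fun_eq_iff)
  show "fun_act s z (fscale s c n) = fscale s c (fun_act s z n)" for c
    by (simp add: fun_act_def fun_eq_iff module.scale_zero_right[OF s])
  show "fun_act s (y + z) n = fun_act s y n + fun_act s z n" for y
    using n by (auto simp: fun_act_def fun_eq_iff rmul_add rmul_Bil functionals_def)
  show "fun_act s (scg c z) n = fscale s c (fun_act s z n)" for c
    using n by (auto simp: fun_act_def fun_eq_iff rmul_scale rmul_Bil functionals_def module.scale_zero_right[OF s])
  show "fun_act s (br y z) n = fun_act s y (fun_act s z n) - fun_act s z (fun_act s y n)"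
    if "pr 0 y = y" "pr 0 z = z" for y
    by (auto simp: fun_act_def fun_eq_iff rmul_bracket[OF _ that] rmul_Bil functionals_diff[OF s n])
qed

definition unit_fun :: "('k \<Rightarrow> 'v \<Rightarrow> 'v::ab_group_add) \<Rightarrow> 'g \<Rightarrow> (('k, 'g) fa \<Rightarrow> 'g \<Rightarrow> 'v) \<Rightarrow> 'v" where
  "unit_fun s y \<beta> = (if \<beta> \<in> Bil s then \<beta> 1 y else 0)"

lemma unit_fun: "unit_fun s y \<in> functionals s"
  by (auto simp: functionals_def unit_fun_def Bil_add Bil_scale)

text \<open>The value of \<open>\<beta>\<close> at the product \<open>v y\<close> in this order: let \<open>v\<close> act on \<open>\<beta>\<close> by \<open>rmul\<close> and evaluate the
  result at \<open>1\<close> and \<open>y\<close>.\<close>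

definition tau :: "('k \<Rightarrow> 'v \<Rightarrow> 'v::ab_group_add) \<Rightarrow> (('k, 'g) fa \<Rightarrow> 'g \<Rightarrow> 'v) \<Rightarrow> ('k, 'g) fa \<Rightarrow> 'g \<Rightarrow> 'v" where
  "tau s \<beta> v y = ev (fscale s) (\<lambda>z. fun_act s (pr 0 z)) v (unit_fun s y) \<beta>"

context
  fixes s :: "'k \<Rightarrow> 'v \<Rightarrow> 'v::ab_group_add"
  assumes s: "Modules.module s"
begin

interpretation fu: super_rep scg "even_pr pr" "even_br pr br" "fscale s" "functionals s" "\<lambda>z. fun_act s (pr 0 z)"
  by (rule super_rep_functionals[OF s])

lemma tau_lin_left: "lin pm_scale s (\<lambda>v. tau s \<beta> v y)"
  unfolding tau_def by (rule lin_comp[OF fu.evl lin_eval[OF s]])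

lemma tau_1: "\<beta> \<in> Bil s \<Longrightarrow> tau s \<beta> 1 y = \<beta> 1 y"
  by (simp add: tau_def unit_fun_def)

lemma tau_letter: "\<beta> \<in> Bil s \<Longrightarrow> tau s \<beta> (letter z * v) y = tau s (rmul (pr 0 z) \<beta>) v y"
  by (simp add: tau_def fu.ev_letter_mult unit_fun) (simp add: fun_act_def)

lemma tau_J: "j \<in> even.J \<Longrightarrow> tau s \<beta> j y = 0"
  by (simp add: tau_def fu.ev_J unit_fun)

lemma tau_functional: "(\<lambda>\<beta>. tau s \<beta> v y) \<in> functionals s"
  unfolding tau_def using fu.ev_closed[OF unit_fun] .

lemma tau_diff: "\<beta> \<in> Bil s \<Longrightarrow> \<gamma> \<in> Bil s \<Longrightarrow> tau s (\<lambda>v y. \<beta> v y - \<gamma> v y) v y = tau s \<beta> v y - tau s \<gamma> v y"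
  using functionals_diff[OF s tau_functional] by blast

lemma tau_add: "\<beta> \<in> Bil s \<Longrightarrow> \<gamma> \<in> Bil s \<Longrightarrow> tau s (\<lambda>v y. \<beta> v y + \<gamma> v y) v y = tau s \<beta> v y + tau s \<gamma> v y"
  using tau_functional unfolding functionals_def by blast

lemmas tau_simps = lin_simps[OF tau_lin_left]

lemma tau_lin_right: "\<beta> \<in> Bil s \<Longrightarrow> lin scg s (tau s \<beta> v)"
proof (induction v arbitrary: \<beta> rule: fa_induct)
  case (one)
  then show ?case using Bil_right[of \<beta> s 1] by (simp add: tau_1[OF one] cong: module_hom_iff)
    (simp add: module_hom_iff tau_1[OF one])
next
  case (letter x f)
  show ?case using letter.IH[OF rmul_Bil[OF letter.prems]] by (simp add: module_hom_iff tau_letter[OF letter.prems])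
qed (auto simp: module_hom_iff tau_simps module_scg s module.scale_zero_right[OF s]
    module.scale_right_distrib[OF s] module.scale_left_commute[OF s] algebra_simps)

lemma tau_Bil:
  assumes "\<beta> \<in> Bil s"
  shows "tau s \<beta> \<in> Bil s"
  unfolding Bil_def using tau_lin_left tau_J tau_lin_right[OF assms] by blast

text \<open>\<open>v z y = v y z + v [z, y]\<close> for even \<open>z\<close>.\<close>

lemma tau_right:
  assumes "\<beta> \<in> Bil s" "pr 0 z = z"
  shows "tau s \<beta> (v * letter z) y = tau s (\<lambda>v. \<beta> (v * letter z)) v y + tau s \<beta> v (br z y)"
  using assms(1)
proof (induction v arbitrary: \<beta> rule: fa_induct)
  case one
  have "tau s \<beta> (letter z) y = tau s (rmul z \<beta>) 1 y"
    using tau_letter[OF one, of z 1] assms(2) by simp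
  then show ?case
    by (simp add: tau_1 rmul_Bil one Bil_mult_right) (simp add: rmul_def)
next
  case (letter x f)
  have "rmul (pr 0 x) (\<lambda>v. \<beta> (v * letter z)) = (\<lambda>v. rmul (pr 0 x) \<beta> (v * letter z))"
    by (simp add: rmul_def mult.assoc)
  then show ?case
    by (simp add: mult.assoc tau_letter letter.prems rmul_Bil Bil_mult_right letter.IH)
qed (simp_all add: tau_simps algebra_simps pm_scale_mult module.scale_right_distrib[OF s])

text \<open>Each commutator that arises when \<open>y\<close> moves from the right of a word to its left absorbs a letter of the
  word. So the difference between the values at \<open>v y\<close> and at \<open>y v\<close> only involves values at shorter words.\<close>

lemma tau_lower:
  assumes S: "module.subspace s S" and \<beta>: "\<beta> \<in> Bil s"
    and low: "\<And>ws y. length ws < n \<Longrightarrow> pr 1 y = y \<Longrightarrow> \<beta> (word ws) y \<in> S"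
    and ws: "length ws \<le> n" "pr 1 y = y"
  shows "tau s \<beta> (word ws) y - \<beta> (word ws) y \<in> S"
  using \<beta> low ws(1)
proof (induction ws arbitrary: \<beta> n)
  case Nil
  then show ?case by (simp add: tau_1 module.subspace_0[OF s S])
next
  case (Cons z ws)
  then obtain m where n: "n = Suc m" and m: "length ws \<le> m" by (cases n) auto
  have odd: "pr 1 (br (pr 0 z) y) = br (pr 0 z) y" if "pr 1 y = y" for y
    using br_parity[of 0 "pr 0 z" 1 y] that by simp
  have z: "\<beta> (letter (pr 0 z) * v) y = \<beta> (letter z * v) y" for v y
    using even.J_neg[OF even_J_pr[of z v]]
    by (intro Bil_cong[OF Cons.prems(1)]) (simp add: algebra_simps)
  have r: "rmul (pr 0 z) \<beta> (word us) y = \<beta> (word (z # us)) y + \<beta> (word us) (br (pr 0 z) y)" for us y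
    by (simp add: rmul_def z word_Cons)
  have "tau s (rmul (pr 0 z) \<beta>) (word ws) y - rmul (pr 0 z) \<beta> (word ws) y \<in> S"
  proof (rule Cons.IH[OF rmul_Bil[OF Cons.prems(1)] _ m])
    fix us :: "'g list" and y assume "length us < m" "pr 1 y = y"
    then show "rmul (pr 0 z) \<beta> (word us) y \<in> S"
      unfolding r by (intro module.subspace_add[OF s S] Cons.prems(2)) (auto simp: n odd)
  qed
  moreover have "\<beta> (word ws) (br (pr 0 z) y) \<in> S"
    using m ws(2) by (intro Cons.prems(2)) (auto simp: n odd)
  ultimately have "(tau s (rmul (pr 0 z) \<beta>) (word ws) y - rmul (pr 0 z) \<beta> (word ws) y) +
     \<beta> (word ws) (br (pr 0 z) y) \<in> S"
    by (rule module.subspace_add[OF s S])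
  then show ?case
    by (simp add: r word_Cons tau_letter[OF Cons.prems(1)])
qed

text \<open>By induction on the length of words the shorter terms vanish, and what remains is
  \<open>\<beta> v (y - \<phi> y) = 0\<close>; every odd element has the form \<open>y - \<phi> y\<close>.\<close>

lemma tau_unique:
  assumes \<beta>: "\<beta> \<in> Bil s" and eq: "\<And>v y. pr 1 y = y \<Longrightarrow> \<beta> v y = tau s \<beta> v (\<phi> y)" and y: "pr 1 y = y"
  shows "\<beta> v y = 0"
proof -
  have "\<beta> (word ws) y = 0" if "pr 1 y = y" for ws y
    using that
  proof (induction "length ws" arbitrary: ws y rule: less_induct)
    case less
    have *: "\<beta> (word ws) (y - \<phi> y) = 0" if "pr 1 y = y" for y
    proof -
      have "tau s \<beta> (word ws) (\<phi> y) - \<beta> (word ws) (\<phi> y) \<in> {0}"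
        by (rule tau_lower[OF module.subspace_single_0[OF s] \<beta>, where n = "length ws"])
          (use less.hyps \<phi>_odd that in auto)
      then show ?thesis using eq[OF that, of "word ws"] by (simp add: Bil_simps[OF \<beta>])
    qed
    show ?case using *[OF \<psi>_odd[OF less.prems]] \<psi>_right[OF less.prems] by simp
  qed
  then have w: "\<beta> (word ws) y = 0" for ws using y .
  show ?thesis
    by (induction v rule: pm_induct)
      (simp_all only: Bil_simps[OF \<beta>] single_word w module.scale_zero_right[OF s] add_0)
qed

text \<open>The equation \<open>L v y = A v y + tau s L v (\<phi> y)\<close> for odd \<open>y\<close> is equivalent to
  \<open>L v y = A v (\<psi> y) + (tau s L - L) v (\<phi> (\<psi> y))\<close>, as \<open>y + \<phi> (\<psi> y) = \<psi> y\<close>. If \<open>\<beta>\<close>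
  vanishes on all words shorter than \<open>k\<close>, then \<open>step \<beta>\<close> vanishes on the words of length \<open>k\<close> as well.
  So the Neumann series of the iterates of \<open>step\<close> has finitely many nonzero terms at each word, and \<open>sol\<close>
  is its sum.\<close>

definition step :: "(('k, 'g) fa \<Rightarrow> 'g \<Rightarrow> 'v) \<Rightarrow> ('k, 'g) fa \<Rightarrow> 'g \<Rightarrow> 'v" where
  "step \<beta> v y = tau s \<beta> v (\<phi> (\<psi> (pr 1 y))) - \<beta> v (\<phi> (\<psi> (pr 1 y)))"

definition steps :: "(('k, 'g) fa \<Rightarrow> 'g \<Rightarrow> 'v) \<Rightarrow> nat \<Rightarrow> ('k, 'g) fa \<Rightarrow> 'g \<Rightarrow> 'v" where
  "steps A k = (step ^^ k) (\<lambda>v y. A v (\<psi> (pr 1 y)))"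

definition sol :: "(('k, 'g) fa \<Rightarrow> 'g \<Rightarrow> 'v) \<Rightarrow> ('k, 'g) fa \<Rightarrow> 'g \<Rightarrow> 'v" where
  "sol A v y = lin_ext s (\<lambda>w. \<Sum>k\<le>length (letters w). steps A k (word (letters w)) y) v"

context
  fixes A assumes A: "A \<in> Bil s"
begin

lemma steps_Bil: "steps A k \<in> Bil s"
proof (induction k)
  case 0
  then show ?case
    using Bil_comp[OF A module.module_hom_ident[OF module_pm] lin_comp[OF pr_lin \<psi>_lin]]
    by (simp add: steps_def)
next
  case (Suc k)
  have "step \<beta> \<in> Bil s" if "\<beta> \<in> Bil s" for \<beta>
    unfolding step_def using that
      Bil_diff[OF Bil_comp[OF tau_Bil[OF that] module.module_hom_ident[OF module_pm] lin_comp[OF lin_comp[OF pr_lin \<psi>_lin] \<phi>_lin]]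
        Bil_comp[OF that module.module_hom_ident[OF module_pm] lin_comp[OF lin_comp[OF pr_lin \<psi>_lin] \<phi>_lin]]]
    by simp
  then show ?case using Suc by (simp add: steps_def)
qed

lemma steps_vanish: "length ws < k \<Longrightarrow> steps A k (word ws) y = 0"
proof (induction k arbitrary: ws y)
  case (Suc k)
  have "pr 1 (\<phi> (\<psi> (pr 1 y))) = \<phi> (\<psi> (pr 1 y))"
    by (intro \<phi>_odd \<psi>_odd) simp
  then have "tau s (steps A k) (word ws) (\<phi> (\<psi> (pr 1 y))) - steps A k (word ws) (\<phi> (\<psi> (pr 1 y))) \<in> {0}"
    using Suc by (intro tau_lower[OF module.subspace_single_0[OF s] steps_Bil, where n = k]) auto
  then show ?case by (simp add: steps_def step_def)
qed simp

lemma sol_eq_sum: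
  assumes "\<And>w. w \<in> Poly_Mapping.keys v \<Longrightarrow> length (letters w) \<le> n"
  shows "sol A v y = (\<Sum>k\<le>n. steps A k v y)"
  unfolding sol_def
proof (rule pm_lin_eqI[OF lin_ext_lin[OF s]])
  show "lin pm_scale s (\<lambda>v. \<Sum>k\<le>n. steps A k v y)"
    by (intro linI module_pm s)
      (simp_all add: Bil_simps[OF steps_Bil] sum.distrib module.scale_sum_right[OF s])
  fix w assume w: "w \<in> Poly_Mapping.keys v"
  have "(\<Sum>k\<le>length (letters w). steps A k (word (letters w)) y) = (\<Sum>k\<le>n. steps A k (word (letters w)) y)"
    by (rule sum.mono_neutral_left) (use assms[OF w] steps_vanish in auto)
  then show "lin_ext s (\<lambda>w. \<Sum>k\<le>length (letters w). steps A k (word (letters w)) y) (Poly_Mapping.single w 1) =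
       (\<Sum>k\<le>n. steps A k (Poly_Mapping.single w 1) y)"
    by (simp only: lin_ext_single_1[OF s]) (simp add: single_word)
qed

lemma sol_word: "length ws \<le> n \<Longrightarrow> sol A (word ws) y = (\<Sum>k\<le>n. steps A k (word ws) y)"
  by (rule sol_eq_sum) (simp add: word_def)

lemma sol_bound: "\<exists>n. \<forall>y. sol A v y = (\<Sum>k\<le>n. steps A k v y)"
proof (intro exI allI)
  show "sol A v y = (\<Sum>k\<le>Max ((\<lambda>w. length (letters w)) ` Poly_Mapping.keys v). steps A k v y)" for y
    by (rule sol_eq_sum) (auto intro: Max_ge)
qed

lemma sol_Bil: "sol A \<in> Bil s"
proof -
  have "lin pm_scale s (\<lambda>v. sol A v y)" for y
    unfolding sol_def by (rule lin_ext_lin[OF s])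
  moreover have "lin scg s (sol A v)" for v
  proof -
    obtain n where n: "\<And>y. sol A v y = (\<Sum>k\<le>n. steps A k v y)" using sol_bound by blast
    show ?thesis
      by (intro linI module_scg s)
        (simp_all add: n Bil_simps[OF steps_Bil] sum.distrib module.scale_sum_right[OF s])
  qed
  moreover have "sol A j y = 0" if "j \<in> even.J" for j y
    using sol_bound[of j] by (auto simp: Bil_J[OF steps_Bil that])
  ultimately show ?thesis by (simp add: Bil_def)
qed

lemma sum_steps_Bil: "(\<lambda>v y. \<Sum>k\<le>(n::nat). steps A k v y) \<in> Bil s"
  by (induction n) (auto intro: Bil_add steps_Bil)

lemma tau_sum_steps: "tau s (\<lambda>v y. \<Sum>k\<le>(n::nat). steps A k v y) v y = (\<Sum>k\<le>n. tau s (steps A k) v y)"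
  by (induction n) (simp_all add: tau_add sum_steps_Bil steps_Bil)

lemma sol_eq:
  assumes y: "pr 1 y = y"
  shows "sol A v y = A v y + tau s (sol A) v (\<phi> y)"
proof (rule pm_lin_eqI[OF Bil_left[OF sol_Bil]])
  show "lin pm_scale s (\<lambda>v. A v y + tau s (sol A) v (\<phi> y))"
    by (rule lin_add_fun[OF Bil_left[OF A] tau_lin_left])
  fix w :: "'g tword" define ws where "ws = letters w"
  let ?n = "length ws"
  have fy: "pr 1 (\<phi> y) = \<phi> y" by (rule \<phi>_odd[OF y])
  have u: "pr 1 (y - \<phi> y) = y - \<phi> y" using y fy by (simp add: pr_simps)
  have p: "\<psi> (pr 1 (y - \<phi> y)) = y" using \<psi>_left[OF y] u by simp
  have t: "tau s (\<lambda>v y. sol A v y - (\<Sum>k\<le>?n. steps A k v y)) (word ws) (\<phi> y) = 0"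
  proof -
    have "tau s (\<lambda>v y. sol A v y - (\<Sum>k\<le>?n. steps A k v y)) (word ws) (\<phi> y) -
        (sol A (word ws) (\<phi> y) - (\<Sum>k\<le>?n. steps A k (word ws) (\<phi> y))) \<in> {0}"
      by (rule tau_lower[OF module.subspace_single_0[OF s] Bil_diff[OF sol_Bil sum_steps_Bil], where n = ?n])
        (simp_all add: fy sol_word[of _ ?n])
    then show ?thesis by (simp add: sol_word[of _ ?n])
  qed
  (* One more term than needed: removing the first one leaves the image under step of the sum up to n. *)
  have "sol A (word ws) (y - \<phi> y) = (\<Sum>k\<le>Suc ?n. steps A k (word ws) (y - \<phi> y))"
    by (rule sol_word) simp
  also have "\<dots> = steps A 0 (word ws) (y - \<phi> y) + (\<Sum>k\<le>?n. steps A (Suc k) (word ws) (y - \<phi> y))"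
    by (rule sum.atMost_Suc_shift)
  also have "\<dots> = A (word ws) y + (\<Sum>k\<le>?n. tau s (steps A k) (word ws) (\<phi> y) - steps A k (word ws) (\<phi> y))"
    by (simp add: steps_def step_def p del: sum.atMost_Suc)
  also have "\<dots> = A (word ws) y + tau s (sol A) (word ws) (\<phi> y) - sol A (word ws) (\<phi> y)"
    using t by (simp add: sum_subtractf tau_diff[OF sol_Bil sum_steps_Bil] tau_sum_steps sol_word[of ws ?n])
  finally show "sol A (Poly_Mapping.single w 1) y = A (Poly_Mapping.single w 1) y + tau s (sol A) (Poly_Mapping.single w 1) (\<phi> y)"
    by (simp add: single_word ws_def[symmetric] Bil_simps[OF sol_Bil])
qed

text \<open>By the same induction as for uniqueness, the solution respects every filtration by length that its
  inhomogeneous term respects.\<close>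

lemma sol_filtered:
  assumes S: "\<And>n. module.subspace s (S n)" "\<And>m n. m \<le> n \<Longrightarrow> S m \<subseteq> S n"
    and AS: "\<And>ws y. pr 1 y = y \<Longrightarrow> A (word ws) y \<in> S (length ws)" and y: "pr 1 y = y"
  shows "sol A (word ws) y \<in> S (length ws)"
  using y
proof (induction "length ws" arbitrary: ws y rule: less_induct)
  case less
  have *: "sol A (word ws) (y - \<phi> y) \<in> S (length ws)" if y: "pr 1 y = y" for y
  proof -
    have "tau s (sol A) (word ws) (\<phi> y) - sol A (word ws) (\<phi> y) \<in> S (length ws)"
    proof (rule tau_lower[OF S(1) sol_Bil, where n = "length ws"])
      show "sol A (word us) u \<in> S (length ws)" if "length us < length ws" "pr 1 u = u" for us u
        using less.hyps[OF that] S(2)[of "length us" "length ws"] that by auto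
    qed (use \<phi>_odd[OF y] in auto)
    from module.subspace_add[OF s S(1) AS[OF y] this]
    show ?thesis using sol_eq[OF y, of "word ws"] by (simp add: Bil_simps[OF sol_Bil] algebra_simps)
  qed
  show ?case using *[OF \<psi>_odd[OF less.prems]] \<psi>_right[OF less.prems] by simp
qed

end

end

text \<open>\<open>tau\<close> commutes with composition by linear maps, so the defining equation of a solution is preserved by
  linear maps out of its target.\<close>

lemma tau_post:
  assumes "Modules.module s" "lin s s2 g" "\<beta> \<in> Bil s"
  shows "tau s2 (\<lambda>v y. g (\<beta> v y)) v y = g (tau s \<beta> v y)"
proof -
  have s2: "Modules.module s2" using assms(2) by (rule module_hom.axioms(2))
  show ?thesis using assms(3)
  proof (induction v arbitrary: \<beta> rule: fa_induct)
    case (letter x f)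
    have "rmul (pr 0 x) (\<lambda>v y. g (\<beta> v y)) = (\<lambda>v y. g (rmul (pr 0 x) \<beta> v y))"
      by (simp add: rmul_def fun_eq_iff lin_add[OF assms(2)])
    then show ?case
      by (simp add: tau_letter[OF s2] tau_letter[OF assms(1)] letter Bil_post[OF _ assms(2)] rmul_Bil)
  qed (simp_all add: tau_simps[OF s2] tau_simps[OF assms(1)] lin_simps[OF assms(2)] tau_1[OF s2]
      tau_1[OF assms(1)] Bil_post[OF _ assms(2)])
qed

end

context twisted_lie
begin

section \<open>Left multiplication of the generators by odd elements\<close>

text \<open>The inhomogeneous term of the equation. In its solution \<open>lodd\<close>, the value \<open>lodd v y\<close> will be the product
  of the odd element \<open>y\<close> with \<open>1 \<otimes> v\<close>.\<close>

definition act1 :: "('k, 'g) fa \<Rightarrow> 'g \<Rightarrow> ('k, 'g) fa2" where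
  "act1 v y = iact y (tens 1 v)"

definition lodd :: "('k, 'g) fa \<Rightarrow> 'g \<Rightarrow> ('k, 'g) fa2" where
  "lodd = sol pm_scale act1"

lemma tens_lin_left: "lin pm_scale pm_scale (\<lambda>f. tens f v)"
  and tens_lin_right: "lin pm_scale pm_scale (\<lambda>v. tens f v)"
  by (rule lin_comp[OF ten_lin_left ind_lin] lin_comp[OF ten_lin_right ind_lin])+

lemmas tens_simps = lin_simps[OF tens_lin_left] lin_simps[OF tens_lin_right]

lemma act_lin_left: "lin scg pm_scale (\<lambda>x. iact x t)"
  by (intro linI module_scg module_pm) (auto simp: ind.a_add_left ind.a_scale_left)

lemmas act_left_simps = lin_simps[OF act_lin_left]

lemma act1_Bil: "act1 \<in> Bil pm_scale"
proof -
  have "act1 = (\<lambda>v y. iact y (tens 1 v))" by (simp add: act1_def fun_eq_iff)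
  then show ?thesis
    by (auto simp: Bil_def tens_eq_0 act_simps act_lin_left intro: lin_comp[OF tens_lin_right act_lin])
qed

lemmas lodd_Bil = sol_Bil[OF module_pm act1_Bil, folded lodd_def]
  and lodd_eq = sol_eq[OF module_pm act1_Bil, folded lodd_def]

lemmas lodd_simps = Bil_simps[OF lodd_Bil]

lemma ad0_J: "pr 0 z = z \<Longrightarrow> j \<in> even.J \<Longrightarrow> ad0 z j \<in> even.J"
  unfolding ad0_def by (intro even.J_diff even.J_mult_left even.J_mult_right)

lemma tens_act_even: "pr 0 z = z \<Longrightarrow> iact z (tens 1 v) = tens 1 (ad0 z v)"
  using tens_balanced[of z 1 v] by (simp add: act_tens)

text \<open>Equivariance under the even part. The defect of equivariance of the solution is again a solution, of the
  equation whose right-hand side is the defect of \<open>act1\<close>; the latter is \<open>0\<close>.\<close>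

lemma lodd_ad0:
  assumes z: "pr 0 z = z" and y: "pr 1 y = y"
  shows "lodd (ad0 z v) y = iact z (lodd v y) - lodd v (br z y)"
proof -
  define \<beta> where "\<beta> = (\<lambda>v y. (lodd (ad0 z v) y - iact z (lodd v y)) + lodd v (br z y))"
  have B1: "(\<lambda>v. lodd (ad0 z v)) \<in> Bil pm_scale"
    using Bil_comp[OF lodd_Bil ad0_lin module.module_hom_ident[OF module_scg]] ad0_J[OF z] by simp
  have B2: "(\<lambda>v y. iact z (lodd v y)) \<in> Bil pm_scale"
    by (rule Bil_post[OF lodd_Bil act_lin])
  have B3: "(\<lambda>v y. lodd v (br z y)) \<in> Bil pm_scale"
    by (rule Bil_br[OF lodd_Bil])
  have "\<beta> v y = 0"
  proof (rule tau_unique[OF module_pm _ _ y])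
    show "\<beta> \<in> Bil pm_scale"
      unfolding \<beta>_def by (intro Bil_add Bil_diff B1 B2 B3)
    fix v y assume y: "pr 1 y = y"
    have o: "pr 1 (br z y) = br z y" using br_parity[OF z y] by simp
    have fb: "\<phi> (br z y) = br z (\<phi> y)" by (simp add: \<phi>_br \<phi>_even[OF z])
    have t3: "tau pm_scale (\<lambda>v y. lodd v (br z y)) v u + tau pm_scale (\<lambda>v. lodd (ad0 z v)) v u =
      tau pm_scale lodd (ad0 z v) u + tau pm_scale lodd v (br z u)" for u
    proof -
      have e: "(\<lambda>v y. lodd v (br z y) + lodd (ad0 z v) y) = (\<lambda>v y. rmul z lodd v y - lodd (v * letter z) y)"
        by (simp add: rmul_def ad0_def lodd_simps fun_eq_iff)
      have "tau pm_scale (\<lambda>v y. lodd v (br z y)) v u + tau pm_scale (\<lambda>v. lodd (ad0 z v)) v u =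
        tau pm_scale (\<lambda>v y. lodd v (br z y) + lodd (ad0 z v) y) v u"
        by (rule tau_add[OF module_pm B3 B1, symmetric])
      also have "\<dots> = tau pm_scale (rmul z lodd) v u - tau pm_scale (\<lambda>v. lodd (v * letter z)) v u"
        unfolding e by (rule tau_diff[OF module_pm rmul_Bil[OF lodd_Bil] Bil_mult_right[OF lodd_Bil]])
      also have "\<dots> = tau pm_scale lodd (ad0 z v) u + tau pm_scale lodd v (br z u)"
        by (simp add: tau_letter[OF module_pm lodd_Bil] tau_right[OF module_pm lodd_Bil z] ad0_def z
          tau_simps[OF module_pm])
      finally show ?thesis .
    qed
    have t: "tau pm_scale \<beta> v u = tau pm_scale (\<lambda>v. lodd (ad0 z v)) v u - iact z (tau pm_scale lodd v u)
        + tau pm_scale (\<lambda>v y. lodd v (br z y)) v u" for u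
      by (simp add: \<beta>_def tau_add[OF module_pm Bil_diff[OF B1 B2] B3] tau_diff[OF module_pm B1 B2]
        tau_post[OF module_pm act_lin lodd_Bil])
    have "act1 (ad0 z v) y - iact z (act1 v y) + act1 v (br z y) = 0"
      using ind.a_bracket[OF z y] by (simp add: act1_def tens_act_even[OF z, symmetric])
    then show "\<beta> v y = tau pm_scale \<beta> v (\<phi> y)"
      using t3[of "\<phi> y"]
      by (simp add: t, simp add: \<beta>_def lodd_eq[OF y] lodd_eq[OF o] act_simps fb algebra_simps)
  qed
  then show ?thesis by (simp add: \<beta>_def algebra_simps eq_neg_iff_add_eq_0)
qed

section \<open>Left multiplication on the induced module\<close>

text \<open>The module \<open>Hom(\<gg>, Ind)\<close>. If \<open>\<kappa> x = \<lambda>\<^sub>x t\<close>, the formula gives \<open>x \<mapsto> \<lambda>\<^sub>x (a\<^sub>y t)\<close> as dictated by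
  \<open>\<lambda>\<^sub>x a\<^sub>y = \<plusminus> a\<^sub>y \<lambda>\<^sub>x + \<lambda>\<^sub>[\<^sub>x\<^sub>,\<^sub>y\<^sub>]\<close>; the argument \<open>pr 0 y - pr 1 y\<close> produces the sign for odd \<open>x\<close>.\<close>

definition hom_act :: "'g \<Rightarrow> ('g \<Rightarrow> ('k, 'g) fa2) \<Rightarrow> 'g \<Rightarrow> ('k, 'g) fa2" where
  "hom_act y \<kappa> x = iact y (\<kappa> (pr 0 x)) + iact (pr 0 y - pr 1 y) (\<kappa> (pr 1 x)) + \<kappa> (br x y)"

definition homs :: "('g \<Rightarrow> ('k, 'g) fa2) set" where
  "homs = {\<kappa>. lin scg pm_scale \<kappa> \<and> (\<forall>x. \<kappa> x = \<kappa> (pr 0 x) + \<kappa> (pr 1 x))}"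

lemma homs_lin: "\<kappa> \<in> homs \<Longrightarrow> lin scg pm_scale \<kappa>"
  and homs_pr: "\<kappa> \<in> homs \<Longrightarrow> \<kappa> x = \<kappa> (pr 0 x) + \<kappa> (pr 1 x)"
  unfolding homs_def by blast+

lemma homsI: "lin scg pm_scale \<kappa> \<Longrightarrow> (\<And>x. \<kappa> x = \<kappa> (pr 0 x) + \<kappa> (pr 1 x)) \<Longrightarrow> \<kappa> \<in> homs"
  unfolding homs_def by blast

lemma hom_act_hom:
  assumes "pr p x = x" "pr q y = y" "\<kappa> \<in> homs"
  shows "hom_act y \<kappa> x = sg p q (iact y (\<kappa> x)) + \<kappa> (br x y)"
  using pr_other[OF assms(1)] pr_other[OF assms(2)] assms(1,2)
  by (cases p; cases q) (auto simp: hom_act_def lin_zero[OF homs_lin[OF assms(3)]] act_simps act_left_simps)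

lemma hom_act_pr: "\<kappa> \<in> homs \<Longrightarrow> hom_act y \<kappa> x = hom_act y \<kappa> (pr 0 x) + hom_act y \<kappa> (pr 1 x)"
  using br_decomp(1)[of x y]
  by (simp add: hom_act_def lin_simps[OF homs_lin] act_simps act_left_simps)

lemma hom_act_homs:
  assumes "\<kappa> \<in> homs"
  shows "hom_act y \<kappa> \<in> homs"
proof -
  have "lin scg pm_scale (hom_act y \<kappa>)"
    unfolding hom_act_def
    by (intro lin_add_fun lin_comp[OF lin_comp[OF pr_lin homs_lin[OF assms]] act_lin]
        lin_comp[OF br_lin_left homs_lin[OF assms]])
  then show ?thesis by (rule homsI) (rule hom_act_pr[OF assms])
qed

lemma super_rep_homs: "super_rep scg pr br (fscale pm_scale) homs hom_act"
proof (intro super_rep.intro super_lie_axioms super_rep_axioms.intro)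
  show "Modules.module (fscale pm_scale :: 'k \<Rightarrow> ('g \<Rightarrow> ('k, 'g) fa2) \<Rightarrow> _)"
    by (rule module_fscale[OF module_pm])
  show "module.subspace (fscale pm_scale) homs"
    unfolding module.subspace_def[OF module_fscale[OF module_pm]]
  proof (intro conjI ballI allI)
    show "0 \<in> homs"
      by (rule homsI) (auto intro!: linI module_scg module_pm)
    fix \<kappa> assume \<kappa>: "\<kappa> \<in> homs"
    note l = lin_simps[OF homs_lin[OF \<kappa>]]
    show "fscale pm_scale c \<kappa> \<in> homs" for c
    proof (rule homsI)
      show "fscale pm_scale c \<kappa> x = fscale pm_scale c \<kappa> (pr 0 x) + fscale pm_scale c \<kappa> (pr 1 x)" for x
        using homs_pr[OF \<kappa>, of x] by (simp add: pm_scale_distribs)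
    qed (auto intro!: linI module_scg module_pm simp: l pm_scale_distribs mult.commute)
    fix \<kappa>' assume \<kappa>': "\<kappa>' \<in> homs"
    show "\<kappa> + \<kappa>' \<in> homs"
    proof (rule homsI)
      show "(\<kappa> + \<kappa>') x = (\<kappa> + \<kappa>') (pr 0 x) + (\<kappa> + \<kappa>') (pr 1 x)" for x
        using homs_pr[OF \<kappa>, of x] homs_pr[OF \<kappa>', of x] by simp
    qed (auto intro!: linI module_scg module_pm simp: l lin_simps[OF homs_lin[OF \<kappa>']] pm_scale_distribs)
  qed
  fix n assume n: "n \<in> homs"
  note ln = lin_simps[OF homs_lin[OF n]]
  show "hom_act x n \<in> homs" for x by (rule hom_act_homs[OF n])
  show "hom_act x (m + n) = hom_act x m + hom_act x n" for x m
    by (simp add: hom_act_def fun_eq_iff act_simps algebra_simps)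
  show "hom_act x (fscale pm_scale c n) = fscale pm_scale c (hom_act x n)" for x c
    by (simp add: hom_act_def fun_eq_iff act_simps pm_scale_distribs)
  show "hom_act (x + y) n = hom_act x n + hom_act y n" for x y
    by (simp add: hom_act_def fun_eq_iff act_left_simps br_simps ln pr_simps algebra_simps)
  show "hom_act (scg c x) n = fscale pm_scale c (hom_act x n)" for x c
    by (simp add: hom_act_def fun_eq_iff act_left_simps br_simps ln pr_simps pm_scale_distribs)
  show "hom_act x n = hom_act (pr 0 x) n + hom_act (pr 1 x) n" for x
  proof
    fix u
    have "iact x (n (pr 0 u)) = iact (pr 0 x) (n (pr 0 u)) + iact (pr 1 x) (n (pr 0 u))"
      by (rule ind.a_pr) simp
    moreover have "n (br u x) = n (br u (pr 0 x)) + n (br u (pr 1 x))"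
      using br_decomp(2)[of u x] by (simp add: ln)
    ultimately show "hom_act x n u = (hom_act (pr 0 x) n + hom_act (pr 1 x) n) u"
      by (simp add: hom_act_def act_left_simps)
  qed
  show "hom_act (br y z) n = hom_act y (hom_act z n) - sg q r (hom_act z (hom_act y n))"
    if y: "pr q y = y" and z: "pr r z = z" for q r y z
  proof
    have h: "hom_act (br y z) n x = hom_act y (hom_act z n) x - sg q r (hom_act z (hom_act y n) x)"
      if x: "pr p x = x" for p x
    proof -
      have j: "br x (br y z) = br (br x y) z - sg q r (br (br x z) y)"
      proof -
        have "br y (br x z) = - sg q (p + r) (br (br x z) y)"
          by (rule br_skew[OF y br_parity[OF x z]])
        then show ?thesis
          using br_jacobi[OF x y z] by (cases p; cases q; cases r) (auto simp: sg_def)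
      qed
      show ?thesis
        using hom_act_hom[OF x br_parity[OF y z] n] hom_act_hom[OF x y hom_act_homs[OF n]]
          hom_act_hom[OF x z hom_act_homs[OF n]] hom_act_hom[OF x y n] hom_act_hom[OF x z n]
          hom_act_hom[OF br_parity[OF x y] z n] hom_act_hom[OF br_parity[OF x z] y n]
          ind.a_bracket[OF y z, of "n x"] j
        by (cases p; cases q; cases r) (simp_all add: ln act_simps)
    qed
    fix x
    have s: "(sg q r \<kappa>) x = sg q r (\<kappa> x)" for \<kappa> :: "'g \<Rightarrow> ('k, 'g) fa2"
      by (simp add: sg_def)
    show "hom_act (br y z) n x = (hom_act y (hom_act z n) - sg q r (hom_act z (hom_act y n))) x"
      using h[OF pr_pr_same[of 0 x]] h[OF pr_pr_same[of 1 x]] hom_act_pr[OF n, of "br y z" x]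
        hom_act_pr[OF hom_act_homs[OF n], of y z x] hom_act_pr[OF hom_act_homs[OF n], of z y x]
      by (simp add: s) (cases q; cases r; simp)
  qed
qed

text \<open>The prescription for \<open>\<lambda>\<^sub>x (1 \<otimes> v)\<close>.\<close>

definition lmul1 :: "('k, 'g) fa \<Rightarrow> 'g \<Rightarrow> ('k, 'g) fa2" where
  "lmul1 v x = tens 1 (letter (pr 0 x) * v) + lodd v (pr 1 x)"

lemma even_letter_lin: "lin scg pm_scale (\<lambda>x. tens f (letter (pr 0 x) * v))"
proof (intro linI module_scg module_pm)
  show "tens f (letter (pr 0 (x + y)) * v) = tens f (letter (pr 0 x) * v) + tens f (letter (pr 0 y) * v)" for x y
    using tens_eq_0(2)[OF even_J_add[of "pr 0 x" "pr 0 y" v], of f]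
    by (simp add: algebra_simps tens_simps pr_simps)
  show "tens f (letter (pr 0 (scg c x)) * v) = pm_scale c (tens f (letter (pr 0 x) * v))" for c x
    using tens_eq_0(2)[OF even_J_scale[of c "pr 0 x" v], of f]
    by (simp add: algebra_simps tens_simps pr_simps pm_scale_mult)
qed

lemma tens_even_bracket: "pr 0 x = x \<Longrightarrow> pr 0 y = y \<Longrightarrow>
    tens f (letter (br x y) * v) = tens f (letter x * (letter y * v)) - tens f (letter y * (letter x * v))"
  using tens_eq_0(2)[OF even_J_bracket[of x y v], of f]
  by (simp add: algebra_simps tens_simps)

lemma tens_even_pr: "tens f (letter (pr 0 z) * v) = tens f (letter z * v)"
  using tens_eq_0(2)[OF even_J_pr[of z v], of f]
  by (simp add: algebra_simps tens_simps)

lemma lmul1_homs: "lmul1 v \<in> homs"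
proof -
  have "lin scg pm_scale (lmul1 v)"
    unfolding lmul1_def
    by (intro lin_add_fun even_letter_lin lin_comp[OF pr_lin Bil_right[OF lodd_Bil]])
  moreover have "lmul1 v x = lmul1 v (pr 0 x) + lmul1 v (pr 1 x)" for x
    using lin_zero[OF even_letter_lin, of 1 v] by (simp add: lmul1_def lodd_simps pr_simps)
  ultimately show ?thesis by (rule homsI)
qed

lemma lmul1_lin: "lin pm_scale (fscale pm_scale) lmul1"
  by (intro linI module_pm module_fscale)
    (auto simp: lmul1_def fun_eq_iff algebra_simps tens_simps lodd_simps pm_scale_distribs pm_scale_mult)

lemma lmul1_even: "pr 0 x = x \<Longrightarrow> lmul1 v x = tens 1 (letter x * v)"
  and lmul1_odd: "pr 1 x = x \<Longrightarrow> lmul1 v x = lodd v x"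
  using lin_zero[OF even_letter_lin, of 1 v] pr_01(1)[of x]
  by (auto simp: lmul1_def pr_other lodd_simps pr_simps)

lemma lmul1_ad0:
  assumes z: "pr 0 z = z"
  shows "lmul1 (ad0 z v) = hom_act z (lmul1 v)"
proof
  have h: "lmul1 (ad0 z v) x = hom_act z (lmul1 v) x" if x: "pr p x = x" for p x
  proof (cases p)
    assume [simp]: "p = 0"
    have x0: "pr 0 x = x" and b: "pr 0 (br x z) = br x z" using x br_parity[OF x z] by simp_all
    have "iact z (tens 1 (letter x * v)) = tens 1 (letter z * (letter x * v)) - tens 1 (letter x * (v * letter z))"
      by (simp add: tens_act_even[OF z] ad0_def tens_simps mult.assoc)
    moreover have "hom_act z (lmul1 v) x = iact z (lmul1 v x) + lmul1 v (br x z)"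
      using hom_act_hom[OF x z lmul1_homs, of v] by simp
    ultimately show ?thesis
      by (simp add: lmul1_even[OF x0] lmul1_even[OF b] ad0_def right_diff_distrib tens_simps
        tens_even_bracket[OF x0 z])
  next
    assume [simp]: "p = 1"
    have x1: "pr 1 x = x" and b: "pr 1 (br x z) = br x z" using x br_parity[OF x z] by simp_all
    have "br x z = - br z x" using br_skew[OF x z] by simp
    then show ?thesis
      using x1 hom_act_hom[OF x z lmul1_homs, of v] lodd_ad0[OF z x1, of v] b
      by (simp add: lmul1_odd lodd_simps pr_simps)
  qed
  fix x
  show "lmul1 (ad0 z v) x = hom_act z (lmul1 v) x"
    using h[OF pr_pr_same[of 0 x]] h[OF pr_pr_same[of 1 x]] homs_pr[OF lmul1_homs, of "ad0 z v" x]
      hom_act_pr[OF lmul1_homs, of z v x]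
    by simp
qed

lemma lmul1_J: "j \<in> even.J \<Longrightarrow> lmul1 j = 0"
  by (simp add: fun_eq_iff lmul1_def tens_eq_0 even.J_mult_left Bil_J[OF lodd_Bil])

definition lmul :: "'g \<Rightarrow> ('k, 'g) fa2 \<Rightarrow> ('k, 'g) fa2" where
  "lmul x t = frob (fscale pm_scale) hom_act lmul1 t x"

lemma frob_lmul:
  fixes F defines "F \<equiv> frob (fscale pm_scale) hom_act lmul1"
  shows "lin pm_scale (fscale pm_scale) F" "F (ten f v) = ev (fscale pm_scale) hom_act f (lmul1 v)"
    "F (ind t) = F t" "F (iact x t) = hom_act x (F t)" "F t \<in> homs"
  unfolding F_def by (rule frobenius[OF super_rep_homs lmul1_lin lmul1_homs]; simp add: lmul1_J lmul1_ad0)+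

lemma lmul_lin: "lin pm_scale pm_scale (lmul x)"
  unfolding lmul_def by (rule lin_comp[OF frob_lmul(1) lin_eval[OF module_pm]])

lemma lmul_ind: "lmul x (ind t) = lmul x t"
  unfolding lmul_def by (simp add: frob_lmul(3))

lemma lmul_homs: "(\<lambda>x. lmul x t) \<in> homs"
  unfolding lmul_def by (rule frob_lmul(5))

lemmas lmul_lin_left = homs_lin[OF lmul_homs]
  and lmul_pr = homs_pr[OF lmul_homs]

lemmas lmul_simps = lin_simps[OF lmul_lin]
  and lmul_left_simps = lin_simps[OF lmul_lin_left]

lemma lmul_act:
  assumes "pr p x = x" "pr q y = y"
  shows "lmul x (iact y t) = sg p q (iact y (lmul x t)) + lmul (br x y) t"
  unfolding lmul_def frob_lmul(4) by (rule hom_act_hom[OF assms frob_lmul(5)])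

interpretation hm: super_rep scg pr br "fscale pm_scale" homs hom_act
  by (rule super_rep_homs)

lemma lmul_tens: "lmul x (tens 1 v) = lmul1 v x"
proof -
  have "lmul x (tens 1 v) = lmul x (ten 1 v)" by (rule lmul_ind)
  also have "\<dots> = lmul1 v x" unfolding lmul_def frob_lmul(2) hm.ev_1 ..
  finally show ?thesis .
qed

lemma lmul_even: "pr 0 x = x \<Longrightarrow> lmul x (tens 1 v) = tens 1 (letter x * v)"
  and lmul_odd: "pr 1 x = x \<Longrightarrow> lmul x (tens 1 v) = lodd v x"
  by (simp_all only: lmul_tens lmul1_even lmul1_odd)

text \<open>Left multiplication by an even \<open>z\<close> and by an odd \<open>y\<close> satisfy \<open>z y v = y z v + [z, y] v\<close>. Both sides solve
  the same equation.\<close>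

lemma lmul_lodd:
  assumes z: "pr 0 z = z" and y: "pr 1 y = y"
  shows "lmul z (lodd v y) = lodd (letter z * v) y + lodd v (br z y)"
proof -
  let ?\<beta> = "\<lambda>v y. lmul z (lodd v y) - rmul z lodd v y"
  have B: "(\<lambda>v y. lmul z (lodd v y)) \<in> Bil pm_scale"
    by (rule Bil_post[OF lodd_Bil lmul_lin])
  have "?\<beta> v y = 0"
  proof (rule tau_unique[OF module_pm Bil_diff[OF B rmul_Bil[OF lodd_Bil]] _ y])
    fix v y assume y: "pr 1 y = y"
    have o: "pr 1 (br z y) = br z y" using br_parity[OF z y] by simp
    have "lmul z (act1 v y) = act1 (letter z * v) y + lodd v (br z y)"
      unfolding act1_def lmul_act[OF z y] by (simp only: lmul_even[OF z] lmul_odd[OF o] sg_simps)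
    moreover have "tau pm_scale ?\<beta> v u = lmul z (tau pm_scale lodd v u) - tau pm_scale lodd (letter z * v) u" for u
      by (simp add: tau_diff[OF module_pm B rmul_Bil[OF lodd_Bil]] tau_post[OF module_pm lmul_lin lodd_Bil]
        tau_letter[OF module_pm lodd_Bil] z)
    ultimately show "?\<beta> v y = tau pm_scale ?\<beta> v (\<phi> y)"
      by (simp add: rmul_def lodd_eq[OF y] lmul_simps)
  qed
  then show ?thesis by (simp add: rmul_def)
qed

section \<open>The relations for left multiplication\<close>

definition commutes :: "bit \<Rightarrow> 'g \<Rightarrow> bit \<Rightarrow> 'g \<Rightarrow> ('k, 'g) fa2 \<Rightarrow> bool" where
  "commutes p x q y t \<longleftrightarrow> lmul (br x y) t = lmul x (lmul y t) - sg p q (lmul y (lmul x t))"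

lemma subspace_commutes: "module.subspace pm_scale {t. commutes p x q y t}"
  by (auto simp: module.subspace_def[OF module_pm] commutes_def lmul_simps sg_def pm_scale_distribs)

lemma commutes_swap:
  assumes "pr p x = x" "pr q y = y" "commutes p x q y t"
  shows "commutes q y p x t"
  using br_skew[OF assms(1,2)] assms(3)
  by (cases p; cases q) (auto simp: commutes_def lmul_left_simps algebra_simps)

text \<open>The relation for \<open>x, y\<close> at \<open>a\<^sub>z t\<close> follows from three relations at \<open>t\<close>, by the Jacobi identity. It is stated
  for a single pair so that it can be used before the relation for two odd elements is known
  everywhere.\<close>

lemma commutes_act:
  assumes x: "pr p x = x" and y: "pr q y = y" and z: "pr r z = z"
    and c: "commutes p x q y t" "commutes (p + r) (br x z) q y t" "commutes p x (q + r) (br y z) t"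
  shows "commutes p x q y (iact z t)"
proof -
  have "br y (br x z) = - sg q (p + r) (br (br x z) y)"
    by (rule br_skew[OF y br_parity[OF x z]])
  then have j: "br (br x y) z = br x (br y z) + sg q r (br (br x z) y)"
    using br_jacobi[OF x y z] by (cases p; cases q; cases r) (auto simp: sg_def)
  show ?thesis
    unfolding commutes_def
    by (cases p; cases q; cases r)
      (simp_all add: j c[unfolded commutes_def] lmul_act[OF br_parity[OF x y] z] lmul_act[OF x z]
        lmul_act[OF y z] lmul_simps lmul_left_simps act_simps)
qed

lemma commutes_even_even: "pr 0 x = x \<Longrightarrow> pr 0 y = y \<Longrightarrow> commutes 0 x 0 y (tens 1 v)"
  using br_parity[of 0 x 0 y] unfolding commutes_def
  by (simp add: lmul_even tens_even_bracket)

lemma commutes_even_odd: "pr 0 x = x \<Longrightarrow> pr 1 y = y \<Longrightarrow> commutes 0 x 1 y (tens 1 v)"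
  using br_parity[of 0 x 1 y] unfolding commutes_def
  by (simp add: lmul_even lmul_odd lmul_lodd)

end

context twisted_lie
begin

definition filt :: "nat \<Rightarrow> ('k, 'g) fa2 set" where
  "filt n = module.span pm_scale {iact y (tens 1 (word ws)) |y ws. pr 1 y = y \<and> length ws \<le> n}"

lemma lodd_filt:
  assumes "pr 1 y = y"
  shows "lodd (word ws) y \<in> filt (length ws)"
  unfolding lodd_def
proof (rule sol_filtered[OF module_pm act1_Bil _ _ _ assms])
  show "module.subspace pm_scale (filt n)" for n
    unfolding filt_def by (rule module.subspace_span[OF module_pm])
  show "filt m \<subseteq> filt n" if "m \<le> n" for m n
    unfolding filt_def using that by (intro module.span_mono[OF module_pm]) force
  show "act1 (word ws) y \<in> filt (length ws)" if "pr 1 y = y" for ws y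
    unfolding filt_def act1_def using that by (intro module.span_base[OF module_pm]) blast
qed

lemma odd_diff: "pr 1 x = x \<Longrightarrow> pr 1 (x - \<phi> x) = x - \<phi> x"
  using \<phi>_odd[of x] by (simp add: pr_simps)

text \<open>In \<open>U\<close> this is \<open>(x - \<phi> x) 1 = ad(x)(1)\<close>.\<close>

lemma lmul_unit_odd:
  assumes "pr 1 x = x"
  shows "lmul (x - \<phi> x) (tens 1 1) = iact x (tens 1 1)"
  using lodd_eq[OF assms, of 1] tau_1[OF module_pm lodd_Bil, of "\<phi> x"]
  by (simp only: lmul_odd[OF odd_diff[OF assms]] lodd_simps act1_def) simp

text \<open>As \<open>1 - \<phi>\<close> is onto, take \<open>x - \<phi> x\<close> and \<open>y - \<phi> y\<close>. Their products on \<open>1 \<otimes> 1\<close> are expressed by \<open>a\<^sub>x\<close> and \<open>a\<^sub>y\<close>,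
  whose anticommutator \<open>a\<^sub>[\<^sub>x\<^sub>,\<^sub>y\<^sub>]\<close> vanishes on \<open>1 \<otimes> 1\<close>, and what remains is \<open>[x, y] = [\<phi> x, \<phi> y]\<close>.\<close>

lemma commutes_unit_odd:
  assumes "pr 1 x = x" "pr 1 y = y"
  shows "commutes 1 x 1 y (tens 1 1)"
proof -
  have main: "commutes 1 (x - \<phi> x) 1 (y - \<phi> y) (tens 1 1)" if x: "pr 1 x = x" and y: "pr 1 y = y" for x y
  proof -
    define x' y' where "x' = x - \<phi> x" "y' = y - \<phi> y"
    have x': "pr 1 x' = x'" and y': "pr 1 y' = y'"
      unfolding x'_y'_def by (rule odd_diff[OF x] odd_diff[OF y])+
    have l: "lmul x' (lmul y' (tens 1 1)) = - iact y (iact x (tens 1 1)) + lmul (br x' y) (tens 1 1)"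
      using lmul_act[OF x' y, of "tens 1 1"] lmul_unit_odd[OF x] lmul_unit_odd[OF y]
      by (simp add: x'_y'_def)
    have r: "lmul y' (lmul x' (tens 1 1)) = - iact x (iact y (tens 1 1)) + lmul (br y' x) (tens 1 1)"
      using lmul_act[OF y' x, of "tens 1 1"] lmul_unit_odd[OF x] lmul_unit_odd[OF y]
      by (simp add: x'_y'_def)
    have b: "pr 0 (br x y) = br x y" using br_parity[OF x y] by simp
    have "iact (br x y) (tens 1 1) = 0"
      by (simp add: tens_act_even[OF b] ad0_def tens_simps)
    then have a: "iact x (iact y (tens 1 1)) = - iact y (iact x (tens 1 1))"
      using ind.a_bracket[OF x y, of "tens 1 1"] by (simp add: add_eq_0_iff2)
    have "br (\<phi> x) (\<phi> y) = br x y"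
      using \<phi>_even[OF b] by (simp add: \<phi>_br)
    moreover have "br y x = br x y" "br y (\<phi> x) = br (\<phi> x) y" "br (\<phi> y) x = br x (\<phi> y)"
      using br_skew[OF y x] br_skew[OF y \<phi>_odd[OF x]] br_skew[OF \<phi>_odd[OF y] x] by simp_all
    ultimately have "br x' y' = br x' y + br y' x"
      by (simp add: x'_y'_def br_simps)
    then show ?thesis
      unfolding x'_y'_def[symmetric] commutes_def by (simp add: l r a lmul_left_simps)
  qed
  show ?thesis
    using main[OF \<psi>_odd[OF assms(1)] \<psi>_odd[OF assms(2)]] \<psi>_right[OF assms(1)] \<psi>_right[OF assms(2)]
    by simp
qed

text \<open>From \<open>v\<close> to \<open>z v\<close> with \<open>z\<close> even: move \<open>\<lambda>\<^sub>z\<close> to the left of \<open>\<lambda>\<^sub>x\<close> and \<open>\<lambda>\<^sub>y\<close>, and use the relation for two odd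
  elements at \<open>v\<close>.\<close>

lemma commutes_odd_step:
  assumes x: "pr 1 x = x" and y: "pr 1 y = y" and z: "pr 0 z = z"
    and xy: "\<And>x y. pr 1 x = x \<Longrightarrow> pr 1 y = y \<Longrightarrow> commutes 1 x 1 y (tens 1 v)"
    and zx: "\<And>x y. pr 1 x = x \<Longrightarrow> pr 1 y = y \<Longrightarrow> commutes 0 z 1 x (lmul y (tens 1 v))"
  shows "commutes 1 x 1 y (lmul z (tens 1 v))"
proof -
  let ?t = "tens 1 v"
  have ox: "pr 1 (br z x) = br z x" and oy: "pr 1 (br z y) = br z y" and exy: "pr 0 (br x y) = br x y"
    using br_parity[OF z x] br_parity[OF z y] br_parity[OF x y] by simp_all
  have zy': "lmul y (lmul z ?t) = lmul z (lmul y ?t) - lmul (br z y) ?t"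
    using commutes_even_odd[OF z y, of v] by (simp add: commutes_def)
  have zx': "lmul x (lmul z ?t) = lmul z (lmul x ?t) - lmul (br z x) ?t"
    using commutes_even_odd[OF z x, of v] by (simp add: commutes_def)
  have zxy: "lmul x (lmul z (lmul y ?t)) = lmul z (lmul x (lmul y ?t)) - lmul (br z x) (lmul y ?t)"
    using zx[OF x y] by (simp add: commutes_def)
  have zyx: "lmul y (lmul z (lmul x ?t)) = lmul z (lmul y (lmul x ?t)) - lmul (br z y) (lmul x ?t)"
    using zx[OF y x] by (simp add: commutes_def)
  have e: "lmul (br x y) (lmul z ?t) = lmul z (lmul (br x y) ?t) - lmul (br z (br x y)) ?t"
    using commutes_even_even[OF z exy, of v] by (simp add: commutes_def)
  have c1: "lmul x (lmul y ?t) = lmul (br x y) ?t - lmul y (lmul x ?t)"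
    using xy[OF x y] by (simp add: commutes_def)
  have c2: "lmul (br z x) (lmul y ?t) = lmul (br (br z x) y) ?t - lmul y (lmul (br z x) ?t)"
    using xy[OF ox y] by (simp add: commutes_def)
  have c3: "lmul x (lmul (br z y) ?t) = lmul (br x (br z y)) ?t - lmul (br z y) (lmul x ?t)"
    using xy[OF x oy] by (simp add: commutes_def)
  have j: "br z (br x y) = br (br z x) y + br x (br z y)"
    using br_jacobi[OF z x y] by simp
  show ?thesis
    unfolding commutes_def
    by (simp add: e zy' zx' lmul_simps zxy zyx c1 c2 c3 j lmul_left_simps)
qed

lemma commutes_subspaceI:
  assumes "t \<in> module.span pm_scale S" "\<And>u. u \<in> S \<Longrightarrow> commutes p x q y u"
  shows "commutes p x q y t"
  using module.span_minimal[OF module_pm _ subspace_commutes, of S p x q y] assms by blast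

text \<open>The step needs the relation of \<open>z\<close> and \<open>x\<close> at \<open>\<lambda>\<^sub>y (1 \<otimes> v)\<close>. This element lies in \<open>filt\<close>, and on its
  generators \<open>a\<^sub>y\<^sub>' (1 \<otimes> v')\<close> the relation follows from relations at \<open>1 \<otimes> v'\<close>, of which the one for two odd
  elements is given by induction as \<open>v'\<close> is not longer than \<open>v\<close>.\<close>

lemma commutes_odd_odd:
  assumes "pr 1 x = x" "pr 1 y = y"
  shows "commutes 1 x 1 y (tens 1 (word ws))"
  using assms
proof (induction "length ws" arbitrary: ws x y rule: less_induct)
  case less
  show ?case
  proof (cases ws)
    case Nil
    then show ?thesis using commutes_unit_odd less.prems by simp
  next
    case (Cons z us)
    have IH: "commutes 1 x 1 y (tens 1 (word ws'))"
      if "length ws' \<le> length us" "pr 1 x = x" "pr 1 y = y" for ws' x y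
      using less.hyps[of ws' x y] that Cons by simp
    have "commutes 1 x 1 y (lmul (pr 0 z) (tens 1 (word us)))"
    proof (rule commutes_odd_step[OF less.prems pr_pr_same])
      fix x y assume x: "pr 1 x = x" and y: "pr 1 y = y"
      show "commutes 1 x 1 y (tens 1 (word us))" by (rule IH[OF _ x y]) simp
      show "commutes 0 (pr 0 z) 1 x (lmul y (tens 1 (word us)))"
        unfolding lmul_odd[OF y]
      proof (rule commutes_subspaceI[OF lodd_filt[OF y, unfolded filt_def]])
        fix u assume "u \<in> {iact y (tens 1 (word ws)) |y ws. pr 1 y = y \<and> length ws \<le> length us}"
        then obtain y' ws' where u: "u = iact y' (tens 1 (word ws'))" "pr 1 y' = y'" "length ws' \<le> length us"
          by blast
        show "commutes 0 (pr 0 z) 1 x u"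
          unfolding u(1) using br_parity[OF pr_pr_same[of 0 z] u(2)] br_parity[OF x u(2)]
          by (intro commutes_act[OF pr_pr_same[of 0 z] x u(2)])
            (auto intro: commutes_even_odd commutes_even_even IH x u)
      qed
    qed
    then show ?thesis
      by (simp only: lmul_even[OF pr_pr_same] tens_even_pr Cons word_Cons)
  qed
qed

lemma commutes_tens:
  assumes x: "pr p x = x" and y: "pr q y = y"
  shows "commutes p x q y (tens 1 v)"
proof (induction v rule: pm_induct)
  case (single b)
  show ?case
    using x y commutes_odd_odd[of x y] commutes_even_odd[of x y] commutes_even_even[of x y]
      commutes_swap[OF _ _ commutes_even_odd, of y x]
    by (cases p; cases q) (auto simp: single_word)
qed (use subspace_commutes[of p x q y] in \<open>auto simp: module.subspace_def[OF module_pm] tens_simps\<close>)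

lemma commutes_all:
  assumes x: "pr p x = x" and y: "pr q y = y"
  shows "commutes p x q y t"
proof -
  have "\<forall>p q x y. pr p x = x \<longrightarrow> pr q y = y \<longrightarrow> commutes p x q y (ind t)"
  proof (induction t rule: ind_induct)
    case (iact p x t)
    then show ?case by (blast intro: commutes_act br_parity)
  qed (use subspace_commutes in \<open>auto simp: module.subspace_def[OF module_pm] intro: commutes_tens\<close>)
  then show ?thesis using x y unfolding commutes_def lmul_ind by blast
qed

lemma super_rep_lmul: "super_rep scg pr br pm_scale UNIV lmul"
proof (intro super_rep.intro super_lie_axioms super_rep_axioms.intro)
  show "module.subspace pm_scale (UNIV :: ('k, 'g) fa2 set)"
    by (simp add: module.subspace_def[OF module_pm])
  show "lmul (br x y) t = lmul x (lmul y t) - sg p q (lmul y (lmul x t))"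
    if "pr p x = x" "pr q y = y" for p q x y t
    using commutes_all[OF that] by (simp add: commutes_def)
  show "lmul x t = lmul (pr 0 x) t + lmul (pr 1 x) t" for x t by (rule lmul_pr)
qed (simp_all add: module_pm lmul_simps lmul_left_simps)

sublocale lm: super_rep scg pr br pm_scale UNIV lmul
  by (rule super_rep_lmul)

section \<open>The twisted adjoint action and the two maps\<close>

definition to_ind :: "('k, 'g) fa \<Rightarrow> ('k, 'g) fa2" where
  "to_ind f = ev pm_scale lmul f (tens 1 1)"

lemma to_ind_lin: "lin pm_scale pm_scale to_ind"
  unfolding to_ind_def by (rule lm.evl)

lemmas to_ind_simps = lin_simps[OF to_ind_lin]

lemma to_ind_env: "to_ind (env f) = to_ind f"
  unfolding to_ind_def by simp

lemma to_ind_letter_mult: "to_ind (letter x * f) = lmul x (to_ind f)"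
  unfolding to_ind_def by (simp add: lm.ev_letter_mult)

lemma to_ind_1: "to_ind 1 = tens 1 1"
  unfolding to_ind_def by simp

text \<open>The inclusion of \<open>V\<close> in \<open>U\<close> on representatives; odd letters vanish in \<open>V\<close>.\<close>

abbreviation "emb \<equiv> map_fa (pr 0)"

lemma emb_J: "j \<in> even.J \<Longrightarrow> emb j \<in> J"
proof (induction j rule: even.J_induct)
  case (rel u r v)
  have "emb r \<in> J"
    using rel unfolding even.rels_def
  proof (elim UnE; clarify?)
    fix x y
    show "emb (letter (x + y) - letter x - letter y) \<in> J"
      by (simp add: env_eq_0_iff[symmetric] map_fa_simps env_simps env_letter_simps pr_simps)
  next
    fix c x
    show "emb (letter (scg c x) - pm_scale c (letter x)) \<in> J"
      by (simp add: env_eq_0_iff[symmetric] map_fa_simps env_simps env_letter_simps pr_simps)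
  next
    fix x
    show "emb (letter x - letter (even_pr pr 0 x) - letter (even_pr pr 1 x)) \<in> J"
      by (simp add: env_eq_0_iff[symmetric] map_fa_simps env_simps env_letter_simps even_pr_def pr_simps)
  next
    fix p q x y assume x: "even_pr pr p x = x" and y: "even_pr pr q y = y"
    then have xy: "pr 0 x = x" "pr 0 y = y" and x0: "p = 1 \<Longrightarrow> x = 0"
      by (auto simp: even_pr_def pr_simps split: if_splits)
    have l0: "env (f * letter 0) = 0" for f
      by (subst env_mult_env) (simp add: env_letter_simps env_simps)
    have "br x y = even_br pr br x y" by (simp add: even_br_def xy)
    then show "emb (letter x * letter y - sg p q (letter y * letter x) - letter (even_br pr br x y)) \<in> J"
      using env_bracket[OF xy] br_parity[OF xy] x0 l0
      by (cases p) (auto simp: env_eq_0_iff[symmetric] map_fa_simps map_fa_mult env_simps env_letter_simps xy sg_def pr_simps)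
  qed
  then show ?case by (simp add: map_fa_mult J_mult_left J_mult_right)
qed (auto simp: map_fa_simps J_0 intro: J_add J_scale)

lemma par_emb: "par (emb f) = emb f"
proof (induction f rule: fa_induct)
  case (letter x f)
  have "sigma (pr 0 x) = pr 0 x" by (simp add: sigma_def)
  then show ?case using letter by (simp add: map_fa_letter_mult)
qed (simp_all add: map_fa_simps)

text \<open>The twisted adjoint action; \<open>par u\<close> accounts for the sign.\<close>

definition twad :: "'g \<Rightarrow> ('k, 'g) fa \<Rightarrow> ('k, 'g) fa" where
  "twad x u = env ((letter (pr 0 x) * u - u * letter (pr 0 x)) + (letter (pr 1 x) * u - par u * letter (\<phi> (pr 1 x))))"

lemma twad_even: "pr 0 x = x \<Longrightarrow> twad x u = env (letter x * u) - env (u * letter x)"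
  and twad_odd: "pr 1 x = x \<Longrightarrow> twad x u = env (letter x * u) - env (par u * letter (\<phi> x))"
  using lin_zero[OF \<phi>_lin] by (simp_all add: twad_def env_simps pr_other env_letter_0)

lemma env_twad [simp]: "env (twad x u) = twad x u"
  by (simp add: twad_def)

lemma twad_env [simp]: "twad x (env u) = twad x u"
  by (simp add: twad_def env_simps)
    (metis env_mult_right par_env)

lemma twad_lin: "lin pm_scale pm_scale (twad x)"
  unfolding twad_def
  by (intro linI module_pm) (simp_all add: env_simps map_fa_simps algebra_simps pm_scale_mult pm_scale_distribs)

lemmas twad_simps = lin_simps[OF twad_lin]

lemma twad_lin_left: "lin scg pm_scale (\<lambda>x. twad x u)"
proof -
  have *: "twad x u = (env (env (letter (pr 0 x)) * u) - env (u * env (letter (pr 0 x)))) +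
     (env (env (letter (pr 1 x)) * u) - env (par u * env (letter (\<phi> (pr 1 x)))))" for x
    by (simp add: twad_def env_simps)
  have r: "lin pm_scale pm_scale (\<lambda>f. env (f * g))" "lin pm_scale pm_scale (\<lambda>f. env (g * f))" for g
    by (rule lin_comp[OF lin_mult_right env_lin] lin_comp[OF lin_mult_left env_lin])+
  show ?thesis
    unfolding *
    by (intro lin_add_fun lin_diff_fun lin_comp[OF _ r(1)] lin_comp[OF _ r(2)])
      (rule lin_comp[OF pr_lin letter_lin_env] lin_comp[OF lin_comp[OF pr_lin \<phi>_lin] letter_lin_env])+
qed

lemma twad_pr: "twad x u = twad (pr 0 x) u + twad (pr 1 x) u"
  using lin_zero[OF \<phi>_lin] by (simp add: twad_def env_simps env_letter_0)

lemma env_bracket_mult: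
  assumes "pr p x = x" "pr q y = y"
  shows env_bracket_left: "env (letter (br x y) * u) =
      env (letter x * (letter y * u)) - sg p q (env (letter y * (letter x * u)))"
    and env_bracket_right: "env (u * letter (br x y)) =
      env (u * (letter x * letter y)) - sg p q (env (u * (letter y * letter x)))"
proof -
  have "env (letter (br x y) * u) = env (env (letter (br x y)) * u)"
    "env (u * letter (br x y)) = env (u * env (letter (br x y)))" by simp_all
  then show "env (letter (br x y) * u) =
      env (letter x * (letter y * u)) - sg p q (env (letter y * (letter x * u)))"
    "env (u * letter (br x y)) =
      env (u * (letter x * letter y)) - sg p q (env (u * (letter y * letter x)))"
    unfolding env_bracket[OF assms]
    by (cases p; cases q; simp add: left_diff_distrib right_diff_distrib distrib_left distrib_right
        env_simps mult.assoc)+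
qed

text \<open>In \<open>U\<close>, left multiplication by \<open>x\<close> and \<open>ad(y)\<close> satisfy the relation imposed on \<open>\<lambda>\<^sub>x\<close> and \<open>a\<^sub>y\<close>.\<close>

lemma twad_letter_mult:
  assumes x: "pr p x = x" and y: "pr q y = y"
  shows "env (letter x * twad y u) = sg p q (twad y (letter x * u)) + env (letter (br x y) * u)"
proof -
  note br = env_bracket_left[OF x y, of u]
  have sp: "env (par (letter x * u) * f) = sg p 1 (env (letter x * (par u * f)))" for f
    by (simp add: map_fa_letter_mult mult.assoc env_letter_sigma[OF x])
  show ?thesis
  proof (cases q)
    assume "q = 0"
    then show ?thesis using y by (simp add: twad_even br env_simps algebra_simps)
  next
    assume "q = 1"
    then show ?thesis using y
      by (cases p) (simp_all add: twad_odd br env_simps algebra_simps sp)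
  qed
qed

lemma super_rep_twad: "super_rep scg pr br pm_scale UNIV twad"
proof (intro super_rep.intro super_lie_axioms super_rep_axioms.intro)
  show "module.subspace pm_scale (UNIV :: ('k, 'g) fa set)"
    by (simp add: module.subspace_def[OF module_pm])
  show "twad x t = twad (pr 0 x) t + twad (pr 1 x) t" for x t by (rule twad_pr)
  show "twad (br x y) u = twad x (twad y u) - sg p q (twad y (twad x u))"
    if x: "pr p x = x" and y: "pr q y = y" for p q x y u
  proof -
    note b = env_bracket_left and b' = env_bracket_right
    have sp: "env (par (letter x * u) * f) = sg p 1 (env (letter x * (par u * f)))" if "pr p x = x" for p x u f
      by (simp add: map_fa_letter_mult mult.assoc env_letter_sigma[OF that])
    have sl: "env (f * letter (sigma x) * g) = sg p 1 (env (f * (letter x * g)))" if "pr p x = x" for p x f g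
    proof -
      have "env (f * letter (sigma x) * g) = env (f * env (letter (sigma x) * g))" by (simp add: mult.assoc)
      then show ?thesis unfolding env_letter_sigma[OF that] by (simp add: sg_def env_simps)
    qed
    have pe: "env (par (env u) * f) = env (par u * f)" for u f
      by (metis env_mult_right par_env)
    have pp: "env (par (par u) * f) = env (u * f)" for u f
      by (metis env_mult_right par_par)
    consider "p = 0" "q = 0" | "p = 0" "q = 1" | "p = 1" "q = 0" | "p = 1" "q = 1" by (cases p; cases q) auto
    then show ?thesis
    proof cases
      case 1
      then show ?thesis using x y b[OF x y, of u] b'[OF x y, of u] br_parity[OF x y]
        by (simp add: twad_even env_simps algebra_simps)
    next
      case 2
      have "\<phi> (br x y) = br x (\<phi> y)" using x 2 by (simp add: \<phi>_br \<phi>_even)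
      then show ?thesis
        using 2 x y b[OF x y, of u] b'[OF x, of 1 "\<phi> y" "par u"] br_parity[OF x y] \<phi>_odd[of y] sl[OF x, of "par u"] env_letter_sigma[OF x, of "par u * letter (\<phi> y)"]
        by (simp add: twad_even twad_odd env_simps algebra_simps map_fa_simps map_fa_mult sp pe)
    next
      case 3
      have "\<phi> (br x y) = br (\<phi> x) y" using y 3 by (simp add: \<phi>_br \<phi>_even)
      then show ?thesis
        using 3 x y b[OF x y, of u] b'[of 1 "\<phi> x", OF _ y, of "par u"] br_parity[OF x y] \<phi>_odd[of x] sl[OF y, of "par u"] env_letter_sigma[OF y, of "par u * letter (\<phi> x)"]
        by (simp add: twad_even twad_odd env_simps algebra_simps map_fa_simps map_fa_mult sp pe)
    next
      case 4
      have e: "pr 0 (br x y) = br x y" using br_parity[OF x y] 4 by simp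
      have "br x y = br (\<phi> x) (\<phi> y)" using \<phi>_even[OF e] by (simp add: \<phi>_br)
      moreover have ox: "pr 1 (\<phi> x) = \<phi> x" and oy: "pr 1 (\<phi> y) = \<phi> y" using \<phi>_odd x y 4 by simp_all
      ultimately have "env (u * letter (br x y)) = env (u * (letter (\<phi> x) * letter (\<phi> y))) + env (u * (letter (\<phi> y) * letter (\<phi> x)))"
        using b'[OF ox oy, of u] by simp
      then show ?thesis
        using 4 x y b[OF x y, of u] e sl[OF ox, of "par (par u)"] sl[OF oy, of "par (par u)"] pp
          env_letter_sigma[OF x, of "par u * letter (\<phi> y)"] env_letter_sigma[OF y, of "par u * letter (\<phi> x)"]
        by (simp add: twad_even twad_odd env_simps algebra_simps map_fa_simps map_fa_mult sp pe)
    qed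
  qed
qed (simp_all add: module_pm twad_simps lin_simps[OF twad_lin_left])

sublocale tw: super_rep scg pr br pm_scale UNIV twad
  by (rule super_rep_twad)

definition from_ind :: "('k, 'g) fa2 \<Rightarrow> ('k, 'g) fa" where
  "from_ind = frob pm_scale twad (\<lambda>v. env (emb v))"

lemma env_emb_lin: "lin pm_scale pm_scale (\<lambda>v. env (emb v))"
  by (rule lin_comp[OF map_fa_lin env_lin])

lemma from_ind:
  shows from_ind_lin: "lin pm_scale pm_scale from_ind"
    and from_ind_ten: "from_ind (ten f v) = ev pm_scale twad f (env (emb v))"
    and from_ind_ind: "from_ind (ind t) = from_ind t"
    and from_ind_act: "from_ind (iact x t) = twad x (from_ind t)"
proof -
  have 1: "env (emb j) = 0" if "j \<in> even.J" for j
    using emb_J[OF that] by (simp add: env_eq_0_iff)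
  have 2: "env (emb (ad0 z v)) = twad z (env (emb v))" if "pr 0 z = z" for z v
    using that by (simp add: ad0_def map_fa_simps map_fa_mult env_simps twad_even)
  show "lin pm_scale pm_scale from_ind" "from_ind (ten f v) = ev pm_scale twad f (env (emb v))"
    "from_ind (ind t) = from_ind t" "from_ind (iact x t) = twad x (from_ind t)"
    unfolding from_ind_def
    by (rule frobenius[OF super_rep_twad env_emb_lin]; simp add: 1 2)+
qed

lemmas from_ind_simps = lin_simps[OF from_ind_lin]

lemma from_ind_tens: "from_ind (tens 1 v) = env (emb v)"
  unfolding from_ind_ind from_ind_ten tw.ev_1 ..

lemma env_letter_mult_lin: "lin scg pm_scale (\<lambda>x. env (letter x * f))"
  using lin_comp[OF letter_lin_env lin_comp[OF lin_mult_right[of f] env_lin]] by simp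

lemmas env_letter_mult_simps = lin_simps[OF env_letter_mult_lin]

lemma env_letter_mult_pr: "env (letter x * f) = env (letter (pr 0 x) * f) + env (letter (pr 1 x) * f)"
  by (subst (1) env_mult_right[symmetric], subst env_letter_pr)
    (simp add: distrib_right env_simps)

lemma env_bracket_even:
  assumes z: "pr 0 z = z"
  shows "env (letter (br z y) * g) = env (letter z * (letter y * g)) - env (letter y * (letter z * g))"
proof -
  have "env (letter z * (letter y * g)) = env (letter z * env (letter y * g))" by simp
  then have "env (letter z * (letter y * g)) =
      env (letter z * (letter (pr 0 y) * g)) + env (letter z * (letter (pr 1 y) * g))"
    unfolding env_letter_mult_pr[of y g] by (simp add: distrib_left env_simps)
  then show ?thesis
    using env_letter_mult_pr[of y "letter z * g"] env_bracket_left[OF z pr_pr_same, of 0 y g]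
      env_bracket_left[OF z pr_pr_same, of 1 y g]
    by (simp add: br_decomp(2)[of z y] env_letter_mult_simps)
qed

text \<open>A bilinear map whose \<open>tau\<close> is known: it is the value at \<open>u v y\<close> when \<open>mid u v y\<close> is the value at
  \<open>u y v\<close>.\<close>

definition mid :: "('k, 'g) fa \<Rightarrow> ('k, 'g) fa \<Rightarrow> 'g \<Rightarrow> ('k, 'g) fa" where
  "mid u v y = env (u * letter y * emb v)"

lemma mid_Bil: "mid u \<in> Bil pm_scale"
proof -
  have "lin pm_scale pm_scale (\<lambda>v. mid u v y)" for y
    unfolding mid_def by (rule lin_comp[OF lin_comp[OF map_fa_lin lin_mult_left] env_lin])
  moreover have "lin scg pm_scale (mid u v)" for v
  proof -
    have "lin scg pm_scale (\<lambda>y. env (u * env (letter y * emb v)))"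
      by (rule lin_comp[OF env_letter_mult_lin lin_comp[OF lin_mult_left env_lin]])
    moreover have "mid u v = (\<lambda>y. env (u * env (letter y * emb v)))"
      by (simp add: mid_def fun_eq_iff mult.assoc)
    ultimately show ?thesis by simp
  qed
  moreover have "mid u j y = 0" if "j \<in> even.J" for j y
    using J_mult_left[OF emb_J[OF that]] by (simp add: mid_def env_eq_0_iff)
  ultimately show ?thesis by (simp add: Bil_def)
qed

lemma tau_mid: "tau pm_scale (mid u) v y = env (u * emb v * letter y)"
proof (induction v arbitrary: u rule: fa_induct)
  case (letter x f)
  have "rmul (pr 0 x) (mid u) v y = mid (u * letter (pr 0 x)) v y" for v y
  proof -
    have "env (u * (letter (br (pr 0 x) y) * emb v)) = env (u * env (letter (br (pr 0 x) y) * emb v))" by simp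
    then show ?thesis
      unfolding env_bracket_even[OF pr_pr_same]
      by (simp add: rmul_def mid_def map_fa_letter_mult mult.assoc right_diff_distrib env_simps)
  qed
  then have "rmul (pr 0 x) (mid u) = mid (u * letter (pr 0 x))" by (simp add: fun_eq_iff)
  then show ?case
    using letter by (simp add: tau_letter[OF module_pm mid_Bil] map_fa_letter_mult mult.assoc)
qed (simp_all add: tau_1[OF module_pm mid_Bil] mid_def tau_simps[OF module_pm] map_fa_simps env_simps
    algebra_simps pm_scale_mult)

text \<open>Both sides solve the same equation, by \<open>ad(y)(v) = y v - v \<phi>(y)\<close>.\<close>

lemma from_ind_lodd:
  assumes y: "pr 1 y = y"
  shows "from_ind (lodd v y) = env (letter y * emb v)"
proof -
  let ?\<beta> = "\<lambda>v y. from_ind (lodd v y) - mid 1 v y"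
  have B: "(\<lambda>v y. from_ind (lodd v y)) \<in> Bil pm_scale"
    by (rule Bil_post[OF lodd_Bil from_ind_lin])
  have "?\<beta> v y = 0"
  proof (rule tau_unique[OF module_pm Bil_diff[OF B mid_Bil] _ y])
    fix v y assume y: "pr 1 y = y"
    have "tau pm_scale ?\<beta> v u = from_ind (tau pm_scale lodd v u) - env (emb v * letter u)" for u
      by (simp add: tau_diff[OF module_pm B mid_Bil] tau_post[OF module_pm from_ind_lin lodd_Bil] tau_mid)
    moreover have "from_ind (act1 v y) = env (letter y * emb v) - env (emb v * letter (\<phi> y))"
      unfolding act1_def by (simp add: from_ind_act from_ind_tens twad_odd[OF y] par_emb)
    ultimately show "?\<beta> v y = tau pm_scale ?\<beta> v (\<phi> y)"
      by (simp add: lodd_eq[OF y] from_ind_simps mid_def)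
  qed
  then show ?thesis by (simp add: mid_def)
qed

text \<open>Both sides have the same commutation rule with the \<open>a\<^sub>y\<close>, so it suffices to compare them on \<open>1 \<otimes> v\<close>.\<close>

lemma from_ind_lmul: "from_ind (lmul x t) = env (letter x * from_ind t)"
proof -
  have "\<forall>p x. pr p x = x \<longrightarrow> from_ind (lmul x (ind t)) = env (letter x * from_ind (ind t))"
  proof (induction t rule: ind_induct)
    case (iact q y t)
    show ?case
    proof (intro allI impI)
      fix p x assume x: "pr p x = x"
      have "from_ind (lmul x (iact y t)) = sg p q (twad y (from_ind (lmul x t))) + from_ind (lmul (br x y) t)"
        by (simp add: lmul_act[OF x iact.hyps] sg_def from_ind_simps from_ind_act)
      then show "from_ind (lmul x (iact y t)) = env (letter x * from_ind (iact y t))"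
        using iact.IH x br_parity[OF x iact.hyps]
        by (simp add: from_ind_act twad_letter_mult[OF x iact.hyps])
    qed
  next
    case (gen v)
    show ?case
    proof (intro allI impI)
      fix p x assume x: "pr p x = x"
      show "from_ind (lmul x (tens 1 v)) = env (letter x * from_ind (tens 1 v))"
      proof (cases p)
        assume "p = 0"
        then have "pr 0 x = x" using x by simp
        then show ?thesis
          unfolding lmul_even[OF \<open>pr 0 x = x\<close>] from_ind_tens by (simp add: map_fa_letter_mult)
      next
        assume "p = 1"
        then have "pr 1 x = x" using x by simp
        then show ?thesis
          unfolding lmul_odd[OF \<open>pr 1 x = x\<close>] from_ind_tens by (simp add: from_ind_lodd)
      qed
    qed
  qed (simp_all add: lmul_simps from_ind_simps env_simps distrib_left pm_scale_mult)
  then show ?thesis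
    using pr_pr_same[of 0 x] pr_pr_same[of 1 x] lmul_pr[of x t] env_letter_mult_pr[of x "from_ind t"]
    unfolding lmul_ind from_ind_ind by (metis lin_add[OF from_ind_lin])
qed

lemma from_ind_to_ind: "from_ind (to_ind f) = env f"
proof (induction f rule: fa_induct)
  case one
  show ?case by (simp add: to_ind_1 from_ind_tens)
qed (simp_all add: to_ind_simps from_ind_simps env_simps to_ind_letter_mult from_ind_lmul)

text \<open>Induction over the words \<open>u\<close>: the commutation rules of \<open>ad(x)\<close> with left multiplications and of \<open>a\<^sub>x\<close> with
  the \<open>\<lambda>\<^sub>y\<close> agree, and at \<open>1\<close> this is \<open>lmul_unit_odd\<close>.\<close>

lemma to_ind_twad_hom: "pr p x = x \<Longrightarrow> to_ind (twad x u) = iact x (to_ind u)"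
proof (induction u arbitrary: p x rule: fa_induct)
  case one
  show ?case
  proof (cases p)
    assume "p = 0"
    then have x: "pr 0 x = x" using one by simp
    show ?thesis
      unfolding to_ind_1 tens_act_even[OF x] by (simp add: twad_even[OF x] ad0_def tens_simps to_ind_simps)
  next
    assume "p = 1"
    then have x: "pr 1 x = x" using one by simp
    have l: "to_ind (letter y) = lmul y (tens 1 1)" for y
      using to_ind_letter_mult[of y 1] by (simp add: to_ind_1)
    show ?thesis
      by (simp add: twad_odd[OF x] to_ind_simps to_ind_env l to_ind_1 lmul_unit_odd[OF x, symmetric] lmul_left_simps)
  qed
next
  case (letter y u)
  have h: "to_ind (twad x (letter y * u)) = iact x (to_ind (letter y * u))" if y: "pr q y = y" for q y
  proof -
    have "to_ind (env (letter y * twad x u)) = sg q p (to_ind (twad x (letter y * u))) + to_ind (env (letter (br y x) * u))"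
      unfolding twad_letter_mult[OF y letter.prems] by (simp add: to_ind_simps sg_def)
    then have "lmul y (iact x (to_ind u)) = sg q p (to_ind (twad x (letter y * u))) + lmul (br y x) (to_ind u)"
      using letter by (simp add: to_ind_env to_ind_letter_mult)
    then show ?thesis
      unfolding lmul_act[OF y letter.prems] to_ind_letter_mult by (cases p; cases q; simp)
  qed
  have "twad x (letter y * u) = twad x (letter (pr 0 y) * u) + twad x (letter (pr 1 y) * u)"
    using env_letter_mult_pr[of y u] twad_simps(1) twad_env by metis
  moreover have "to_ind (letter y * u) = to_ind (letter (pr 0 y) * u) + to_ind (letter (pr 1 y) * u)"
    unfolding to_ind_letter_mult by (rule lmul_pr)
  ultimately show ?case
    using h[OF pr_pr_same[of 0 y]] h[OF pr_pr_same[of 1 y]] by (simp add: to_ind_simps act_simps)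
qed (simp_all add: to_ind_simps twad_simps act_simps)

lemma to_ind_twad: "to_ind (twad x u) = iact x (to_ind u)"
  using to_ind_twad_hom[OF pr_pr_same[of 0 x]] to_ind_twad_hom[OF pr_pr_same[of 1 x]]
    twad_pr[of x u] ind.a_pr[of "to_ind u" x]
  by (simp add: to_ind_simps)

lemma to_ind_emb: "to_ind (emb v) = tens 1 v"
proof (induction v rule: fa_induct)
  case (letter x f)
  then show ?case
    by (simp only: map_fa_letter_mult to_ind_letter_mult lmul_even[OF pr_pr_same] tens_even_pr)
qed (simp_all add: map_fa_simps to_ind_simps to_ind_1 tens_simps)

lemma to_ind_from_ind: "to_ind (from_ind t) = ind t"
proof -
  have "to_ind (from_ind (ind t)) = ind t"
    by (induction t rule: ind_induct)
      (simp_all add: to_ind_simps from_ind_simps from_ind_act to_ind_twad from_ind_tens to_ind_env to_ind_emb)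
  then show ?thesis by (simp add: from_ind_ind)
qed

end

section \<open>Quotient spaces given by representatives\<close>

text \<open>The space \<open>M\<close> consists of the classes \<open>cl u\<close>, with the operations induced from representatives, and two
  representatives have the same class iff \<open>q\<close> takes the same value on them.\<close>

locale presented =
  fixes M :: "('k::field_char_0, 'c, 'z) module_scheme" and s :: "'k \<Rightarrow> 'v \<Rightarrow> 'v::ab_group_add"
    and q :: "'v \<Rightarrow> 'v" and cl :: "'v \<Rightarrow> 'c"
  assumes q_lin: "lin s s q"
    and carrier_eq: "carrier M = range cl"
    and zero_eq: "\<zero>\<^bsub>M\<^esub> = cl 0"
    and add_cl: "cl u \<oplus>\<^bsub>M\<^esub> cl v = cl (u + v)"
    and smult_cl: "c \<odot>\<^bsub>M\<^esub> cl u = cl (s c u)"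
    and cl_eq: "cl u = cl v \<longleftrightarrow> q u = q v"
begin

lemma ms: "Modules.module s"
  using q_lin by (rule module_hom.axioms)

lemma ab: "abelian_group M"
proof (rule abelian_groupI)
  fix A assume "A \<in> carrier M"
  then obtain u where "A = cl u" by (auto simp: carrier_eq)
  then show "\<exists>B\<in>carrier M. B \<oplus>\<^bsub>M\<^esub> A = \<zero>\<^bsub>M\<^esub>"
    by (intro bexI[of _ "cl (- u)"]) (auto simp: carrier_eq add_cl zero_eq)
qed (auto simp: carrier_eq zero_eq add_cl algebra_simps)

lemma vspace: "Module.module (ring_of_type_algebra :: 'k ring) M"
proof (rule moduleI)
  show "cring (ring_of_type_algebra :: 'k ring)" by (rule cring_from_type_algebra)
qed (auto simp: ab ring_of_type_algebra_def carrier_eq smult_cl add_cl module.scale_left_distrib[OF ms]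
    module.scale_right_distrib[OF ms] module.scale_scale[OF ms] module.scale_one[OF ms])

lemma neg_cl: "\<ominus>\<^bsub>M\<^esub> cl u = cl (- u)"
proof (rule abelian_group.minus_equality[OF ab])
  show "cl (- u) \<oplus>\<^bsub>M\<^esub> cl u = \<zero>\<^bsub>M\<^esub>" by (simp add: add_cl zero_eq)
qed (auto simp: carrier_eq)

lemma minus_cl: "cl u \<ominus>\<^bsub>M\<^esub> cl v = cl (u - v)"
  by (simp add: a_minus_def neg_cl add_cl)

lemma finsum_cl: "finite A \<Longrightarrow> (\<Oplus>\<^bsub>M\<^esub>a\<in>A. cl (h a)) = cl (\<Sum>a\<in>A. h a)"
proof (induction A rule: finite_induct)
  case empty
  then show ?case
    using abelian_monoid.finsum_empty[OF abelian_group.axioms(1)[OF ab]] by (simp add: zero_eq)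
next
  case (insert a A)
  then show ?case
    using abelian_monoid.finsum_insert[OF abelian_group.axioms(1)[OF ab], of A a "\<lambda>a. cl (h a)"]
    by (simp add: carrier_eq add_cl)
qed

lemma submoduleI_cl:
  assumes "module.subspace s S"
  shows "submodule (cl ` S) (ring_of_type_algebra :: 'k ring) M"
proof (rule Module.module.submoduleI[OF vspace])
  show "\<zero>\<^bsub>M\<^esub> \<in> cl ` S"
    using module.subspace_0[OF ms assms] by (auto simp: zero_eq)
qed (auto simp: carrier_eq neg_cl add_cl smult_cl intro!: imageI module.subspace_add[OF ms assms]
    module.subspace_scale[OF ms assms] module.subspace_neg[OF ms assms])

end

definition coset :: "'v::ab_group_add set \<Rightarrow> 'v \<Rightarrow> 'v set" where
  "coset W f = (\<lambda>w. w + f) ` W"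

lemma coset_eq_iff:
  assumes "module.subspace pm_scale W"
  shows "coset W f = coset W g \<longleftrightarrow> f - g \<in> W"
proof
  note sub = module.subspace_0[OF module_pm assms] module.subspace_add[OF module_pm assms]
    module.subspace_diff[OF module_pm assms]
  show "f - g \<in> W" if "coset W f = coset W g"
  proof -
    have "f \<in> coset W f" using sub(1) by (force simp: coset_def)
    then show ?thesis using that by (auto simp: coset_def)
  qed
  show "coset W f = coset W g" if fg: "f - g \<in> W"
  proof -
    have "w + f \<in> coset W g" if "w \<in> W" for w
      using sub(2)[OF that fg] unfolding coset_def by (rule_tac image_eqI[of _ _ "w + (f - g)"]) auto
    moreover have "w + g \<in> coset W f" if "w \<in> W" for w
      using sub(3)[OF that fg] unfolding coset_def by (rule_tac image_eqI[of _ _ "w - (f - g)"]) auto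
    ultimately show ?thesis by (auto simp: coset_def)
  qed
qed

lemma self_coset: "module.subspace pm_scale W \<Longrightarrow> f \<in> coset W f"
  using module.subspace_0[OF module_pm, of W] by (force simp: coset_def)

locale free_quotient =
  fixes F :: "('k::field_char_0, 'b \<Rightarrow>\<^sub>0 'k) module" and B :: "'b set"
    and W :: "('b \<Rightarrow>\<^sub>0 'k) set"
  assumes sub: "module.subspace pm_scale W"
    and carrier_F: "carrier F = {f. Poly_Mapping.keys f \<subseteq> B}"
    and add_F: "add F = (+)"
    and smult_F: "module.smult F = pm_scale"
begin

lemma r_coset: "W +>\<^bsub>F\<^esub> f = coset W f"
  by (auto simp: a_r_coset_def' add_F coset_def)

lemma Union_coset:
  assumes "\<And>a. a - f \<in> W \<Longrightarrow> h a - h f \<in> W"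
  shows "(\<Union>a\<in>coset W f. coset W (h a)) = coset W (h f)"
proof -
  have "coset W (h a) = coset W (h f)" if "a \<in> coset W f" for a
  proof -
    have "a - f \<in> W" using that by (auto simp: coset_def)
    then show ?thesis using assms coset_eq_iff[OF sub] by blast
  qed
  then show ?thesis using self_coset[OF sub, of f] by blast
qed

context
  fixes H :: "bit \<Rightarrow> 'b set" and Q defines "Q \<equiv> super_quotient F W H"
begin

lemma carrier_Q: "carrier Q = coset W ` {f. Poly_Mapping.keys f \<subseteq> B}"
  by (auto simp: Q_def super_quotient_def ring.defs FactRing_def A_RCOSETS_def' r_coset carrier_F)

lemma zero_Q: "\<zero>\<^bsub>Q\<^esub> = coset W 0"
  by (simp add: Q_def super_quotient_def ring.defs FactRing_def coset_def)

lemma add_Q: "coset W f \<oplus>\<^bsub>Q\<^esub> coset W g = coset W (f + g)"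
proof -
  have "coset W f \<oplus>\<^bsub>Q\<^esub> coset W g = (\<Union>h\<in>coset W f. \<Union>k\<in>coset W g. {h + k})"
    by (simp add: Q_def super_quotient_def ring.defs FactRing_def set_add_def' add_F)
  also have "\<dots> = coset W (f + g)"
  proof (intro equalityI subsetI)
    fix a assume "a \<in> (\<Union>h\<in>coset W f. \<Union>k\<in>coset W g. {h + k})"
    then obtain w w' where "w \<in> W" "w' \<in> W" "a = (w + f) + (w' + g)"
      by (auto simp: coset_def)
    then show "a \<in> coset W (f + g)"
      using module.subspace_add[OF module_pm sub, of w w'] unfolding coset_def
      by (intro image_eqI[of _ _ "w + w'"]) (simp_all add: algebra_simps)
  next
    fix a assume "a \<in> coset W (f + g)"
    then obtain w where "w \<in> W" "a = (w + f) + g"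
      by (auto simp: coset_def add.assoc)
    then have "w + f \<in> coset W f" by (simp add: coset_def)
    then show "a \<in> (\<Union>h\<in>coset W f. \<Union>k\<in>coset W g. {h + k})"
      using self_coset[OF sub, of g] \<open>a = (w + f) + g\<close> by blast
  qed
  finally show ?thesis .
qed

lemma smult_Q: "c \<odot>\<^bsub>Q\<^esub> coset W f = coset W (pm_scale c f)"
  using Union_coset[of f "pm_scale c"] module.subspace_scale[OF module_pm sub]
  by (simp add: Q_def super_quotient_def ring.defs r_coset smult_F pm_scale_distribs(3)[symmetric])

lemma gpart_Q: "gpart Q p = coset W ` {f. Poly_Mapping.keys f \<subseteq> H p}"
  by (simp add: Q_def super_quotient_def ring.defs r_coset)

lemma mult_Q: "A \<otimes>\<^bsub>Q\<^esub> A' = (\<Union>f\<in>A. \<Union>g\<in>A'. coset W (f \<otimes>\<^bsub>F\<^esub> g))"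
  by (simp add: Q_def super_quotient_def ring.defs FactRing_def rcoset_mult_def r_coset)

text \<open>The representatives may come from another space, by a map \<open>r\<close> onto the span of \<open>B\<close> modulo \<open>W\<close>.\<close>

lemma presented_Q:
  assumes "lin pm_scale pm_scale q" "range r \<subseteq> {f. Poly_Mapping.keys f \<subseteq> B}" "lin pm_scale pm_scale r"
    "\<And>f. Poly_Mapping.keys f \<subseteq> B \<Longrightarrow> \<exists>u. f - r u \<in> W" "\<And>u. r u \<in> W \<longleftrightarrow> q u = 0"
  shows "presented Q pm_scale q (\<lambda>u. coset W (r u))"
proof
  have "coset W f \<in> range (\<lambda>u. coset W (r u))" if "Poly_Mapping.keys f \<subseteq> B" for f
    using assms(4)[OF that] coset_eq_iff[OF sub] by blast
  then show "carrier Q = range (\<lambda>u. coset W (r u))"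
    using assms(2) by (auto simp: carrier_Q)
  show "coset W (r u) = coset W (r v) \<longleftrightarrow> q u = q v" for u v
    using assms(5)[of "u - v"] by (simp add: coset_eq_iff[OF sub] lin_diff[OF assms(3)] lin_diff[OF assms(1)])
qed (simp_all add: zero_Q add_Q smult_Q lin_simps[OF assms(3)] lin_simps[OF assms(1)] pm_scale_distribs)

end

end

section \<open>The enveloping algebra as a set of cosets\<close>

text \<open>A Lie superalgebra with a choice of projections to its parts that extend to the ambient space.\<close>

locale lie_total = lie_superalgebra L
  for L :: "('k::field_char_0, 'g::ab_group_add) lie_super" +
  fixes pr :: "bit \<Rightarrow> 'g \<Rightarrow> 'g"
  assumes pr_lin': "lin (lscale L) (lscale L) (pr p)"
    and pr_in: "pr p x \<in> lpart L p"
    and pr_id: "x \<in> lpart L p \<Longrightarrow> pr p x = x"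
    and pr_zero: "x \<in> lpart L p \<Longrightarrow> q \<noteq> p \<Longrightarrow> pr q x = 0"
begin

definition proj :: "'g \<Rightarrow> 'g" where "proj x = pr 0 x + pr 1 x"

definition tbr :: "'g \<Rightarrow> 'g \<Rightarrow> 'g" where "tbr x y = lbracket L (proj x) (proj y)"

lemma lpart_iff: "x \<in> lpart L p \<longleftrightarrow> pr p x = x"
  using pr_id pr_in by metis

lemma module_L: "Modules.module (lscale L)"
  using scale by (simp add: module_iff_vector_space)

lemma lpart_lcarrier: "x \<in> lpart L p \<Longrightarrow> x \<in> lcarrier L"
proof -
  have "0 \<in> lpart L r" for r using module.subspace_0[OF module_L part_subspace] .
  then show "x \<in> lpart L p \<Longrightarrow> x \<in> lcarrier L"
    unfolding lcarrier_def by (cases p) (force, force)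
qed

lemma proj_in: "proj x \<in> lcarrier L"
  unfolding proj_def lcarrier_def using pr_in by blast

lemma lcarrier_iff: "x \<in> lcarrier L \<longleftrightarrow> proj x = x"
proof
  assume "x \<in> lcarrier L"
  then obtain y z where "x = y + z" "y \<in> lpart L 0" "z \<in> lpart L 1" unfolding lcarrier_def by blast
  then show "proj x = x"
    by (simp add: proj_def lin_add[OF pr_lin'] pr_id pr_zero[of y 0 1] pr_zero[of z 1 0])
qed (use proj_in[of x] in simp)

lemma proj_lin: "lin (lscale L) (lscale L) proj"
  unfolding proj_def by (intro lin_add_fun pr_lin')

lemma pr_pr': "pr p (pr q x) = (if p = q then pr p x else 0)"
  using pr_id[OF pr_in] pr_zero[OF pr_in] by simp

lemma proj_proj [simp]: "proj (proj x) = proj x"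
  using proj_in lcarrier_iff by blast

lemma lpart_proj: "x \<in> lpart L p \<Longrightarrow> proj x = x"
  using lpart_lcarrier lcarrier_iff by blast

lemma tbr_lpart: "x \<in> lpart L p \<Longrightarrow> y \<in> lpart L q \<Longrightarrow> tbr x y = lbracket L x y"
  by (simp add: tbr_def lpart_proj)

lemma super_lie_L: "super_lie (lscale L) pr tbr"
proof (rule super_lie.intro)
  show "vector_space (lscale L)" by (rule scale)
  show "lin (lscale L) (lscale L) (pr p)" for p by (rule pr_lin')
  show "pr p (pr q x) = (if p = q then pr p x else 0)" for p q x by (rule pr_pr')
  show "lin (lscale L) (lscale L) (\<lambda>x. tbr x y)" "lin (lscale L) (lscale L) (tbr y)" for y
    by (intro linI module_L; simp add: tbr_def lin_simps[OF proj_lin] bracket_add_left bracket_add_right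
        bracket_scale_left bracket_scale_right proj_in)+
  show "tbr (pr 0 x + pr 1 x) y = tbr x y" "tbr x (pr 0 y + pr 1 y) = tbr x y" for x y
    by (simp_all add: tbr_def proj_def[symmetric])
next
  fix p q r x y z assume "pr p x = x" "pr q y = y"
  then have x: "x \<in> lpart L p" and y: "y \<in> lpart L q" by (simp_all add: lpart_iff)
  show "pr (p + q) (tbr x y) = tbr x y"
    using bracket_parity[OF x y] by (simp add: tbr_lpart[OF x y] lpart_iff)
  show "tbr x y = - sg p q (tbr y x)"
    using bracket_skew[OF x y] by (simp add: tbr_lpart[OF x y] tbr_lpart[OF y x] sg_parity_sign[OF module_L])
  assume "pr r z = z"
  then have z: "z \<in> lpart L r" by (simp add: lpart_iff)
  show "tbr x (tbr y z) = tbr (tbr x y) z + sg p q (tbr y (tbr x z))"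
    using bracket_jacobi[OF x y z]
    by (simp add: tbr_lpart[OF y z] tbr_lpart[OF x y] tbr_lpart[OF x z] sg_parity_sign[OF module_L]
      tbr_lpart[OF x bracket_parity[OF y z]] tbr_lpart[OF bracket_parity[OF x y] z]
      tbr_lpart[OF y bracket_parity[OF x z]])
qed

sublocale super_lie "lscale L" pr tbr
  by (rule super_lie_L)

abbreviation "wordsC \<equiv> {w. set (letters w) \<subseteq> lcarrier L}"
abbreviation "car \<equiv> {f :: ('k, 'g) fa. Poly_Mapping.keys f \<subseteq> wordsC}"
abbreviation "\<kappa> \<equiv> map_fa proj :: ('k, 'g) fa \<Rightarrow> ('k, 'g) fa"
abbreviation "FA \<equiv> free_algebra (lcarrier L) :: ('k, 'g tword \<Rightarrow>\<^sub>0 'k) module"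

lemma car_closed:
  "0 \<in> car" "1 \<in> car" "f \<in> car \<Longrightarrow> g \<in> car \<Longrightarrow> f + g \<in> car" "f \<in> car \<Longrightarrow> pm_scale c f \<in> car"
  "f \<in> car \<Longrightarrow> g \<in> car \<Longrightarrow> f * g \<in> car" "f \<in> car \<Longrightarrow> - f \<in> car" "f \<in> car \<Longrightarrow> g \<in> car \<Longrightarrow> f - g \<in> car"
  "x \<in> lcarrier L \<Longrightarrow> letter x \<in> car" "set xs \<subseteq> lcarrier L \<Longrightarrow> word xs \<in> car"
proof -
  show add: "f \<in> car \<Longrightarrow> g \<in> car \<Longrightarrow> f + g \<in> car" for f g
    using keys_add[of f g] by blast
  show sc: "f \<in> car \<Longrightarrow> pm_scale c f \<in> car" for c f
    by (auto simp: in_keys_iff subset_iff)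
  show neg: "f \<in> car \<Longrightarrow> - f \<in> car" for f by simp
  show "f \<in> car \<Longrightarrow> g \<in> car \<Longrightarrow> f - g \<in> car" for f g
    using add[of f "- g"] neg[of g] by simp
  show "f \<in> car \<Longrightarrow> g \<in> car \<Longrightarrow> f * g \<in> car" for f g
    using keys_mult[of f g] by (fastforce simp: plus_tword_def)
qed (auto simp: letter_def word_def zero_tword_def)

lemma carrier_FA: "carrier FA = car" and add_FA: "add FA = (+)" and smult_FA: "module.smult FA = pm_scale"
  and zero_FA: "\<zero>\<^bsub>FA\<^esub> = 0" and mult_FA: "monoid.mult FA = (*)" and one_FA: "\<one>\<^bsub>FA\<^esub> = 1"
  by (simp_all add: free_algebra_def free_space_def)

lemmas FA_simps = carrier_FA add_FA smult_FA zero_FA mult_FA one_FA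

lemma ring_FA: "ring FA"
proof (rule ringI)
  show "abelian_group FA"
  proof (rule abelian_groupI)
    fix f assume "f \<in> carrier FA"
    then show "\<exists>g\<in>carrier FA. g \<oplus>\<^bsub>FA\<^esub> f = \<zero>\<^bsub>FA\<^esub>"
      by (intro bexI[of _ "- f"]) (simp_all add: FA_simps)
  qed (use car_closed(1,3) in \<open>auto simp: FA_simps algebra_simps\<close>)
  show "Group.monoid FA"
    by (rule monoidI) (use car_closed(2,5) in \<open>auto simp: FA_simps mult.assoc\<close>)
qed (auto simp: FA_simps algebra_simps)

lemma \<kappa>_car: "\<kappa> f \<in> car"
  by (induction f rule: pm_induct)
    (simp_all only: map_fa_simps single_word map_fa_word car_closed(1,3,4), rule car_closed, auto simp: proj_in)

lemma \<kappa>_id: "f \<in> car \<Longrightarrow> \<kappa> f = f"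
proof (rule pm_lin_eqI[OF map_fa_lin module.module_hom_ident[OF module_pm]])
  fix b assume "f \<in> car" "b \<in> Poly_Mapping.keys f"
  then have "map proj (letters b) = letters b"
    by (intro map_idI) (auto simp: lcarrier_iff subset_iff)
  then show "\<kappa> (Poly_Mapping.single b 1) = Poly_Mapping.single b 1"
    by (simp only: single_word map_fa_word)
qed

end

lemma pm_double_0: "(v :: 'b \<Rightarrow>\<^sub>0 'k::field_char_0) + v = 0 \<Longrightarrow> v = 0"
proof (rule poly_mapping_eqI)
  fix k assume "v + v = 0"
  then have "Poly_Mapping.lookup (v + v) k = 0" by simp
  then have "2 * Poly_Mapping.lookup v k = 0" by (simp only: lookup_add mult_2)
  then show "Poly_Mapping.lookup v k = Poly_Mapping.lookup 0 k" by simp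
qed

context lie_total
begin

lemma env_relations_cases [consumes 1, case_names add scale bracket]:
  assumes "r \<in> env_relations L"
  obtains x y where "r = letter (x + y) - letter x - letter y" "x \<in> lcarrier L" "y \<in> lcarrier L"
  | c x where "r = letter (lscale L c x) - pm_scale c (letter x)" "x \<in> lcarrier L"
  | p q x y where "r = letter x * letter y - pm_scale (parity_sign p q) (letter y * letter x) - letter (lbracket L x y)"
    "x \<in> lpart L p" "y \<in> lpart L q"
  using assms unfolding env_relations_def by blast

lemma ideal_env: "ideal (env_ideal L) FA"
  and relations_ideal: "env_relations L \<subseteq> env_ideal L"
proof -
  interpret FA: ring FA by (rule ring_FA)
  have bc: "lbracket L x y \<in> lcarrier L" if "x \<in> lpart L p" "y \<in> lpart L q" for p q x y
    using bracket_parity[OF that] lpart_lcarrier by blast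
  have cadd: "x + y \<in> lcarrier L" and sc: "lscale L c x \<in> lcarrier L"
    if "x \<in> lcarrier L" "y \<in> lcarrier L" for x y c
    using that by (simp_all add: lcarrier_iff lin_simps[OF proj_lin])
  have "r \<in> car" if "r \<in> env_relations L" for r
    using that
  proof (cases rule: env_relations_cases)
    case (add x y)
    show ?thesis unfolding add(1) using add(2,3) by (intro car_closed cadd)
  next
    case (scale c x)
    show ?thesis unfolding scale(1) using scale(2) by (intro car_closed sc)
  next
    case (bracket p q x y)
    show ?thesis unfolding bracket(1) using bracket(2,3)
      by (intro car_closed bc) (auto intro: lpart_lcarrier)
  qed
  then have "env_relations L \<subseteq> carrier FA" unfolding carrier_FA by (rule subsetI)
  then show "ideal (env_ideal L) FA" "env_relations L \<subseteq> env_ideal L"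
    unfolding env_ideal_def by (rule FA.genideal_ideal, rule FA.genideal_self)
qed

lemma env_ideal_car: "env_ideal L \<subseteq> car"
  using additive_subgroup.a_subset[OF ideal.axioms(1)[OF ideal_env]] by (simp only: carrier_FA)

lemma env_ideal_closed:
  "f \<in> env_ideal L \<Longrightarrow> g \<in> env_ideal L \<Longrightarrow> f + g \<in> env_ideal L"
  "f \<in> env_ideal L \<Longrightarrow> g \<in> car \<Longrightarrow> f * g \<in> env_ideal L"
  "f \<in> env_ideal L \<Longrightarrow> g \<in> car \<Longrightarrow> g * f \<in> env_ideal L"
  "0 \<in> env_ideal L"
  using additive_subgroup.a_closed[OF ideal.axioms(1)[OF ideal_env], of f g]
    additive_subgroup.zero_closed[OF ideal.axioms(1)[OF ideal_env]]
    ideal.I_l_closed[OF ideal_env, of f g] ideal.I_r_closed[OF ideal_env, of f g]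
  by (simp_all only: FA_simps)

lemma subspace_env_ideal: "module.subspace pm_scale (env_ideal L)"
proof -
  have "Poly_Mapping.single 0 c \<in> car" for c by (simp add: zero_tword_def)
  then show ?thesis
    using env_ideal_closed by (auto simp: module.subspace_def[OF module_pm] pm_scale_conv_mult)
qed

text \<open>The intersection of \<open>J\<close> with the free algebra on the carrier is an ideal that contains the defining
  relations.\<close>

lemma env_ideal_J: "env_ideal L \<subseteq> J"
proof -
  interpret FA: ring FA by (rule ring_FA)
  have "ideal (J \<inter> car) FA"
  proof (rule idealI[OF ring_FA])
    show "subgroup (J \<inter> car) (add_monoid FA)"
    proof (rule FA.add.subgroupI)
      show "J \<inter> car \<noteq> {}" using J_0 car_closed(1) by blast
      fix f assume f: "f \<in> J \<inter> car"
      have "\<ominus>\<^bsub>FA\<^esub> f = - f"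
        using f by (intro FA.minus_equality) (simp_all add: FA_simps)
      then show "\<ominus>\<^bsub>FA\<^esub> f \<in> J \<inter> car"
        using f J_neg car_closed(6) by simp
    qed (use J_add car_closed(3) in \<open>auto simp: FA_simps\<close>)
  qed (use J_mult_left J_mult_right car_closed(5) in \<open>auto simp: FA_simps\<close>)
  moreover have "r \<in> J" if "r \<in> env_relations L" for r
    using that
  proof (cases rule: env_relations_cases)
    case (bracket p q x y)
    then show ?thesis using J_bracket[of p x q y]
      by (simp add: sg_parity_sign[OF module_pm] lpart_iff[symmetric] tbr_lpart)
  qed (simp_all add: J_letter_add J_letter_scale)
  moreover have "env_relations L \<subseteq> car"
    using relations_ideal env_ideal_car by blast
  ultimately have "Idl\<^bsub>FA\<^esub> (env_relations L) \<subseteq> J \<inter> car"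
    by (intro FA.genideal_minimal) auto
  then show ?thesis by (simp add: env_ideal_def)
qed

text \<open>Conversely, replacing each letter by its projection to the carrier turns the relations that span \<open>J\<close> into
  defining relations or \<open>0\<close>.\<close>

lemma kappa_J: "f \<in> J \<Longrightarrow> \<kappa> f \<in> env_ideal L"
proof (induction f rule: J_induct)
  case (rel u r v)
  have "\<kappa> r \<in> env_relations L \<union> {0}"
    using rel
  proof (cases rule: rels_cases)
    case (add x y)
    have "\<kappa> r = letter (proj x + proj y) - letter (proj x) - letter (proj y)"
      by (simp add: add map_fa_simps lin_simps[OF proj_lin])
    then show ?thesis unfolding env_relations_def using proj_in by blast
  next
    case (scale c x)
    have "\<kappa> r = letter (lscale L c (proj x)) - pm_scale c (letter (proj x))"
      by (simp add: scale map_fa_simps lin_simps[OF proj_lin])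
    then show ?thesis unfolding env_relations_def using proj_in by blast
  next
    case (parts x)
    have "proj (pr 0 x) = pr 0 x" "proj (pr 1 x) = pr 1 x"
      using lpart_proj[OF pr_in] by blast+
    then have "\<kappa> r = letter (pr 0 x + pr 1 x) - letter (pr 0 x) - letter (pr 1 x)"
      by (simp add: parts map_fa_simps) (simp add: proj_def)
    then show ?thesis unfolding env_relations_def using lpart_lcarrier[OF pr_in] by blast
  next
    case (bracket p q x y)
    then have x: "x \<in> lpart L p" and y: "y \<in> lpart L q" by (simp_all add: lpart_iff)
    have "\<kappa> r = letter x * letter y - pm_scale (parity_sign p q) (letter y * letter x) - letter (lbracket L x y)"
      using lpart_proj[OF x] lpart_proj[OF y] lpart_proj[OF bracket_parity[OF x y]]
      by (simp add: bracket(1) sg_parity_sign[OF module_pm] tbr_lpart[OF x y] sg_def map_fa_simps map_fa_mult)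
    then show ?thesis
      unfolding env_relations_def using x y by blast
  qed
  then have "\<kappa> r \<in> env_ideal L" using relations_ideal env_ideal_closed(4) by auto
  then show ?case using \<kappa>_car by (simp only: map_fa_mult env_ideal_closed)
qed (use env_ideal_closed module.subspace_scale[OF module_pm subspace_env_ideal] in \<open>auto simp: map_fa_simps\<close>)

lemma env_proj: "env (letter (proj x)) = env (letter x)"
  using env_letter_pr[of x] by (simp add: proj_def env_letter_simps)

lemma env_kappa: "env (\<kappa> f) = env f"
proof (induction f rule: fa_induct)
  case (letter x f)
  show ?case unfolding map_fa_letter_mult by (rule env_mult_cong[OF env_proj letter])
qed (simp_all add: map_fa_simps env_simps)

lemma kappa_ideal_iff: "\<kappa> f \<in> env_ideal L \<longleftrightarrow> env f = 0"
  using kappa_J env_ideal_J env_kappa by (metis env_eq_0_iff subsetD)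

definition cls :: "('k, 'g) fa \<Rightarrow> ('k, 'g) env_elem" where
  "cls f = coset (env_ideal L) (\<kappa> f)"

abbreviation "U \<equiv> enveloping_algebra L"

sublocale fq: free_quotient FA wordsC "env_ideal L"
  by standard (simp_all only: subspace_env_ideal FA_simps)

sublocale U: presented U pm_scale env cls
  unfolding cls_def[abs_def] enveloping_algebra_def
proof (rule fq.presented_Q[OF env_lin _ map_fa_lin])
  show "range \<kappa> \<subseteq> car" using \<kappa>_car by blast
  show "\<exists>u. f - \<kappa> u \<in> env_ideal L" if "Poly_Mapping.keys f \<subseteq> wordsC" for f
    using \<kappa>_id[of f] that env_ideal_closed(4) by (intro exI[of _ f]) simp
qed (rule kappa_ideal_iff)

lemma cls_car: "f \<in> car \<Longrightarrow> cls f = coset (env_ideal L) f"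
  unfolding cls_def by (simp only: \<kappa>_id)

lemma env_class_cls: "f \<in> car \<Longrightarrow> env_class L f = cls f"
  unfolding env_class_def fq.r_coset by (simp only: cls_car)

lemma env_embed_cls: "x \<in> lcarrier L \<Longrightarrow> env_embed L x = cls (letter x)"
  unfolding env_embed_def by (intro env_class_cls car_closed)

lemma mult_cls: "cls f \<otimes>\<^bsub>U\<^esub> cls g = cls (f * g)"
proof -
  have eq: "coset (env_ideal L) (f' \<otimes>\<^bsub>FA\<^esub> g') = cls (f * g)"
    if fg: "f' \<in> coset (env_ideal L) (\<kappa> f)" "g' \<in> coset (env_ideal L) (\<kappa> g)" for f' g'
  proof -
    obtain i j where ij: "i \<in> env_ideal L" "j \<in> env_ideal L" "f' = i + \<kappa> f" "g' = j + \<kappa> g"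
      using fg unfolding coset_def by blast
    have c: "f' \<in> car" "g' \<in> car"
      unfolding ij(3,4)
      by (rule car_closed(3)[OF subsetD[OF env_ideal_car] \<kappa>_car], rule ij)+
    have z: "env i = 0" "env j = 0" using ij(1,2) env_ideal_J env_eq_0_iff by auto
    have "env f' = env f" "env g' = env g"
      by (simp_all add: ij env_simps env_kappa z)
    then have "env (f' * g') = env (f * g)" by (rule env_mult_cong)
    then have "cls (f' * g') = cls (f * g)" by (simp add: U.cl_eq)
    then show ?thesis using cls_car[OF car_closed(5)[OF c]] by (simp only: mult_FA)
  qed
  have "cls f \<otimes>\<^bsub>U\<^esub> cls g = (\<Union>f'\<in>cls f. \<Union>g'\<in>cls g. coset (env_ideal L) (f' \<otimes>\<^bsub>FA\<^esub> g'))"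
    unfolding enveloping_algebra_def by (rule fq.mult_Q)
  also have "\<dots> = (\<Union>f'\<in>cls f. \<Union>g'\<in>cls g. cls (f * g))"
    by (intro SUP_cong refl) (simp add: cls_def[of f] cls_def[of g] eq)
  also have "\<dots> = cls (f * g)"
    using self_coset[OF subspace_env_ideal] by (auto simp: cls_def[of f] cls_def[of g])
  finally show ?thesis .
qed

section \<open>The grading of the enveloping algebra\<close>

lemma word_part_wordsC: "word_part L p \<subseteq> wordsC"
proof -
  have w: "set xs \<subseteq> lcarrier L" if "list_all2 (\<lambda>x q. x \<in> lpart L q) xs ps" for xs ps
    using that by (auto simp: list_all2_conv_all_nth in_set_conv_nth) (metis lpart_lcarrier)
  then show ?thesis unfolding word_part_def by (clarsimp) (use w in blast)
qed

lemma word_part_car: "Poly_Mapping.keys f \<subseteq> word_part L p \<Longrightarrow> f \<in> car"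
  using word_part_wordsC by blast

lemma sg_sg: "sg p 1 (sg q 1 v) = sg (p + q) 1 v"
  by (cases p; cases q) simp_all

lemma par_word_part:
  assumes "Poly_Mapping.keys f \<subseteq> word_part L p"
  shows "env (par f) = sg p 1 (env f)"
proof (rule pm_lin_eqI[OF lin_comp[OF map_fa_lin env_lin]])
  show "lin pm_scale pm_scale (\<lambda>f. sg p 1 (env f))"
    by (intro linI module_pm) (simp_all add: sg_def env_simps)
  fix w assume "w \<in> Poly_Mapping.keys f"
  then obtain xs ps where w: "w = TWord xs" "list_all2 (\<lambda>x q. x \<in> lpart L q) xs ps" "sum_list ps = p"
    using assms unfolding word_part_def by blast
  have "env (par (word xs)) = sg (sum_list ps) 1 (env (word xs))"
    using w(2)
  proof (induction rule: list_all2_induct)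
    case (Cons x xs q qs)
    have x: "pr q x = x" using Cons.hyps by (simp add: lpart_iff)
    have "env (par (word (x # xs))) = env (letter (sigma x) * env (par (word xs)))"
      by (simp add: word_Cons map_fa_letter_mult)
    also have "\<dots> = sg q 1 (sg (sum_list qs) 1 (env (letter x * word xs)))"
      unfolding env_letter_sigma[OF x] Cons.IH by (simp add: sg_def env_simps)
    finally show ?case by (simp add: sg_sg word_Cons)
  qed simp
  then show "env (par (Poly_Mapping.single w 1)) = sg p 1 (env (Poly_Mapping.single w 1))"
    by (simp only: single_word w tword.sel)
qed

lemma letter_word_part:
  assumes "Poly_Mapping.keys f \<subseteq> word_part L p" "x \<in> lpart L q"
  shows "Poly_Mapping.keys (letter x * f) \<subseteq> word_part L (q + p)"
proof
  fix w assume "w \<in> Poly_Mapping.keys (letter x * f)"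
  then obtain v where v: "v \<in> Poly_Mapping.keys f" "w = TWord [x] + v"
    using keys_mult[of "letter x" f] by (auto simp: letter_def)
  then obtain xs ps where "v = TWord xs" "list_all2 (\<lambda>x q. x \<in> lpart L q) xs ps" "sum_list ps = p"
    using assms(1) unfolding word_part_def by blast
  then show "w \<in> word_part L (q + p)"
    unfolding word_part_def using assms(2) v(2)
    by (auto simp: plus_tword_def intro!: exI[of _ "q # ps"])
qed

text \<open>Splitting every letter into its even and odd parts splits words into homogeneous ones.\<close>

lemma decompose:
  "\<exists>f0 f1. Poly_Mapping.keys f0 \<subseteq> word_part L 0 \<and> Poly_Mapping.keys f1 \<subseteq> word_part L 1 \<and> env u = env (f0 + f1)"
proof (induction u rule: fa_induct)
  case zero
  show ?case by (intro exI[of _ 0]) simp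
next
  case (add t u)
  then obtain f0 f1 g0 g1 where
    "Poly_Mapping.keys f0 \<subseteq> word_part L 0" "Poly_Mapping.keys f1 \<subseteq> word_part L 1" "env t = env (f0 + f1)"
    "Poly_Mapping.keys g0 \<subseteq> word_part L 0" "Poly_Mapping.keys g1 \<subseteq> word_part L 1" "env u = env (g0 + g1)"
    by blast
  then show ?case
    using keys_add[of f0 g0] keys_add[of f1 g1]
    by (intro exI[of _ "f0 + g0"] exI[of _ "f1 + g1"]) (auto simp: env_simps algebra_simps)
next
  case (scale c t)
  then obtain f0 f1 where
    "Poly_Mapping.keys f0 \<subseteq> word_part L 0" "Poly_Mapping.keys f1 \<subseteq> word_part L 1" "env t = env (f0 + f1)"
    by blast
  moreover have "Poly_Mapping.keys (pm_scale c f) \<subseteq> Poly_Mapping.keys f" for f :: "('k, 'g) fa"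
    by (auto simp: in_keys_iff)
  ultimately show ?case
    by (intro exI[of _ "pm_scale c f0"] exI[of _ "pm_scale c f1"]) (auto simp: env_simps pm_scale_distribs)
next
  case one
  have "TWord [] \<in> word_part L 0" by (auto simp: word_part_def)
  then show ?case by (intro exI[of _ 1] exI[of _ 0]) (simp add: zero_tword_def)
next
  case (letter x f)
  then obtain f0 f1 where f:
    "Poly_Mapping.keys f0 \<subseteq> word_part L 0" "Poly_Mapping.keys f1 \<subseteq> word_part L 1" "env f = env (f0 + f1)"
    by blast
  let ?x0 = "letter (pr 0 x)" and ?x1 = "letter (pr 1 x)"
  have "env (letter x * f) = env (letter x * (f0 + f1))"
    using f(3) env_mult_left by metis
  then have "env (letter x * f) = env ((?x0 * f0 + ?x1 * f1) + (?x0 * f1 + ?x1 * f0))"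
    using env_letter_pr[of x] env_mult_right[of "letter x" "f0 + f1"]
    by (simp add: algebra_simps env_simps flip: env_mult_right[of "letter x"])
  moreover have "Poly_Mapping.keys (?x0 * f0 + ?x1 * f1) \<subseteq> word_part L 0"
    using letter_word_part[OF f(1) pr_in[of 0 x]] letter_word_part[OF f(2) pr_in[of 1 x]]
      keys_add[of "?x0 * f0" "?x1 * f1"] by auto
  moreover have "Poly_Mapping.keys (?x0 * f1 + ?x1 * f0) \<subseteq> word_part L 1"
    using letter_word_part[OF f(2) pr_in[of 0 x]] letter_word_part[OF f(1) pr_in[of 1 x]]
      keys_add[of "?x0 * f1" "?x1 * f0"] by auto
  ultimately show ?case by blast
qed

text \<open>A vector with \<open>\<sigma> u = \<plusminus>u\<close> equals its homogeneous part of that parity, because twice the other part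
  is \<open>0\<close>.\<close>

lemma gpart_cls: "gpart U p = {cls u |u. env (par u) = sg p 1 (env u)}"
proof (intro equalityI subsetI)
  fix A assume "A \<in> gpart U p"
  then obtain f where f: "Poly_Mapping.keys f \<subseteq> word_part L p" "A = coset (env_ideal L) f"
    unfolding enveloping_algebra_def fq.gpart_Q by blast
  then show "A \<in> {cls u |u. env (par u) = sg p 1 (env u)}"
    using cls_car[OF word_part_car[OF f(1)]] par_word_part[OF f(1)] by blast
next
  fix A assume "A \<in> {cls u |u. env (par u) = sg p 1 (env u)}"
  then obtain u where u: "A = cls u" "env (par u) = sg p 1 (env u)" by blast
  obtain f0 f1 where f: "Poly_Mapping.keys f0 \<subseteq> word_part L 0" "Poly_Mapping.keys f1 \<subseteq> word_part L 1"
    "env u = env (f0 + f1)" using decompose by blast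
  have "env (par u) = env (par (f0 + f1))" using f(3) par_env by metis
  then have p: "env (par u) = env f0 - env f1"
    using par_word_part[OF f(1)] par_word_part[OF f(2)] by (simp add: map_fa_simps env_simps)
  have "\<exists>f. Poly_Mapping.keys f \<subseteq> word_part L p \<and> env u = env f"
  proof (cases p)
    assume "p = 0"
    then have "env f1 + env f1 = 0" using u(2) p f(3) by (simp add: env_simps algebra_simps)
    then show ?thesis using pm_double_0[of "env f1"] f \<open>p = 0\<close> by (auto simp: env_simps)
  next
    assume "p = 1"
    then have "env f0 + env f0 = 0" using u(2) p f(3) by (simp add: env_simps algebra_simps eq_neg_iff_add_eq_0)
    then show ?thesis using pm_double_0[of "env f0"] f \<open>p = 1\<close> by (auto simp: env_simps)
  qed
  then obtain f where f: "Poly_Mapping.keys f \<subseteq> word_part L p" "env u = env f" by blast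
  then have "A = coset (env_ideal L) f"
    using cls_car[OF word_part_car[OF f(1)]] u(1) by (metis U.cl_eq)
  then show "A \<in> gpart U p"
    unfolding enveloping_algebra_def fq.gpart_Q using f(1) by blast
qed

lemma hom_component_L: "x \<in> lcarrier L \<Longrightarrow> hom_component (+) (lpart L) p x = pr p x"
  unfolding hom_component_def
proof (rule the_equality)
  assume x: "x \<in> lcarrier L"
  show "pr p x \<in> lpart L p \<and> (\<exists>b\<in>lpart L (p + 1). x = pr p x + b)"
    using x pr_in[of p x] pr_in[of "p + 1" x] unfolding lcarrier_iff proj_def
    by (cases p) (auto simp: add.commute intro: bexI[of _ "pr (p + 1) x"])
  fix a assume "a \<in> lpart L p \<and> (\<exists>b\<in>lpart L (p + 1). x = a + b)"
  then show "a = pr p x"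
    by (cases p) (auto simp: lin_add[OF pr_lin'] pr_id pr_zero)
qed

lemma hom_component_U:
  assumes "env (par f0) = env f0" "env (par f1) = - env f1"
  shows "hom_component (add U) (gpart U) q (cls (f0 + f1)) = cls (if q = 0 then f0 else f1)"
  unfolding hom_component_def
proof (rule the_equality)
  have g: "cls f0 \<in> gpart U 0" "cls f1 \<in> gpart U 1"
    unfolding gpart_cls using assms by auto
  show "cls (if q = 0 then f0 else f1) \<in> gpart U q \<and>
    (\<exists>b\<in>gpart U (q + 1). cls (f0 + f1) = cls (if q = 0 then f0 else f1) \<oplus>\<^bsub>U\<^esub> b)"
    using g by (cases q) (auto simp: U.add_cl add.commute intro: bexI[of _ "cls f0"] bexI[of _ "cls f1"])
  fix a assume "a \<in> gpart U q \<and> (\<exists>b\<in>gpart U (q + 1). cls (f0 + f1) = a \<oplus>\<^bsub>U\<^esub> b)"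
  then obtain u v where uv: "a = cls u" "env (par u) = sg q 1 (env u)" "env (par v) = sg (q + 1) 1 (env v)"
    "cls (f0 + f1) = cls (u + v)"
    unfolding gpart_cls by (auto simp: U.add_cl)
  then have e: "env f0 + env f1 = env u + env v" by (simp add: U.cl_eq env_simps)
  have "env (par (f0 + f1)) = env (par (u + v))"
    using uv(4) unfolding U.cl_eq by (metis par_env)
  then have e': "env f0 - env f1 = env (par u) + env (par v)"
    using assms by (simp add: map_fa_simps env_simps)
  have "env u + env u = env (if q = 0 then f0 else f1) + env (if q = 0 then f0 else f1)"
  proof (cases q)
    assume q: "q = 0"
    have "env u + env u = (env u + env v) + (env u - env v)" by simp
    also have "\<dots> = (env f0 + env f1) + (env f0 - env f1)" using e e' uv(2,3) q by simp
    finally show ?thesis using q by simp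
  next
    assume q: "q = 1"
    have "env u + env u = (env u + env v) - (- env u + env v)" by simp
    also have "\<dots> = (env f0 + env f1) - (env f0 - env f1)" using e e' uv(2,3) q by simp
    finally show ?thesis using q by simp
  qed
  then have "(env u - env (if q = 0 then f0 else f1)) + (env u - env (if q = 0 then f0 else f1)) = 0"
    by (simp add: algebra_simps del: env_simps)
  then have "env u = env (if q = 0 then f0 else f1)" using pm_double_0 eq_iff_diff_eq_0 by blast
  then show "a = cls (if q = 0 then f0 else f1)" by (simp add: uv(1) U.cl_eq)
qed

end

section \<open>The twisted adjoint module\<close>

context lie_total
begin

text \<open>The module axioms for a space of classes whose homogeneous parts are the eigenspaces of an involution
  \<open>\<sigma>\<close>: a vector is the sum of its two eigencomponents \<open>(u \<plusminus> \<sigma> u)/2\<close>, and their intersection is \<open>0\<close> because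
  \<open>2\<close> is invertible.\<close>

lemma lie_moduleI:
  fixes M :: "('k, 'c, 'g) lie_rep" and s :: "'k \<Rightarrow> 'v \<Rightarrow> 'v::ab_group_add"
  assumes M: "presented M s q cl" and a: "super_rep (lscale L) pr tbr s UNIV a"
    and \<sigma>: "lin s s \<sigma>" "\<And>u. q u = 0 \<Longrightarrow> q (\<sigma> u) = 0" "\<And>u. q (\<sigma> (\<sigma> u)) = q u"
    and gp: "\<And>p. gpart M p = {cl u |u. q (\<sigma> u) = sg p 1 (q u)}"
    and act: "\<And>x u. x \<in> lcarrier L \<Longrightarrow> act M x (cl u) = cl (a x u)"
    and par: "\<And>p x u. x \<in> lpart L p \<Longrightarrow> q (\<sigma> (a x u)) = sg p 1 (q (a x (\<sigma> u)))"
  shows "lie_module L M"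
proof -
  interpret M: presented M s q cl by fact
  interpret a: super_rep "lscale L" pr tbr s UNIV a by fact
  note ql = lin_simps[OF M.q_lin] and \<sigma>l = lin_simps[OF \<sigma>(1)]
  note sc = module.scale_minus_right[OF M.ms] module.scale_zero_right[OF M.ms]
  have q_cong: "q (\<sigma> u) = q (\<sigma> v)" if "q u = q v" for u v
    using \<sigma>(2)[of "u - v"] that by (simp add: ql \<sigma>l)
  have sub: "module.subspace s {u. q (\<sigma> u) = sg p 1 (q u)}" for p
    by (auto simp: module.subspace_def[OF M.ms] ql \<sigma>l sg_def sc)
  have gp': "gpart M p = cl ` {u. q (\<sigma> u) = sg p 1 (q u)}" for p
    unfolding gp by blast
  have half: "s (1/2) v + s (1/2) v = v" for v
    by (simp add: module.scale_left_distrib[OF M.ms, symmetric] module.scale_one[OF M.ms])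
  have double: "v = 0" if "v + v = 0" for v :: 'v
    using half[of v] that by (simp add: module.scale_right_distrib[OF M.ms, symmetric] sc)
  show ?thesis
  proof (rule lie_module.intro)
    show "Module.module (ring_of_type_algebra :: 'k ring) M" by (rule M.vspace)
    show "submodule (gpart M p) (ring_of_type_algebra :: 'k ring) M" for p
      unfolding gp' by (rule M.submoduleI_cl[OF sub])
    show "carrier M = gpart M 0 <+>\<^bsub>M\<^esub> gpart M 1"
    proof (intro equalityI subsetI)
      fix A assume "A \<in> carrier M"
      then obtain u where A: "A = cl u" by (auto simp: M.carrier_eq)
      let ?v = "s (1/2) u" and ?w = "s (1/2) (\<sigma> u)"
      have sv: "\<sigma> ?v = ?w" and sw: "q (\<sigma> ?w) = q ?v"
        by (simp_all add: \<sigma>l ql \<sigma>(3))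
      have "cl (?v + ?w) \<in> gpart M 0" "cl (?v - ?w) \<in> gpart M 1"
        unfolding gp' by (rule imageI; simp add: \<sigma>l ql \<sigma>(3))+
      moreover have "A = cl (?v + ?w) \<oplus>\<^bsub>M\<^esub> cl (?v - ?w)"
        by (simp add: A M.add_cl half)
      ultimately show "A \<in> gpart M 0 <+>\<^bsub>M\<^esub> gpart M 1"
        unfolding set_add_def' by blast
    next
      fix A assume "A \<in> gpart M 0 <+>\<^bsub>M\<^esub> gpart M 1"
      then show "A \<in> carrier M"
        by (auto simp: set_add_def' gp' M.add_cl M.carrier_eq)
    qed
    show "gpart M 0 \<inter> gpart M 1 = {\<zero>\<^bsub>M\<^esub>}"
    proof (intro equalityI subsetI)
      fix A assume "A \<in> gpart M 0 \<inter> gpart M 1"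
      then have "A \<in> gpart M 0" "A \<in> gpart M 1" by simp_all
      then obtain u v where uv: "A = cl u" "q (\<sigma> u) = q u" "A = cl v" "q (\<sigma> v) = - q v"
        unfolding gp by fastforce
      then have e: "q u = q v" using M.cl_eq by blast
      have "q u = q (\<sigma> u)" by (rule uv(2)[symmetric])
      also have "\<dots> = q (\<sigma> v)" by (rule q_cong[OF e])
      also have "\<dots> = - q u" unfolding e by (rule uv(4))
      finally have "q u = - q u" .
      then have "q u + q u = 0" by (rule eq_neg_iff_add_eq_0[THEN iffD1])
      then have "q u = 0" by (rule double)
      then have "q u = q 0" by (simp add: ql)
      then show "A \<in> {\<zero>\<^bsub>M\<^esub>}" by (simp add: uv(1) M.zero_eq M.cl_eq)
    next
      fix A assume "A \<in> {\<zero>\<^bsub>M\<^esub>}"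
      then show "A \<in> gpart M 0 \<inter> gpart M 1"
        unfolding gp' by (auto simp: M.zero_eq ql \<sigma>l intro!: image_eqI[of _ _ 0])
    qed
    have cadd: "x + y \<in> lcarrier L" and csc: "lscale L c x \<in> lcarrier L"
      if "x \<in> lcarrier L" "y \<in> lcarrier L" for x y c
      using that by (simp_all add: lcarrier_iff lin_simps[OF proj_lin])
    show "act M (x + y) A = act M x A \<oplus>\<^bsub>M\<^esub> act M y A"
      if "x \<in> lcarrier L" "y \<in> lcarrier L" "A \<in> carrier M" for x y A
      using that by (auto simp: M.carrier_eq act cadd M.add_cl a.a_add_left)
    show "act M (lscale L c x) A = c \<odot>\<^bsub>M\<^esub> act M x A"
      if "x \<in> lcarrier L" "A \<in> carrier M" for c x A
      using that by (auto simp: M.carrier_eq act csc M.smult_cl a.a_scale_left)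
    show "act M x (A \<oplus>\<^bsub>M\<^esub> B) = act M x A \<oplus>\<^bsub>M\<^esub> act M x B"
      if "x \<in> lcarrier L" "A \<in> carrier M" "B \<in> carrier M" for x A B
      using that by (auto simp: M.carrier_eq act M.add_cl a.a_add)
    show "act M x (c \<odot>\<^bsub>M\<^esub> A) = c \<odot>\<^bsub>M\<^esub> act M x A"
      if "x \<in> lcarrier L" "A \<in> carrier M" for c x A
      using that by (auto simp: M.carrier_eq act M.smult_cl a.a_scale)
    show "act M x A \<in> gpart M (p + r)" if x: "x \<in> lpart L p" and A: "A \<in> gpart M r" for p r x A
    proof -
      obtain u where u: "A = cl u" "q (\<sigma> u) = sg r 1 (q u)" using A unfolding gp' by auto
      have xc: "x \<in> lcarrier L" using lpart_lcarrier[OF x] .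
      have qa: "q (a x v) = q (a x w)" if "q v = q w" for v w
        using act[OF xc, of v] act[OF xc, of w] that M.cl_eq by metis
      have "q (\<sigma> u) = q (sg r 1 u)" using u(2) by (simp add: sg_def ql)
      then have "q (a x (\<sigma> u)) = q (a x (sg r 1 u))" by (rule qa)
      also have "\<dots> = sg r 1 (q (a x u))"
        using a.a_scale[of u x "-1"] by (simp add: sg_def ql module.scale_minus_left[OF M.ms] module.scale_one[OF M.ms])
      finally have "q (\<sigma> (a x u)) = sg (p + r) 1 (q (a x u))"
        unfolding par[OF x] by (simp add: sg_sg)
      then show ?thesis unfolding gp' u(1) act[OF xc] by blast
    qed
    show "act M (lbracket L x y) A = act M x (act M y A) \<ominus>\<^bsub>M\<^esub> parity_sign p r \<odot>\<^bsub>M\<^esub> act M y (act M x A)"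
      if x: "x \<in> lpart L p" and y: "y \<in> lpart L r" and A: "A \<in> carrier M" for p r x y A
    proof -
      obtain u where u: "A = cl u" using A by (auto simp: M.carrier_eq)
      note c = lpart_lcarrier[OF x] lpart_lcarrier[OF y] lpart_lcarrier[OF bracket_parity[OF x y]]
      show ?thesis
        using a.a_bracket[of p x r y u] x y
        by (simp add: u act c M.smult_cl M.minus_cl sg_parity_sign[OF M.ms] lpart_iff[symmetric] tbr_lpart)
    qed
  qed
qed

end

locale lie_twisted = lie_total L pr
  for L :: "('k::field_char_0, 'g::ab_group_add) lie_super" and pr +
  fixes \<phi> \<psi> :: "'g \<Rightarrow> 'g"
  assumes \<phi>_add: "x \<in> lcarrier L \<Longrightarrow> y \<in> lcarrier L \<Longrightarrow> \<phi> (x + y) = \<phi> x + \<phi> y"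
    and \<phi>_scale: "x \<in> lcarrier L \<Longrightarrow> \<phi> (lscale L c x) = lscale L c (\<phi> x)"
    and \<phi>_lpart: "x \<in> lpart L p \<Longrightarrow> \<phi> x \<in> lpart L p"
    and \<phi>_bracket: "x \<in> lcarrier L \<Longrightarrow> y \<in> lcarrier L \<Longrightarrow> \<phi> (lbracket L x y) = lbracket L (\<phi> x) (\<phi> y)"
    and \<phi>_fix: "x \<in> lpart L 0 \<Longrightarrow> \<phi> x = x"
    and \<psi>_lin': "lin (lscale L) (lscale L) \<psi>"
    and \<psi>_lpart: "x \<in> lpart L 1 \<Longrightarrow> \<psi> x \<in> lpart L 1"
    and \<psi>_right': "x \<in> lpart L 1 \<Longrightarrow> \<psi> x - \<phi> (\<psi> x) = x"
    and \<psi>_left': "x \<in> lpart L 1 \<Longrightarrow> \<psi> (x - \<phi> x) = x"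
begin

definition tphi :: "'g \<Rightarrow> 'g" where "tphi x = \<phi> (proj x)"

lemma \<phi>_lcarrier: "x \<in> lcarrier L \<Longrightarrow> \<phi> x \<in> lcarrier L"
proof -
  assume "x \<in> lcarrier L"
  then obtain y z where x: "x = y + z" "y \<in> lpart L 0" "z \<in> lpart L 1" unfolding lcarrier_def by blast
  then have "\<phi> x = \<phi> y + \<phi> z" using lpart_lcarrier by (simp add: \<phi>_add)
  then show "\<phi> x \<in> lcarrier L"
    using \<phi>_lpart[OF x(2)] \<phi>_lpart[OF x(3)] unfolding lcarrier_def by blast
qed

lemma tphi_lpart: "x \<in> lpart L p \<Longrightarrow> tphi x = \<phi> x"
  by (simp add: tphi_def lpart_proj)

lemma tbr_in: "tbr x y \<in> lcarrier L"
proof -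
  have p: "proj (tbr (pr p x) (pr q y)) = tbr (pr p x) (pr q y)" for p q
    using lpart_lcarrier[OF bracket_parity[OF pr_in pr_in, of p x q y]]
    by (simp add: tbr_lpart[OF pr_in pr_in] lcarrier_iff)
  have "tbr x y = tbr (pr 0 x) (pr 0 y) + tbr (pr 0 x) (pr 1 y) + (tbr (pr 1 x) (pr 0 y) + tbr (pr 1 x) (pr 1 y))"
    using br_decomp(1)[of x y] br_decomp(2)[of "pr 0 x" y] br_decomp(2)[of "pr 1 x" y] by simp
  then show ?thesis by (simp add: lcarrier_iff lin_simps[OF proj_lin] p)
qed

sublocale twisted_lie "lscale L" pr tbr tphi \<psi>
proof (intro twisted_lie.intro super_lie_axioms twisted_lie_axioms.intro)
  show "lin (lscale L) (lscale L) tphi"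
    unfolding tphi_def
    by (intro linI module_L) (simp_all add: lin_simps[OF proj_lin] \<phi>_add \<phi>_scale proj_in)
  show "tphi x = x" if "pr 0 x = x" for x
    using that by (simp add: lpart_iff[symmetric] tphi_lpart \<phi>_fix)
  show "pr 1 (tphi x) = tphi x" if "pr 1 x = x" for x
    using that by (simp add: lpart_iff[symmetric] tphi_lpart \<phi>_lpart)
  show "tphi (tbr x y) = tbr (tphi x) (tphi y)" for x y
    using tbr_in[of x y] \<phi>_lcarrier[OF proj_in[of x]] \<phi>_lcarrier[OF proj_in[of y]]
    unfolding lcarrier_iff by (simp add: tphi_def) (simp add: tbr_def \<phi>_bracket proj_in)
  show "lin (lscale L) (lscale L) \<psi>" by (rule \<psi>_lin')
  show "pr 1 (\<psi> x) = \<psi> x" "\<psi> x - tphi (\<psi> x) = x" "\<psi> (x - tphi x) = x" if "pr 1 x = x" for x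
    using that by (simp_all add: lpart_iff[symmetric] tphi_lpart[OF \<psi>_lpart] tphi_lpart \<psi>_lpart \<psi>_right' \<psi>_left')
qed

lemma UNIV_bit: "(UNIV :: bit set) = {0, 1}"
  by (auto simp: bit_not_one_iff)

lemma sum_bit: "(\<Sum>p\<in>UNIV. h p) = h 0 + h (1 :: bit)"
  by (simp only: UNIV_bit) simp

lemma finite_bit: "finite (UNIV :: bit set)"
  by (simp only: UNIV_bit finite.emptyI finite.insertI)

text \<open>The definition extends the formula for homogeneous elements bilinearly; with \<open>f = f0 + f1\<close> the sign in front
  of \<open>f1\<close> turns \<open>f0 + f1\<close> into \<open>f0 - f1\<close>, which is \<open>par f\<close> in the enveloping algebra.\<close>

lemma act_twisted_adjoint:
  assumes x: "x \<in> lcarrier L"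
  shows "act (twisted_adjoint L \<phi>) x (cls f) = cls (twad x f)"
proof -
  obtain f0 f1 where f: "Poly_Mapping.keys f0 \<subseteq> word_part L 0" "Poly_Mapping.keys f1 \<subseteq> word_part L 1"
    "env f = env (f0 + f1)" using decompose by blast
  have p: "env (par f0) = env f0" "env (par f1) = - env f1"
    using par_word_part[OF f(1)] par_word_part[OF f(2)] by simp_all
  define g where "g q = (if q = 0 then f0 else f1)" for q :: bit
  define h where "h p q = letter (pr p x) * g q - sg p q (g q * letter (\<phi> (pr p x)))" for p q
  have cf: "cls f = cls (f0 + f1)" using f(3) by (simp add: U.cl_eq)
  have hx: "hom_component (+) (lpart L) p x = pr p x" for p by (rule hom_component_L[OF x])
  have hc: "hom_component (add U) (gpart U) q (cls f) = cls (g q)" for q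
    unfolding cf g_def by (rule hom_component_U[OF p])
  have e: "env_embed L (pr p x) = cls (letter (pr p x))" "env_embed L (\<phi> (pr p x)) = cls (letter (\<phi> (pr p x)))" for p
    by (rule env_embed_cls[OF lpart_lcarrier[OF pr_in]] env_embed_cls[OF lpart_lcarrier[OF \<phi>_lpart[OF pr_in]]])+
  have "act (twisted_adjoint L \<phi>) x (cls f) = (\<Oplus>\<^bsub>U\<^esub>p\<in>UNIV. \<Oplus>\<^bsub>U\<^esub>q\<in>UNIV. cls (h p q))"
    unfolding twisted_adjoint_def
    by (simp add: superspace.defs Let_def hx hc e mult_cls U.smult_cl U.minus_cl sg_parity_sign[OF module_pm] h_def)
  also have "\<dots> = cls (\<Sum>p\<in>UNIV. \<Sum>q\<in>UNIV. h p q)"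
    by (simp only: U.finsum_cl[OF finite_bit])
  also have "\<dots> = cls (twad x f)"
  proof -
    have pf: "env (par (f0 + f1) * k) = env ((f0 - f1) * k)" for k
      using p by (intro env_mult_cong) (simp_all add: map_fa_simps env_simps)
    have "twad x f = twad x (f0 + f1)" using f(3) twad_env by metis
    also have "\<dots> = env (letter (pr 0 x) * (f0 + f1)) - env ((f0 + f1) * letter (pr 0 x)) +
      (env (letter (pr 1 x) * (f0 + f1)) - env ((f0 - f1) * letter (\<phi> (pr 1 x))))"
      unfolding twad_def using pf by (simp only: env_simps tphi_lpart[OF pr_in])
    also have "\<dots> = env (\<Sum>p\<in>UNIV. \<Sum>q\<in>UNIV. h p q)"
      by (simp add: sum_bit h_def g_def \<phi>_fix[OF pr_in] env_simps algebra_simps)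
    finally show ?thesis by (simp add: U.cl_eq)
  qed
  finally show ?thesis .
qed

lemma twad_par:
  assumes "pr p x = x"
  shows "env (par (twad x u)) = sg p 1 (twad x (par u))"
proof (cases p)
  assume "p = 0"
  then have x: "pr 0 x = x" using assms by simp
  then have s: "sigma x = x" by (simp add: sigma_hom[OF x])
  have "env (par (twad x u)) = env (par (letter x * u - u * letter x))"
    unfolding twad_even[OF x] by (simp add: map_fa_simps env_simps par_env)
  then show ?thesis
    using \<open>p = 0\<close> by (simp add: map_fa_simps map_fa_mult env_simps s twad_even[OF x])
next
  assume "p = 1"
  then have x: "pr 1 x = x" using assms by simp
  have px: "pr 1 (tphi x) = tphi x" by (rule \<phi>_odd[OF x])
  have r: "env (par (par u) * letter (sigma (tphi x))) = - env (par (par u) * letter (tphi x))"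
  proof -
    have "env (par (par u) * letter (sigma (tphi x))) = env (par (par u) * env (letter (sigma (tphi x)) * 1))" by simp
    then show ?thesis unfolding env_letter_sigma[OF px] by (simp add: env_simps)
  qed
  have "env (par (twad x u)) = env (par (letter x * u - par u * letter (tphi x)))"
    unfolding twad_odd[OF x] by (simp add: map_fa_simps env_simps par_env)
  then show ?thesis
    using \<open>p = 1\<close> by (simp add: map_fa_simps map_fa_mult env_simps env_letter_sigma[OF x] r twad_odd[OF x])
qed

lemma presented_twisted: "presented (twisted_adjoint L \<phi>) pm_scale env cls"
  using U.carrier_eq U.zero_eq U.add_cl U.smult_cl U.cl_eq env_lin
  by (simp add: presented_def twisted_adjoint_def Let_def superspace.defs)

lemma gpart_twisted: "gpart (twisted_adjoint L \<phi>) p = {cls u |u. env (par u) = sg p 1 (env u)}"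
  using gpart_cls[of p] by (simp add: twisted_adjoint_def Let_def superspace.defs)

lemma lie_module_twisted: "lie_module L (twisted_adjoint L \<phi>)"
proof (rule lie_moduleI[OF presented_twisted super_rep_twad map_fa_lin _ par_par gpart_twisted act_twisted_adjoint])
  show "env (par u) = 0" if "env u = 0" for u
    using par_J[of u] that by (simp add: env_eq_0_iff)
  show "env (par (twad x u)) = sg p 1 (env (twad x (par u)))" if "x \<in> lpart L p" for p x u
    using twad_par[of p x u] that by (simp add: lpart_iff)
qed

end

section \<open>The even part as a Lie superalgebra\<close>

context lie_total
begin

lemma even_part_simps [simp]:
  "lscale (even_part L) = lscale L" "lbracket (even_part L) = lbracket L"
  "lpart (even_part L) p = (if p = 0 then lpart L 0 else {0})"
  by (simp_all add: even_part_def)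

lemma lcarrier_even_part [simp]: "lcarrier (even_part L) = lpart L 0"
  by (auto simp: lcarrier_def)

lemma even_part_lie_superalgebra: "lie_superalgebra (even_part L)"
proof (rule lie_superalgebra.intro)
  have z: "0 \<in> lpart L p" for p using module.subspace_0[OF module_L part_subspace] .
  note c = lpart_lcarrier[of _ 0]
  have add: "x + y \<in> lpart L 0" if "x \<in> lpart L 0" "y \<in> lpart L 0" for x y
    using module.subspace_add[OF module_L part_subspace that] .
  have br: "lbracket L x y \<in> lpart L 0" if "x \<in> lpart L 0" "y \<in> lpart L 0" for x y
    using bracket_parity[OF that] by simp
  have l0: "lbracket L 0 y = 0" "lbracket L y 0 = 0" if "y \<in> lpart L 0" for y
    using bracket_scale_left[OF c[OF z] c[OF that], of 0] bracket_scale_right[OF c[OF that] c[OF z], of 0]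
    by (simp_all add: module.scale_zero_left[OF module_L])
  note sc0 = module.scale_zero_right[OF module_L] module.scale_minus_right[OF module_L]
    module.scale_one[OF module_L] module.scale_minus_left[OF module_L]
  show "vector_space (lscale (even_part L))" using scale by simp
  show "module.subspace (lscale (even_part L)) (lpart (even_part L) p)" for p
    using part_subspace[of 0] module.subspace_single_0[OF module_L] by simp
  show "lpart (even_part L) 0 \<inter> lpart (even_part L) 1 = {0}" using z by auto
  fix p q r x y z
  show "lbracket (even_part L) x y \<in> lpart (even_part L) (p + q)"
    if "x \<in> lpart (even_part L) p" "y \<in> lpart (even_part L) q"
    using that br z l0 by (cases p; cases q) (auto simp: z l0)
  show "lbracket (even_part L) x y = - lscale (even_part L) (parity_sign p q) (lbracket (even_part L) y x)"
    if "x \<in> lpart (even_part L) p" "y \<in> lpart (even_part L) q"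
    using that bracket_skew[of x 0 y 0] z l0
    by (cases p; cases q) (auto simp: parity_sign_def sc0)
  show "lbracket (even_part L) x (lbracket (even_part L) y z) =
    lbracket (even_part L) (lbracket (even_part L) x y) z +
    lscale (even_part L) (parity_sign p q) (lbracket (even_part L) y (lbracket (even_part L) x z))"
    if "x \<in> lpart (even_part L) p" "y \<in> lpart (even_part L) q" "z \<in> lpart (even_part L) r"
  proof -
    have m: "x \<in> lpart L 0" "y \<in> lpart L 0" "z \<in> lpart L 0"
      using that \<open>\<And>p. 0 \<in> lpart L p\<close> by (auto split: if_splits)
    have "p = 1 \<Longrightarrow> x = 0" using that by simp
    then show ?thesis
      using bracket_jacobi[OF m] br[OF m(2,3)] br[OF m(1,3)] br[OF m(1,2)] m l0
      by (cases p) (auto simp: parity_sign_def sc0)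
  qed
qed (auto simp: bracket_add_left bracket_add_right bracket_scale_left bracket_scale_right lpart_lcarrier)

lemma even_part_lie_total: "lie_total (even_part L) (even_pr pr)"
proof (intro lie_total.intro even_part_lie_superalgebra lie_total_axioms.intro)
  have z: "0 \<in> lpart L p" for p using module.subspace_0[OF module_L part_subspace] .
  show "lin (lscale (even_part L)) (lscale (even_part L)) (even_pr pr p)" for p
    using super_lie.pr_lin[OF even_super_lie] by simp
  show "even_pr pr p x \<in> lpart (even_part L) p" for p x
    by (simp add: even_pr_def pr_in)
  show "even_pr pr p x = x" if "x \<in> lpart (even_part L) p" for p x
    using that by (auto simp: even_pr_def pr_id split: if_splits)
  show "even_pr pr q x = 0" if "x \<in> lpart (even_part L) p" "q \<noteq> p" for p q x
    using that by (cases p) (auto simp: even_pr_def pr_simps)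
qed

lemma even_part_lie_twisted: "lie_twisted (even_part L) (even_pr pr) id id"
proof (intro lie_twisted.intro even_part_lie_total lie_twisted_axioms.intro)
  show "lin (lscale (even_part L)) (lscale (even_part L)) id"
    using module.module_hom_id[OF module_L] by simp
qed auto

end

text \<open>Here the results on the twisted adjoint module are also used for the even part with the identity
  automorphism. For that algebra \<open>even_br\<close> is the bracket obtained by totalising, so both views
  of the even part have the same enveloping algebra.\<close>

locale lie_induced = lie_twisted L pr \<phi> \<psi>
  for L :: "('k::field_char_0, 'g::ab_group_add) lie_super" and pr \<phi> \<psi>
begin

lemma even_tbr: "lie_total.tbr (even_part L) (even_pr pr) = even_br pr tbr"
proof (intro ext)
  fix x y
  interpret E: lie_total "even_part L" "even_pr pr" by (rule even_part_lie_total)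
  show "E.tbr x y = even_br pr tbr x y"
    by (simp add: E.tbr_def E.proj_def even_br_def tbr_def even_pr_def proj_def)
qed

sublocale E: lie_twisted "even_part L" "even_pr pr" id id
  rewrites "lscale (even_part L) = lscale L"
    and "lie_total.tbr (even_part L) (even_pr pr) = even_br pr tbr"
  by (rule even_part_lie_twisted, rule even_part_simps, rule even_tbr)

end

context lie_induced
begin

abbreviation "V \<equiv> adjoint (even_part L)"
abbreviation "U0 \<equiv> enveloping_algebra (even_part L)"

lemma V_presented: "presented V pm_scale even.env E.cls"
  unfolding adjoint_def by (rule E.presented_twisted)

interpretation V: presented V pm_scale even.env E.cls
  by (rule V_presented)

lemma carrier_U0: "carrier U0 = carrier V"
  by (simp add: E.U.carrier_eq V.carrier_eq)

lemma act_V: "z \<in> lpart L 0 \<Longrightarrow> act V z (E.cls u) = E.cls (E.twad z u)"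
  using E.act_twisted_adjoint[of z u] by (simp add: adjoint_def)

lemma E_twad: "pr 0 z = z \<Longrightarrow> E.twad z u = even.env (ad0 z u)"
  by (subst E.twad_even) (simp_all add: even_pr_def ad0_def even.env_simps)

lemma E_twad_0: "E.twad 0 u = 0"
  by (rule lin_zero[OF E.twad_lin_left])

lemma E_twad_pr: "E.twad x u = E.twad (pr 0 x) u"
  using E.twad_pr[of x u] by (simp add: even_pr_def E_twad_0)

lemma E_proj: "E.proj = pr 0"
  by (simp add: fun_eq_iff E.proj_def even_pr_def)

lemma E_sigma: "even.sigma = pr 0"
  by (simp add: fun_eq_iff even.sigma_def even_pr_def)

text \<open>All representatives \<open>f\<close> of a class act in the same way, by the universal property.\<close>

lemma env_act_V: "env_act V (E.cls g) (E.cls v) = E.cls (ev pm_scale E.twad g v)"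
proof -
  have f: "free_act V f (E.cls v) = E.cls (ev pm_scale E.twad f v)" if "f \<in> E.car" for f
  proof -
    have fold: "foldr (act V) xs (E.cls v) = E.cls (foldr E.twad xs v)" if "set xs \<subseteq> lpart L 0" for xs
      using that by (induction xs) (simp_all add: act_V)
    have "free_act V f (E.cls v) =
      (\<Oplus>\<^bsub>V\<^esub>w\<in>Poly_Mapping.keys f. E.cls (pm_scale (Poly_Mapping.lookup f w) (foldr E.twad (letters w) v)))"
      unfolding free_act_def
    proof (rule abelian_monoid.finsum_cong'[OF abelian_group.axioms(1)[OF V.ab]])
      fix w assume "w \<in> Poly_Mapping.keys f"
      then have "set (letters w) \<subseteq> lpart L 0" using that by auto
      then show "Poly_Mapping.lookup f w \<odot>\<^bsub>V\<^esub> foldr (act V) (letters w) (E.cls v) =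
        E.cls (pm_scale (Poly_Mapping.lookup f w) (foldr E.twad (letters w) v))"
        by (simp add: fold V.smult_cl)
    qed (auto simp: V.carrier_eq)
    then show ?thesis by (simp add: V.finsum_cl ev_def lin_ext_def)
  qed
  have "free_act V f (E.cls v) = E.cls (ev pm_scale E.twad g v)" if "f \<in> E.cls g" for f
  proof -
    obtain i where i: "i \<in> env_ideal (even_part L)" "f = i + E.\<kappa> g"
      using \<open>f \<in> E.cls g\<close> unfolding E.cls_def coset_def by blast
    have c: "f \<in> E.car"
      unfolding i(2) by (rule E.car_closed(3)[OF subsetD[OF E.env_ideal_car i(1)] E.\<kappa>_car])
    have "even.env i = 0" using i(1) E.env_ideal_J even.env_eq_0_iff by auto
    then have "even.env f = even.env g" by (simp add: i(2) even.env_simps E.env_kappa)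
    then have "ev pm_scale E.twad f v = ev pm_scale E.twad g v"
      using E.tw.ev_env[of v f] E.tw.ev_env[of v g] by simp
    then show ?thesis by (simp add: f[OF c])
  qed
  moreover have "E.\<kappa> g \<in> E.cls g"
    unfolding E.cls_def by (rule self_coset[OF E.subspace_env_ideal])
  ultimately have "(\<lambda>f. free_act V f (E.cls v)) ` E.cls g = {E.cls (ev pm_scale E.twad g v)}" by blast
  then show ?thesis unfolding env_act_def by simp
qed

lemma env_incl_cls: "env_incl L (E.cls g) = cls (emb g)"
proof -
  have "env_class L a = cls (emb g)" if ag: "a \<in> E.cls g" for a
  proof -
    obtain i where i: "i \<in> env_ideal (even_part L)" "a = i + emb g"
      using ag unfolding E.cls_def coset_def E_proj by blast
    have ic: "i \<in> E.car" using i(1) E.env_ideal_car by blast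
    have c: "a \<in> E.car"
      unfolding i(2) by (rule E.car_closed(3)[OF ic E.\<kappa>_car[unfolded E_proj]])
    then have "a \<in> car" using lpart_lcarrier[of _ 0] by auto
    then have "env_class L a = cls a" by (rule env_class_cls)
    moreover have "emb i = i" using E.\<kappa>_id[OF ic] by (simp only: E_proj)
    then have "env i = 0"
      using emb_J[of i] i(1) E.env_ideal_J by (metis env_eq_0_iff subsetD)
    then have "env a = env (emb g)" by (simp add: i(2) env_simps)
    ultimately show ?thesis by (simp add: U.cl_eq)
  qed
  moreover have "E.\<kappa> g \<in> E.cls g"
    unfolding E.cls_def by (rule self_coset[OF E.subspace_env_ideal])
  ultimately have "env_incl L (E.cls g) = (\<Union>a\<in>E.cls g. cls (emb g))"
    unfolding env_incl_def by blast
  then show ?thesis using \<open>E.\<kappa> g \<in> E.cls g\<close> by blast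
qed

section \<open>The tensor product as a set of cosets\<close>

abbreviation "ra \<equiv> \<lambda>u a. u \<otimes>\<^bsub>U\<^esub> env_incl L a"
abbreviation "TW \<equiv> tensor_subspace U0 U ra V (env_act V)"
abbreviation "PB \<equiv> carrier U \<times> carrier V"
abbreviation "FP \<equiv> free_space PB :: ('k, _) module"

abbreviation pair :: "('k, 'g) fa \<Rightarrow> ('k, 'g) fa \<Rightarrow> ('k, 'g) env_pairs" where
  "pair f v \<equiv> Poly_Mapping.single (cls f, E.cls v) 1"

lemma tensor_relations_eq: "tensor_relations U0 U ra V (env_act V) =
   {pair (f + f') v - pair f v - pair f' v |f f' v. True} \<union>
   {pair f (v + v') - pair f v - pair f v' |f v v'. True} \<union>
   {pair (pm_scale c f) v - pm_scale c (pair f v) |c f v. True} \<union>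
   {pair f (pm_scale c v) - pm_scale c (pair f v) |c f v. True} \<union>
   {pair (f * emb a) v - pair f (ev pm_scale E.twad a v) |f a v. True}"
proof -
  have U: "u \<in> carrier U \<longleftrightarrow> (\<exists>f. u = cls f)" for u by (auto simp: U.carrier_eq)
  have V: "u \<in> carrier V \<longleftrightarrow> (\<exists>f. u = E.cls f)" for u by (auto simp: V.carrier_eq)
  show ?thesis
    unfolding tensor_relations_def Let_def carrier_U0 U V
    by (intro arg_cong2[where f = "(\<union>)"] Collect_cong)
      (auto simp: U.add_cl U.smult_cl V.add_cl V.smult_cl env_incl_cls mult_cls env_act_V; metis U.add_cl U.smult_cl V.add_cl V.smult_cl env_incl_cls mult_cls env_act_V)+
qed

lemma subspace_TW: "module.subspace pm_scale TW"
  unfolding tensor_subspace_def by (rule module.subspace_span[OF module_pm])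

lemmas TW_0 = module.subspace_0[OF module_pm subspace_TW]
  and TW_add = module.subspace_add[OF module_pm subspace_TW]
  and TW_scale = module.subspace_scale[OF module_pm subspace_TW]
  and TW_diff = module.subspace_diff[OF module_pm subspace_TW]

lemma TW_rel:
  "pair (f + f') v - pair f v - pair f' v \<in> TW"
  "pair f (v + v') - pair f v - pair f v' \<in> TW"
  "pair (pm_scale c f) v - pm_scale c (pair f v) \<in> TW"
  "pair f (pm_scale c v) - pm_scale c (pair f v) \<in> TW"
  "pair (f * emb a) v - pair f (ev pm_scale E.twad a v) \<in> TW"
proof -
  have *: "r \<in> tensor_relations U0 U ra V (env_act V) \<Longrightarrow> r \<in> TW" for r
    unfolding tensor_subspace_def by (rule module.span_base[OF module_pm])
  show "pair (f + f') v - pair f v - pair f' v \<in> TW"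
    "pair f (v + v') - pair f v - pair f v' \<in> TW"
    "pair (pm_scale c f) v - pm_scale c (pair f v) \<in> TW"
    "pair f (pm_scale c v) - pm_scale c (pair f v) \<in> TW"
    "pair (f * emb a) v - pair f (ev pm_scale E.twad a v) \<in> TW"
    by (rule *, unfold tensor_relations_eq, blast)+
qed

lemma TW_induct [consumes 1, case_names zero add scale add_left add_right scale_left scale_right balanced]:
  assumes "t \<in> TW" "Q 0" "\<And>t u. Q t \<Longrightarrow> Q u \<Longrightarrow> Q (t + u)" "\<And>c t. Q t \<Longrightarrow> Q (pm_scale c t)"
    "\<And>f f' v. Q (pair (f + f') v - pair f v - pair f' v)"
    "\<And>f v v'. Q (pair f (v + v') - pair f v - pair f v')"
    "\<And>c f v. Q (pair (pm_scale c f) v - pm_scale c (pair f v))"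
    "\<And>c f v. Q (pair f (pm_scale c v) - pm_scale c (pair f v))"
    "\<And>f a v. Q (pair (f * emb a) v - pair f (ev pm_scale E.twad a v))"
  shows "Q t"
  using assms(1) unfolding tensor_subspace_def
proof (rule module.span_induct[OF module_pm])
  show "module.subspace pm_scale {t. Q t}"
    using assms(2-4) by (auto simp: module.subspace_def[OF module_pm])
qed (unfold tensor_relations_eq, use assms(5-9) in blast)

text \<open>The tensor product of the definition is a quotient of the free space on pairs of classes, the one used
  above a quotient of the free space on pairs of words. The map \<open>of_words\<close> takes the classes of words,
  and \<open>to_words\<close> chooses representatives of classes; modulo the respective relations they are inverse
  to each other.\<close>

definition of_words :: "('k, 'g) fa2 \<Rightarrow> ('k, 'g) env_pairs" where
  "of_words = lift pm_scale pair"

lemma of_words_lin: "lin pm_scale pm_scale of_words"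
  unfolding of_words_def by (rule lift_lin[OF module_pm])

lemmas of_words_simps = lin_simps[OF of_words_lin]

lemma of_words_single: "of_words (Poly_Mapping.single (a, b) 1) = pair (Poly_Mapping.single a 1) (Poly_Mapping.single b 1)"
  by (simp add: of_words_def lift_def module_pm)

text \<open>Both terms are bilinear modulo the relations and agree on words.\<close>

lemma pair_of_words: "pair f v - of_words (ten f v) \<in> TW"
proof (induction f rule: pm_induct)
  case zero
  show ?case using TW_rel(3)[of 0 0 v] by (simp add: ten_simps of_words_simps del: pm_scale_single)
next
  case (add t u)
  have "(pair (t + u) v - pair t v - pair u v) + (pair t v - of_words (ten t v)) + (pair u v - of_words (ten u v)) \<in> TW"
    by (intro TW_add TW_rel add)
  then show ?case by (simp add: ten_simps of_words_simps algebra_simps)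
next
  case (scale c t)
  have "(pair (pm_scale c t) v - pm_scale c (pair t v)) + pm_scale c (pair t v - of_words (ten t v)) \<in> TW"
    by (intro TW_add TW_rel TW_scale scale)
  then show ?case by (simp add: ten_simps of_words_simps pm_scale_distribs del: pm_scale_single)
next
  case (single a)
  let ?f = "Poly_Mapping.single a (1 :: 'k)"
  show ?case
  proof (induction v rule: pm_induct)
    case zero
    show ?case using TW_rel(4)[of ?f 0 0] by (simp add: ten_simps of_words_simps del: pm_scale_single)
  next
    case (add t u)
    have "(pair ?f (t + u) - pair ?f t - pair ?f u) + (pair ?f t - of_words (ten ?f t)) + (pair ?f u - of_words (ten ?f u)) \<in> TW"
      by (intro TW_add TW_rel add)
    then show ?case by (simp add: ten_simps of_words_simps algebra_simps)
  next
    case (scale c t)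
    have "(pair ?f (pm_scale c t) - pm_scale c (pair ?f t)) + pm_scale c (pair ?f t - of_words (ten ?f t)) \<in> TW"
      by (intro TW_add TW_rel TW_scale scale)
    then show ?case by (simp add: ten_simps of_words_simps pm_scale_distribs del: pm_scale_single)
  next
    case (single b)
    show ?case using TW_0 by (simp add: of_words_single)
  qed
qed

lemma pair_cong: "env f = env f' \<Longrightarrow> even.env v = even.env v' \<Longrightarrow> pair f v = pair f' v'"
  by (simp add: U.cl_eq[symmetric] E.U.cl_eq[symmetric])

lemma of_words_ten_cong:
  assumes "pair f v - pair f' v' \<in> TW"
  shows "of_words (ten f v) - of_words (ten f' v') \<in> TW"
proof -
  have "(pair f v - pair f' v') - (pair f v - of_words (ten f v)) + (pair f' v' - of_words (ten f' v')) \<in> TW"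
    by (intro TW_add TW_diff pair_of_words assms)
  then show ?thesis by (simp add: algebra_simps)
qed

lemma of_words_W: "t \<in> W \<Longrightarrow> of_words t \<in> TW"
  unfolding W_def
proof (erule module.span_induct[OF module_pm])
  show "module.subspace pm_scale {t. of_words t \<in> TW}"
    by (auto simp: module.subspace_def[OF module_pm] of_words_simps TW_0 TW_add TW_scale)
  fix r assume "r \<in> ind_rels"
  then consider j v where "r = ten j v" "j \<in> J" | f j where "r = ten f j" "j \<in> even.J" |
    f v z where "r = ten (f * letter z) v - ten f (ad0 z v)" "pr 0 z = z"
    unfolding ind_rels_def by blast
  then show "of_words r \<in> TW"
  proof cases
    case 1
    then have "pair j v = pair 0 v" by (intro pair_cong) (simp_all add: env_eq_0_iff env_simps)
    then show ?thesis using of_words_ten_cong[of j v 0 v] TW_0 1 by (simp add: ten_simps of_words_simps)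
  next
    case 2
    then have "pair f j = pair f 0" by (intro pair_cong) (simp_all add: even.env_eq_0_iff even.env_simps)
    then show ?thesis using of_words_ten_cong[of f j f 0] TW_0 2 by (simp add: ten_simps of_words_simps)
  next
    case 3
    have "E.cls (even.env (ad0 z v)) = E.cls (ad0 z v)"
      by (simp add: E.U.cl_eq)
    then have "pair (f * letter z) v - pair f (ad0 z v) \<in> TW"
      using TW_rel(5)[of f "letter z" v] 3(2) by (simp add: E_twad)
    from of_words_ten_cong[OF this] show ?thesis unfolding 3 by (simp add: of_words_simps)
  qed
qed

definition to_words :: "('k, 'g) env_pairs \<Rightarrow> ('k, 'g) fa2" where
  "to_words = lin_ext pm_scale (\<lambda>(A, B). ind (ten (SOME f. cls f = A) (SOME v. E.cls v = B)))"

lemma to_words_lin: "lin pm_scale pm_scale to_words"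
  unfolding to_words_def by (rule lin_ext_lin[OF module_pm])

lemmas to_words_simps = lin_simps[OF to_words_lin]

lemma tens_cong: "env f = env f' \<Longrightarrow> even.env v = even.env v' \<Longrightarrow> tens f v = tens f' v'"
proof -
  assume "env f = env f'" and v: "even.env v = even.env v'"
  then have "tens f v = tens f' v" by (intro ind_ten_cong)
  moreover have "tens f' (v - v') = 0" using v by (intro tens_eq_0(2)) (simp add: even.env_eq_iff)
  ultimately show ?thesis by (simp add: tens_simps)
qed

lemma to_words_pair: "to_words (pair f v) = tens f v"
proof -
  have "cls (SOME f'. cls f' = cls f) = cls f" "E.cls (SOME v'. E.cls v' = E.cls v) = E.cls v"
    by (rule someI[of _ f] someI[of _ v]; simp)+
  then have "tens (SOME f'. cls f' = cls f) (SOME v'. E.cls v' = E.cls v) = tens f v"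
    unfolding U.cl_eq E.U.cl_eq by (rule tens_cong)
  then show ?thesis
    unfolding to_words_def lin_ext_single_1[OF module_pm] prod.case .
qed

lemma tens_ev_twad: "tens (f * emb a) v = tens f (ev pm_scale E.twad a v)"
proof (induction a arbitrary: f rule: fa_induct)
  case (letter x a)
  have "tens (f * emb (letter x * a)) v = tens ((f * letter (pr 0 x)) * emb a) v"
    by (simp add: map_fa_letter_mult mult.assoc)
  also have "\<dots> = tens f (ad0 (pr 0 x) (ev pm_scale E.twad a v))"
    unfolding letter by (rule tens_balanced) simp
  also have "\<dots> = tens f (ev pm_scale E.twad (letter x * a) v)"
    by (intro tens_cong) (simp_all add: E.tw.ev_letter_mult E_twad_pr[of x] E_twad)
  finally show ?case .
qed (simp_all add: map_fa_simps E.tw.ev_simps tens_simps algebra_simps pm_scale_mult)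

lemma to_words_TW: "t \<in> TW \<Longrightarrow> to_words t = 0"
  by (induction t rule: TW_induct)
    (simp_all add: to_words_simps to_words_pair tens_simps tens_ev_twad del: pm_scale_single)

lemma to_words_of_words: "to_words (of_words t) = ind t"
  by (rule pm_lin_eqI[OF lin_comp[OF of_words_lin to_words_lin] ind_lin])
    (auto simp: of_words_single to_words_pair)

lemma PB_cases:
  assumes "b \<in> PB"
  obtains f v where "b = (cls f, E.cls v)"
  using assms by (auto simp: U.carrier_eq V.carrier_eq)

lemma pm_induct_keys [consumes 1, case_names zero add scale single]:
  assumes "Poly_Mapping.keys t \<subseteq> B" "Q 0" "\<And>t u. Q t \<Longrightarrow> Q u \<Longrightarrow> Q (t + u)" "\<And>c t. Q t \<Longrightarrow> Q (pm_scale c t)"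
    "\<And>b. b \<in> B \<Longrightarrow> Q (Poly_Mapping.single b 1)"
  shows "Q t"
  by (rule pm_induct[of Q t]) (use assms in auto)

lemma ind_of_words: "ind (s - t) = 0 \<Longrightarrow> of_words s - of_words t \<in> TW"
  using of_words_W[of "s - t"] by (simp add: ind_eq_0_iff of_words_simps)

lemma of_words_to_words:
  assumes "Poly_Mapping.keys t \<subseteq> PB"
  shows "t - of_words (to_words t) \<in> TW"
  using assms
proof (induction t rule: pm_induct_keys)
  case (add t u)
  then show ?case using TW_add[of "t - of_words (to_words t)" "u - of_words (to_words u)"]
    by (simp add: to_words_simps of_words_simps algebra_simps)
next
  case (scale c t)
  then show ?case using TW_scale[of "t - of_words (to_words t)" c]
    by (simp add: to_words_simps of_words_simps pm_scale_distribs)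
next
  case (single b)
  obtain f v where b: "b = (cls f, E.cls v)" using PB_cases[OF single] .
  have "of_words (ten f v) - of_words (tens f v) \<in> TW"
    by (rule ind_of_words) (simp add: ind_simps)
  from TW_add[OF pair_of_words[of f v] this] show ?case
    by (simp add: b to_words_pair)
qed (simp add: to_words_simps of_words_simps TW_0)

end

context lie_induced
begin

interpretation V: presented V pm_scale even.env E.cls
  by (rule V_presented)

abbreviation "carP \<equiv> {t :: ('k, 'g) env_elem \<times> ('k, 'g) env_elem \<Rightarrow>\<^sub>0 'k. Poly_Mapping.keys t \<subseteq> PB}"

lemma keys_subset_iff: "Poly_Mapping.keys t \<subseteq> B \<longleftrightarrow> (\<forall>b. b \<notin> B \<longrightarrow> Poly_Mapping.lookup t b = 0)"
  by (auto simp: in_keys_iff)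

lemma keys_closed:
  "Poly_Mapping.keys t \<subseteq> B \<Longrightarrow> Poly_Mapping.keys u \<subseteq> B \<Longrightarrow> Poly_Mapping.keys (t + u) \<subseteq> B"
  "Poly_Mapping.keys (t :: 'b \<Rightarrow>\<^sub>0 'k) \<subseteq> B \<Longrightarrow> Poly_Mapping.keys (pm_scale c t) \<subseteq> B"
  "Poly_Mapping.keys (t :: 'b \<Rightarrow>\<^sub>0 'k) \<subseteq> B \<Longrightarrow> Poly_Mapping.keys u \<subseteq> B \<Longrightarrow> Poly_Mapping.keys (t - u) \<subseteq> B"
  by (auto simp: keys_subset_iff lookup_add lookup_minus)

lemma keys_pair: "Poly_Mapping.keys (pair f v) \<subseteq> PB"
  by (auto simp: U.carrier_eq V.carrier_eq)

lemma TW_carP: "t \<in> TW \<Longrightarrow> Poly_Mapping.keys t \<subseteq> PB"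
  by (induction t rule: TW_induct) (simp, (rule keys_closed keys_pair | assumption)+)

lemma of_words_carP: "Poly_Mapping.keys (of_words t) \<subseteq> PB"
proof (induction t rule: pm_induct)
  case (single b)
  obtain w w' where b: "b = (w, w')" by (cases b)
  show ?case unfolding b of_words_single by (rule keys_pair)
qed (simp_all only: of_words_simps keys_closed keys_zero empty_subsetI)

lemma of_words_TW_iff: "of_words t \<in> TW \<longleftrightarrow> ind t = 0"
  using of_words_W[of t] to_words_TW[of "of_words t"] by (auto simp: to_words_of_words ind_eq_0_iff)

sublocale fp: free_quotient FP PB TW
  by standard (simp_all add: subspace_TW free_space_def)

definition clsP :: "('k, 'g) fa2 \<Rightarrow> ('k, 'g) env_pairs set" where
  "clsP t = coset TW (of_words t)"

abbreviation "HP \<equiv> \<lambda>p. \<Union>q. gpart U q \<times> gpart V (p + q)"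
abbreviation "N \<equiv> induced_module L V"

lemma presented_tensor: "presented (super_quotient FP TW HP) pm_scale ind clsP"
  unfolding clsP_def[abs_def]
proof (rule fp.presented_Q[OF ind_lin _ of_words_lin])
  show "range of_words \<subseteq> carP" using of_words_carP by blast
  show "\<exists>u. f - of_words u \<in> TW" if "Poly_Mapping.keys f \<subseteq> PB" for f
    using of_words_to_words[OF that] by blast
qed (rule of_words_TW_iff)

lemma N_fields: "carrier N = carrier (super_quotient FP TW HP)" "\<zero>\<^bsub>N\<^esub> = \<zero>\<^bsub>super_quotient FP TW HP\<^esub>"
  "add N = add (super_quotient FP TW HP)" "module.smult N = module.smult (super_quotient FP TW HP)"
  "gpart N p = gpart (super_quotient FP TW HP) p"
  by (simp_all add: induced_module_def tensor_product_def Let_def superspace.defs)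

lemma presented_induced: "presented N pm_scale ind clsP"
  using presented_tensor unfolding presented_def N_fields .

definition mulP :: "'g \<Rightarrow> ('k, 'g) env_pairs \<Rightarrow> ('k, 'g) env_pairs" where
  "mulP x = lin_ext pm_scale (\<lambda>(u, v). Poly_Mapping.single (env_embed L x \<otimes>\<^bsub>U\<^esub> u, v) 1)"

lemma act_N: "act N x T = (\<Union>t\<in>T. coset TW (mulP x t))"
proof -
  have "(\<Sum>(u, v)\<in>Poly_Mapping.keys t. Poly_Mapping.single (env_embed L x \<otimes>\<^bsub>U\<^esub> u, v) (Poly_Mapping.lookup t (u, v))) = mulP x t" for t
    unfolding mulP_def lin_ext_def by (intro sum.cong refl) (auto split: prod.split)
  then show ?thesis
    unfolding induced_module_def Let_def by (simp add: superspace.defs fp.r_coset)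
qed

text \<open>It suffices to compare on a pair of classes, where both sides are the class of \<open>x f \<otimes> v\<close>.\<close>

lemma mulP_words:
  assumes "x \<in> lcarrier L" "Poly_Mapping.keys t \<subseteq> PB"
  shows "mulP x t - of_words (iact x (to_words t)) \<in> TW"
proof -
  have "lin pm_scale pm_scale (mulP x)" unfolding mulP_def by (rule lin_ext_lin[OF module_pm])
  note l = lin_simps[OF this]
  show ?thesis
    using assms(2)
  proof (induction t rule: pm_induct_keys)
    case (add t u)
    then show ?case using TW_add[of "mulP x t - of_words (iact x (to_words t))" "mulP x u - of_words (iact x (to_words u))"]
      by (simp add: l to_words_simps of_words_simps act_simps algebra_simps)
  next
    case (scale c t)
    then show ?case using TW_scale[of "mulP x t - of_words (iact x (to_words t))" c]
      by (simp add: l to_words_simps of_words_simps act_simps pm_scale_distribs)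
  next
    case (single b)
    obtain f v where b: "b = (cls f, E.cls v)" using PB_cases[OF single] .
    have m: "mulP x (pair f v) = pair (letter x * f) v"
      unfolding mulP_def lin_ext_single_1[OF module_pm] by (simp add: env_embed_cls[OF assms(1)] mult_cls)
    have "of_words (ten (letter x * f) v) - of_words (tens (letter x * f) v) \<in> TW"
      by (rule ind_of_words) (simp add: ind_simps)
    from TW_add[OF pair_of_words[of "letter x * f" v] this] show ?case
      unfolding b m to_words_pair act_tens by simp
  qed (simp add: l to_words_simps of_words_simps act_simps TW_0)
qed

lemma act_induced:
  assumes x: "x \<in> lcarrier L"
  shows "act N x (clsP s) = clsP (iact x s)"
proof -
  have "coset TW (mulP x t) = clsP (iact x s)" if t: "t \<in> clsP s" for t
  proof -
    obtain w where w: "w \<in> TW" "t = w + of_words s" using t unfolding clsP_def coset_def by blast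
    have k: "Poly_Mapping.keys t \<subseteq> PB"
      unfolding w(2) by (intro keys_closed TW_carP[OF w(1)] of_words_carP)
    have "to_words t = ind s"
      by (simp add: w(2) to_words_simps to_words_TW[OF w(1)] to_words_of_words)
    then show ?thesis
      using mulP_words[OF x k] unfolding clsP_def coset_eq_iff[OF subspace_TW] by (simp add: act_ind)
  qed
  moreover have "of_words s \<in> clsP s" unfolding clsP_def by (rule self_coset[OF subspace_TW])
  ultimately show ?thesis unfolding act_N by blast
qed

section \<open>The grading of the induced module\<close>

text \<open>As \<open>V\<close> is even, the parity automorphism acts on the first factor.\<close>

definition parP :: "('k, 'g) fa2 \<Rightarrow> ('k, 'g) fa2" where
  "parP = lift pm_scale (\<lambda>f v. ten (par f) v)"

lemma parP_lin: "lin pm_scale pm_scale parP"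
  unfolding parP_def by (rule lift_lin[OF module_pm])

lemmas parP_simps = lin_simps[OF parP_lin]

lemma parP_ten: "parP (ten f v) = ten (par f) v"
  unfolding parP_def
  by (rule lift_ten[OF module_pm]) (rule lin_comp[OF map_fa_lin ten_lin_left] ten_lin_right)+

lemma ind_parP_ind: "ind (parP (ind t)) = ind (parP t)"
proof (rule lin_ind[OF lin_comp[OF parP_lin ind_lin]], erule lin_W[OF lin_comp[OF parP_lin ind_lin], rotated -1])
  show "ind (parP (ten j v)) = 0" if "j \<in> J" for j v
    using par_J[OF that] by (simp add: parP_ten tens_eq_0)
  show "ind (parP (ten f j)) = 0" if "j \<in> even.J" for f j
    using that by (simp add: parP_ten tens_eq_0)
  show "ind (parP (ten (f * letter z) v)) = ind (parP (ten f (ad0 z v)))" if "pr 0 z = z" for f v z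
    using that by (simp add: parP_ten map_fa_mult sigma_hom[OF that] tens_balanced)
qed

lemma ind_parP_0: "ind u = 0 \<Longrightarrow> ind (parP u) = 0"
  using ind_parP_ind[of u] by (simp add: parP_simps ind_simps)

lemma parP_parP: "ind (parP (parP t)) = ind t"
  by (rule ten_lin_eqI[OF lin_comp[OF lin_comp[OF parP_lin parP_lin] ind_lin] ind_lin])
    (simp add: parP_ten ind_ten_cong[OF par_par])

lemma parP_act:
  assumes "pr p x = x"
  shows "ind (parP (iact x t)) = sg p 1 (iact x (parP t))"
proof (rule ten_lin_eqI[OF lin_comp[OF lin_comp[OF act_lin parP_lin] ind_lin]])
  show "lin pm_scale pm_scale (\<lambda>t. sg p 1 (iact x (parP t)))"
    by (intro linI module_pm) (simp_all add: sg_def parP_simps act_simps)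
  fix f v
  have "env (letter (sigma x) * par f) = env (sg p 1 (letter x * par f))"
    unfolding env_letter_sigma[OF assms] by (simp add: sg_def env_simps)
  then have "tens (letter (sigma x) * par f) v = tens (sg p 1 (letter x * par f)) v"
    by (rule ind_ten_cong)
  then show "ind (parP (iact x (ten f v))) = sg p 1 (iact x (parP (ten f v)))"
    by (simp add: act_ten ind_parP_ind parP_ten map_fa_letter_mult) (simp add: sg_def tens_simps)
qed

text \<open>The odd part of \<open>V\<close> is \<open>0\<close>.\<close>

lemma gpart_V: "gpart V r = {E.cls v |v. r = 0 \<or> even.env v = 0}"
proof -
  have e: "even.env (map_fa even.sigma v) = even.env v" for v
    using E.env_kappa[of v] by (simp add: E_proj E_sigma)
  have z: "even.env v = - even.env v \<longleftrightarrow> even.env v = 0" for v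
    using pm_double_0[of "even.env v"] by (auto simp: eq_neg_iff_add_eq_0)
  show ?thesis
    unfolding adjoint_def E.gpart_twisted e by (cases r) (simp_all add: z)
qed

text \<open>In one direction it suffices to look at a pair of homogeneous classes. In the other, a vector with
  \<open>\<sigma> u = \<plusminus>u\<close> is \<open>(u \<plusminus> \<sigma> u)/2\<close>, and \<open>a \<plusminus> \<sigma> a\<close> is homogeneous for each word \<open>a\<close> in the first factor.\<close>

lemma gpart_induced: "gpart N p = {clsP u |u. ind (parP u) = sg p 1 (ind u)}"
proof -
  have HP: "HP p \<subseteq> PB"
    unfolding gpart_cls gpart_V by (auto simp: U.carrier_eq V.carrier_eq)
  have g: "gpart N p = coset TW ` {t. Poly_Mapping.keys t \<subseteq> HP p}"
    unfolding N_fields by (rule fp.gpart_Q)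
  show ?thesis
    unfolding g
  proof (intro equalityI subsetI)
    fix A assume "A \<in> coset TW ` {t. Poly_Mapping.keys t \<subseteq> HP p}"
    then obtain t where t: "Poly_Mapping.keys t \<subseteq> HP p" "A = coset TW t" by blast
    have "ind (parP (to_words t)) = sg p 1 (ind (to_words t))"
      using t(1)
    proof (induction t rule: pm_induct_keys)
      case (single b)
      then obtain q f v where b: "b = (cls f, E.cls v)" "env (par f) = sg q 1 (env f)" "p + q = 0 \<or> even.env v = 0"
        unfolding gpart_cls gpart_V by blast
      have "tens (par f) v = sg p 1 (tens f v)"
      proof (cases "p + q = 0")
        case True
        then have "p = q" by (cases p; cases q) simp_all
        then have "env (par f) = env (sg p 1 f)" using b(2) by (simp add: sg_def env_simps)
        then have "tens (par f) v = tens (sg p 1 f) v" by (rule ind_ten_cong)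
        then show ?thesis by (simp add: sg_def tens_simps)
      next
        case False
        then have "v \<in> even.J" using b(3) by (simp add: even.env_eq_0_iff)
        then show ?thesis by (simp add: tens_eq_0 sg_def)
      qed
      then show ?case unfolding b(1) to_words_pair by (simp add: ind_parP_ind parP_ten)
    qed (simp_all add: to_words_simps parP_simps ind_simps sg_def)
    moreover have "A = clsP (to_words t)"
      unfolding t(2) clsP_def coset_eq_iff[OF subspace_TW]
      using of_words_to_words t(1) HP by blast
    ultimately show "A \<in> {clsP u |u. ind (parP u) = sg p 1 (ind u)}" by blast
  next
    fix A assume "A \<in> {clsP u |u. ind (parP u) = sg p 1 (ind u)}"
    then obtain u where u: "A = clsP u" "ind (parP u) = sg p 1 (ind u)" by blast
    define hw :: "'g tword \<Rightarrow> ('k, 'g) fa" where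
      "hw a = Poly_Mapping.single a 1 + sg p 1 (par (Poly_Mapping.single a 1))" for a
    define T where "T = lin_ext pm_scale (\<lambda>(a, b). pair (hw a) (Poly_Mapping.single b 1))"
    have T: "lin pm_scale pm_scale T" unfolding T_def by (rule lin_ext_lin[OF module_pm])
    have Ts: "T (Poly_Mapping.single (a, b) 1) = pair (hw a) (Poly_Mapping.single b 1)" for a b
      unfolding T_def lin_ext_single_1[OF module_pm] by simp
    have keysT: "Poly_Mapping.keys (T t) \<subseteq> HP p" for t
    proof (induction t rule: pm_induct)
      case (single b)
      obtain a c where b: "b = (a, c)" by (cases b)
      have "env (par (hw a)) = sg p 1 (env (hw a))"
        by (cases p) (simp_all add: hw_def map_fa_simps env_simps par_par)
      then have "cls (hw a) \<in> gpart U p" unfolding gpart_cls by blast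
      moreover have "E.cls (Poly_Mapping.single c 1) \<in> gpart V (p + p)"
        unfolding gpart_V by (cases p) auto
      ultimately have "(cls (hw a), E.cls (Poly_Mapping.single c 1)) \<in> HP p" by blast
      then show ?case
        unfolding b Ts by (simp only: keys_single one_neq_zero if_False insert_subset empty_subsetI simp_thms)
    qed (simp_all only: lin_simps[OF T] keys_closed keys_zero empty_subsetI)
    have approx: "T t - of_words (t + sg p 1 (parP t)) \<in> TW" for t
    proof (induction t rule: pm_induct)
      case (add t u)
      from TW_add[OF add] show ?case
        by (cases p) (simp_all add: lin_simps[OF T] of_words_simps parP_simps algebra_simps)
    next
      case (scale c t)
      from TW_scale[OF scale] show ?case
        by (cases p) (simp_all add: lin_simps[OF T] of_words_simps parP_simps pm_scale_distribs)
    next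
      case (single b)
      obtain a c where b: "b = (a, c)" by (cases b)
      have "Poly_Mapping.single (a, c) (1 :: 'k) = ten (Poly_Mapping.single a 1) (Poly_Mapping.single c 1)" by simp
      then have "Poly_Mapping.single b 1 + sg p 1 (parP (Poly_Mapping.single b 1)) = ten (hw a) (Poly_Mapping.single c 1)"
        unfolding b hw_def by (simp only: parP_ten) (simp add: sg_def ten_simps del: ten_single)
      then show ?case
        using pair_of_words[of "hw a" "Poly_Mapping.single c 1"] unfolding b Ts by (simp only:)
    qed (simp add: lin_simps[OF T] of_words_simps parP_simps sg_def TW_0)
    let ?h = "1/2 :: 'k"
    have two: "pm_scale ?h t + pm_scale ?h t = t" for t :: "'g tword \<times> 'g tword \<Rightarrow>\<^sub>0 'k"
      by (simp flip: pm_scale_distribs(2))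
    have "ind (u - pm_scale ?h (u + sg p 1 (parP u))) = 0"
      using u(2) two[of "ind u"] by (cases p) (simp_all add: ind_simps pm_scale_distribs)
    then have "of_words (u - pm_scale ?h (u + sg p 1 (parP u))) \<in> TW" by (simp add: of_words_TW_iff)
    from TW_diff[OF this TW_scale[OF approx[of u], of ?h]]
    have "of_words u - T (pm_scale ?h u) \<in> TW"
      by (simp add: of_words_simps lin_simps[OF T] pm_scale_distribs algebra_simps)
    then have "A = coset TW (T (pm_scale ?h u))"
      unfolding u(1) clsP_def coset_eq_iff[OF subspace_TW] .
    then show "A \<in> coset TW ` {t. Poly_Mapping.keys t \<subseteq> HP p}" using keysT by blast
  qed
qed

lemma lie_module_induced: "lie_module L N"
  by (rule lie_moduleI[OF presented_induced super_rep_act parP_lin ind_parP_0 parP_parP gpart_induced act_induced])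
    (simp_all add: parP_act lpart_iff)

section \<open>The isomorphism\<close>

lemma from_ind_parP: "from_ind (parP t) = env (par (from_ind t))"
proof (rule ten_lin_eqI[OF lin_comp[OF parP_lin from_ind_lin] lin_comp[OF lin_comp[OF from_ind_lin map_fa_lin] env_lin]])
  fix f v
  have t: "twad (sigma x) (par u) = env (par (twad x u))" for x u
  proof -
    have "env (par (twad x u)) = env (par (twad (pr 0 x) u)) + env (par (twad (pr 1 x) u))"
      by (subst twad_pr) (simp add: map_fa_simps env_simps)
    then show ?thesis
      by (simp add: twad_par[OF pr_pr_same] sigma_def lin_simps[OF twad_lin_left])
  qed
  have "ev pm_scale twad (par f) (env (emb v)) = env (par (ev pm_scale twad f (env (emb v))))"
  proof (induction f rule: fa_induct)
    case one
    show ?case by (simp add: par_env par_emb)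
  next
    case (letter x f)
    then show ?case by (simp add: map_fa_letter_mult tw.ev_letter_mult t)
  qed (simp_all add: map_fa_simps tw.ev_simps env_simps)
  then show "from_ind (parP (ten f v)) = env (par (from_ind (ten f v)))"
    by (simp add: parP_ten from_ind_ten)
qed

lemma ind_to_ind: "ind (to_ind u) = to_ind u"
  using to_ind_from_ind[of "to_ind u"] by (simp add: from_ind_to_ind to_ind_env)

text \<open>The inverse of a bijection that commutes with the parity automorphisms commutes with them as well.\<close>

lemma parP_to_ind:
  assumes "env (par u) = sg p 1 (env u)"
  shows "ind (parP (to_ind u)) = sg p 1 (ind (to_ind u))"
proof -
  have "from_ind (parP (to_ind u)) = sg p 1 (env u)"
    using assms by (simp add: from_ind_parP from_ind_to_ind par_env)
  then have "ind (parP (to_ind u)) = to_ind (sg p 1 (env u))"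
    using to_ind_from_ind[of "parP (to_ind u)"] by simp
  then show ?thesis by (simp add: sg_def to_ind_simps to_ind_env ind_to_ind)
qed

lemma isomorphic: "lie_module_isomorphic L (twisted_adjoint L \<phi>) N"
proof -
  interpret M: presented "twisted_adjoint L \<phi>" pm_scale env cls by (rule presented_twisted)
  interpret N: presented N pm_scale ind clsP by (rule presented_induced)
  define f where "f A = clsP (to_ind (SOME u. cls u = A))" for A
  have f: "f (cls u) = clsP (to_ind u)" for u
  proof -
    have "cls (SOME u'. cls u' = cls u) = cls u" by (rule someI[of _ u]) simp
    then have "env (SOME u'. cls u' = cls u) = env u" by (simp add: M.cl_eq)
    then show ?thesis unfolding f_def using to_ind_env by metis
  qed
  have "f \<in> lie_module_iso L (twisted_adjoint L \<phi>) N"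
    unfolding lie_module_iso_def
  proof (intro CollectI conjI ballI allI)
    show "bij_betw f (carrier (twisted_adjoint L \<phi>)) (carrier N)"
      unfolding M.carrier_eq N.carrier_eq
    proof (rule bij_betw_imageI)
      show "inj_on f (range cls)"
      proof (rule inj_onI, elim rangeE, hypsubst)
        fix u v assume "f (cls u) = f (cls v)"
        then have "ind (to_ind u) = ind (to_ind v)" by (simp add: f N.cl_eq)
        then have "from_ind (to_ind u) = from_ind (to_ind v)" using from_ind_ind by metis
        then show "cls u = cls v" by (simp add: from_ind_to_ind M.cl_eq)
      qed
      have "clsP t = f (cls (from_ind t))" for t
        by (simp add: f N.cl_eq to_ind_from_ind)
      then have "clsP t \<in> f ` range cls" for t by blast
      then show "f ` range cls = range clsP" using f by auto
    qed
    show "f (A \<oplus>\<^bsub>twisted_adjoint L \<phi>\<^esub> B) = f A \<oplus>\<^bsub>N\<^esub> f B"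
      if "A \<in> carrier (twisted_adjoint L \<phi>)" "B \<in> carrier (twisted_adjoint L \<phi>)" for A B
      using that by (auto simp: M.carrier_eq M.add_cl N.add_cl f to_ind_simps)
    show "f (c \<odot>\<^bsub>twisted_adjoint L \<phi>\<^esub> A) = c \<odot>\<^bsub>N\<^esub> f A" if "A \<in> carrier (twisted_adjoint L \<phi>)" for c A
      using that by (auto simp: M.carrier_eq M.smult_cl N.smult_cl f to_ind_simps)
    show "f ` gpart (twisted_adjoint L \<phi>) p \<subseteq> gpart N p" for p
      unfolding gpart_twisted gpart_induced using parP_to_ind by (auto simp: f)
    show "f (act (twisted_adjoint L \<phi>) x A) = act N x (f A)"
      if "x \<in> lcarrier L" "A \<in> carrier (twisted_adjoint L \<phi>)" for x A
      using that by (auto simp: M.carrier_eq act_twisted_adjoint act_induced f to_ind_twad)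
  qed
  then show ?thesis
    unfolding lie_module_isomorphic_def using lie_module_twisted lie_module_induced by blast
qed

end

text \<open>Modulo \<open>B\<close> the subspace \<open>A\<close> embeds, so the quotient map has a left inverse on it.\<close>

lemma exists_projection:
  fixes s :: "'k::field \<Rightarrow> 'v::ab_group_add \<Rightarrow> 'v"
  assumes "vector_space s" and A: "module.subspace s A" and B: "module.subspace s B" and "A \<inter> B = {0}"
  shows "\<exists>f. lin s s f \<and> range f \<subseteq> A \<and> (\<forall>x\<in>A. f x = x) \<and> (\<forall>x\<in>B. f x = 0)"
proof -
  interpret vector_space s by fact
  interpret p: vector_space_pair s s ..
  obtain n where n: "lin s s n" "\<And>x. n x = 0 \<longleftrightarrow> x \<in> B"
    using exists_linear_quotient[OF assms(1) B] by blast
  have "inj_on n A"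
  proof (rule inj_onI)
    fix x y assume "x \<in> A" "y \<in> A" "n x = n y"
    then have "x - y \<in> A \<inter> B" using n(2)[of "x - y"] subspace_diff[OF A] by (simp add: lin_diff[OF n(1)])
    then show "x = y" using assms(4) by simp
  qed
  moreover have nl: "Vector_Spaces.linear s s n"
    using n(1) by (simp add: Vector_Spaces.linear_def vector_space_axioms)
  ultimately obtain g where g: "range g \<subseteq> A" "Vector_Spaces.linear s s g" "\<forall>v\<in>A. g (n v) = v"
    using p.linear_exists_left_inverse_on[OF nl A] by blast
  have gl: "lin s s g" using g(2) by (simp add: Vector_Spaces.linear_def)
  have "g (n x) = 0" if "x \<in> B" for x using n(2)[of x] that lin_zero[OF gl] by simp
  then show ?thesis
    using g lin_comp[OF n(1) gl] by (intro exI[of _ "\<lambda>x. g (n x)"]) auto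
qed

text \<open>An injective endomorphism of a space of finite dimension is onto: otherwise the image of a basis could be
  enlarged to an independent set with too many elements.\<close>

lemma exists_inverse_on_subspace:
  fixes s :: "'k::field \<Rightarrow> 'v::ab_group_add \<Rightarrow> 'v"
  assumes "vector_space s" and S: "module.subspace s S" and h: "lin s s h" "h ` S \<subseteq> S" "inj_on h S"
    and B: "finite B" "S \<subseteq> module.span s B"
  shows "\<exists>g. lin s s g \<and> range g \<subseteq> S \<and> (\<forall>x\<in>S. h (g x) = x) \<and> (\<forall>x\<in>S. g (h x) = x)"
proof -
  interpret vector_space s by fact
  interpret p: vector_space_pair s s ..
  have hl: "Vector_Spaces.linear s s h"
    using h(1) by (simp add: Vector_Spaces.linear_def vector_space_axioms)
  obtain C where C: "C \<subseteq> S" "independent C" "S \<subseteq> span C"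
    by (rule basis_exists[of S])
  have fC: "finite C" using independent_span_bound[OF B(1) C(2)] C(1) B(2) by blast
  have sC: "span C = S" using C S by (metis span_minimal subset_antisym)
  have inj: "inj_on h (span C)" using h(3) by (simp only: sC)
  then have iC: "independent (h ` C)" by (rule p.linear_independent_injective_image[OF hl C(2)])
  have "h ` S = S"
  proof (rule ccontr)
    assume "h ` S \<noteq> S"
    then obtain x where x: "x \<in> S" "x \<notin> h ` S" using h(2) by blast
    have "span (h ` C) = h ` S" using p.linear_span_image[OF hl, of C] sC by simp
    then have "x \<notin> span (h ` C)" using x(2) by simp
    then have ins: "independent (insert x (h ` C))" and "x \<notin> h ` C"
      using iC independent_insertI[of x "h ` C"] span_base[of x "h ` C"] by blast+
    have "insert x (h ` C) \<subseteq> span C" using x(1) h(2) C(1) sC by blast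
    then have "card (insert x (h ` C)) \<le> card C"
      using independent_span_bound[OF fC ins] by blast
    moreover have "card (h ` C) = card C"
      by (rule card_image) (rule inj_on_subset[OF h(3) C(1)])
    moreover have "card (insert x (h ` C)) = Suc (card (h ` C))"
      using fC \<open>x \<notin> h ` C\<close> by (intro card_insert_disjoint) auto
    ultimately show False by linarith
  qed
  moreover obtain g where g: "range g \<subseteq> S" "Vector_Spaces.linear s s g" "\<forall>v\<in>h ` S. h (g v) = v"
    using p.linear_exists_right_inverse_on[OF hl S] by blast
  moreover have "g (h x) = x" if "x \<in> S" for x
  proof (rule inj_onD[OF h(3) _ _ that])
    show "h (g (h x)) = h x" using g(3) that by blast
    show "g (h x) \<in> S" using g(1) by blast
  qed
  ultimately show ?thesis
    by (intro exI[of _ g]) (auto simp: Vector_Spaces.linear_def)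
qed

theorem theorem1p8:
  fixes L :: "('k::{alg_closed_field, field_char_0}, 'g::ab_group_add) lie_super"
    and \<phi> :: "'g \<Rightarrow> 'g"
  assumes "lie_superalgebra L"
    and "finite_dimensional L"
    and "lie_automorphism L \<phi>"
    and "\<forall>x\<in>lpart L 0. \<phi> x = x"
    and "\<forall>x\<in>lcarrier L. \<phi> x = x \<longrightarrow> x \<in> lpart L 0"
  shows "lie_module_isomorphic L (twisted_adjoint L \<phi>)
           (induced_module L (adjoint (even_part L)))"
proof -
  interpret lie_superalgebra L by fact
  have ex: "\<exists>f. lin (lscale L) (lscale L) f \<and> range f \<subseteq> lpart L p \<and> (\<forall>x\<in>lpart L p. f x = x) \<and>
      (\<forall>x\<in>lpart L (p + 1). f x = 0)" for p
    using exists_projection[OF scale part_subspace[of p] part_subspace[of "p + 1"]] part_direct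
    by (cases p) (auto simp: Int_commute)
  define pr where "pr p = (SOME f. lin (lscale L) (lscale L) f \<and> range f \<subseteq> lpart L p \<and>
      (\<forall>x\<in>lpart L p. f x = x) \<and> (\<forall>x\<in>lpart L (p + 1). f x = 0))" for p
  have pr: "lin (lscale L) (lscale L) (pr p)" "range (pr p) \<subseteq> lpart L p" "\<forall>x\<in>lpart L p. pr p x = x"
    "\<forall>x\<in>lpart L (p + 1). pr p x = 0" for p
    using someI_ex[OF ex[of p], folded pr_def] by blast+
  interpret lie_total L pr
  proof (intro lie_total.intro lie_total_axioms.intro lie_superalgebra_axioms)
    show "pr p x \<in> lpart L p" for p x using pr(2) by blast
    show "pr q x = 0" if "x \<in> lpart L p" "q \<noteq> p" for p q x
      using that pr(4)[of q] by (cases p; cases q) auto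
  qed (use pr in \<open>auto\<close>)
  have \<phi>: "x \<in> lcarrier L \<Longrightarrow> y \<in> lcarrier L \<Longrightarrow> \<phi> (x + y) = \<phi> x + \<phi> y"
    "x \<in> lcarrier L \<Longrightarrow> \<phi> (lscale L c x) = lscale L c (\<phi> x)"
    "x \<in> lpart L p \<Longrightarrow> \<phi> x \<in> lpart L p"
    "x \<in> lcarrier L \<Longrightarrow> y \<in> lcarrier L \<Longrightarrow> \<phi> (lbracket L x y) = lbracket L (\<phi> x) (\<phi> y)" for x y c p
    using assms(3) unfolding lie_automorphism_def by blast+
  note odd = lpart_lcarrier[of _ 1]
  (* The hypothesis on fixed points makes 1 - phi injective on the odd part. *)
  define h where "h x = pr 1 x - \<phi> (pr 1 x)" for x
  have hS: "h x = x - \<phi> x" if "x \<in> lpart L 1" for x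
    using pr(3)[of 1] that by (simp add: h_def)
  have hl: "lin (lscale L) (lscale L) h"
    unfolding h_def
    by (intro linI module_L)
      (simp_all add: lin_simps[OF pr(1)] \<phi>(1,2) odd[OF pr_in] module.scale_right_diff_distrib[OF module_L])
  have h1: "h ` lpart L 1 \<subseteq> lpart L 1"
    using hS \<phi>(3)[of _ 1] module.subspace_diff[OF module_L part_subspace[of 1]] by auto
  have h2: "inj_on h (lpart L 1)"
  proof (rule inj_onI)
    fix x y assume x: "x \<in> lpart L 1" and y: "y \<in> lpart L 1" and e: "h x = h y"
    have d: "x - y \<in> lpart L 1" by (rule module.subspace_diff[OF module_L part_subspace x y])
    have "h (x - y) = 0" using e by (simp add: lin_diff[OF hl])
    then have "\<phi> (x - y) = x - y" using hS[OF d] by simp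
    then have "x - y \<in> lpart L 0" using assms(5) odd[OF d] by blast
    then have "x - y \<in> {0}" unfolding part_direct[symmetric] using d by blast
    then show "x = y" by simp
  qed
  obtain B where B: "finite B" "module.span (lscale L) B = lcarrier L"
    using assms(2) unfolding finite_dimensional_def by blast
  have "lpart L 1 \<subseteq> module.span (lscale L) B" using odd B(2) by blast
  from exists_inverse_on_subspace[OF scale part_subspace hl h1 h2 B(1) this]
  obtain \<psi> where \<psi>: "lin (lscale L) (lscale L) \<psi>" "range \<psi> \<subseteq> lpart L 1"
    "\<forall>x\<in>lpart L 1. h (\<psi> x) = x" "\<forall>x\<in>lpart L 1. \<psi> (h x) = x" by blast
  have "lie_induced L pr \<phi> \<psi>"
  proof (intro lie_induced.intro lie_twisted.intro lie_total_axioms lie_twisted_axioms.intro)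
    fix x assume x: "x \<in> lpart L 1"
    show p: "\<psi> x \<in> lpart L 1" using \<psi>(2) by blast
    show "\<psi> x - \<phi> (\<psi> x) = x" using \<psi>(3) x hS[OF p] by simp
    show "\<psi> (x - \<phi> x) = x" unfolding hS[OF x, symmetric] using \<psi>(4) x by blast
  qed (use \<phi> \<psi>(1) assms(4) in auto)
  then interpret lie_induced L pr \<phi> \<psi> .
  show ?thesis by (rule isomorphic)
qed

end
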